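(* Let $p$ be an odd prime and $H\cong\mathbb{Z}_p^5$. Let $A<\mathrm{Aut}(H)$ be a $p$-group such that $|C_{H_R}(A)|\ge p^2$. Then the S-ring $V(H,A)$ is a CI-S-ring.
   Context: $H$ is written additively. For $h\in H$, $h_R\in\mathrm{Sym}(H)$ is the translation $x\mapsto x+h$, $H_R=\{h_R:h\in H\}$, and $\mathrm{Aut}(H)$ is regarded as a subgroup of $\mathrm{Sym}(H)$; $C_{H_R}(A)$ is the set of elements of $H_R$ commuting with every element of $A$. For $S\subseteq H$, $\mathrm{Cay}(H,S)$ is the digraph on $H$ with arcs $(x,x+s)$, $x\in H$, $s\in S$. A Schur ring (S-ring) over $H$ is a subalgebra $\mathcal A$ of the group algebra $\mathbb{Q}H$ for which there is a partition $\mathrm{Bs}(\mathcal A)$ of $H$ (the basic sets) with $\{0\}\in\mathrm{Bs}(\mathcal A)$, $-T\in\mathrm{Bs}(\mathcal A)$ for each $T\in\mathrm{Bs}(\mathcal A)$, and $\mathcal A$ spanned by the elements $\underline{T}=\sum_{t\in T}t$, $T\in\mathrm{Bs}(\mathcal A)$. For $A\le\mathrm{Aut}(H)$, $V(H,A)$ denotes the S-ring whose basic sets are the $A$-orbits on $H$. $\mathrm{Aut}(\mathcal A)=\bigcap_{T\in\mathrm{Bs}(\mathcal A)}\mathrm{Aut}(\mathrm{Cay}(H,T))$. A bijection $f:H\to H$ is an isomorphism from $\mathcal A$ to an S-ring over $H$ if there is an S-ring $\mathcal B$ over $H$ with $\{\mathrm{Cay}(H,T)^f:T\in\mathrm{Bs}(\mathcal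 A)\}=\{\mathrm{Cay}(H,S):S\in\mathrm{Bs}(\mathcal B)\}$ (where $\mathrm{Cay}(H,T)^f$ is the image digraph under $f$); $\mathrm{Iso}(\mathcal A)$ is the set of all such $f$. $\mathcal A$ is a CI-S-ring if $\mathrm{Iso}(\mathcal A)=\mathrm{Aut}(\mathcal A)\,\mathrm{Aut}(H)$ (products of permutations). *)

theory Defs
  imports Complex_Main "HOL-Combinatorics.Permutations" "HOL-Computational_Algebra.Primes"
begin

definition Zp5 :: "nat \<Rightarrow> (nat \<Rightarrow> int) set" where
  "Zp5 p = {v. \<forall>i. (i < 5 \<longrightarrow> 0 \<le> v i \<and> v i < int p) \<and> (5 \<le> i \<longrightarrow> v i = 0)}"

definition vadd :: "nat \<Rightarrow> (nat \<Rightarrow> int) \<Rightarrow> (nat \<Rightarrow> int) \<Rightarrow> (nat \<Rightarrow> int)" where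
  "vadd p x y = (\<lambda>i. (x i + y i) mod int p)"

definition vneg :: "nat \<Rightarrow> (nat \<Rightarrow> int) \<Rightarrow> (nat \<Rightarrow> int)" where
  "vneg p x = (\<lambda>i. (- x i) mod int p)"

definition vzero :: "nat \<Rightarrow> int" where
  "vzero = (\<lambda>_. 0)"

text \<open>Permutations of H are functions that permute the carrier and fix everything else.\<close>

definition transl :: "nat \<Rightarrow> (nat \<Rightarrow> int) \<Rightarrow> (nat \<Rightarrow> int) \<Rightarrow> (nat \<Rightarrow> int)" where
  "transl p h = (\<lambda>x. if x \<in> Zp5 p then vadd p x h else x)"

definition AutH :: "nat \<Rightarrow> ((nat \<Rightarrow> int) \<Rightarrow> (nat \<Rightarrow> int)) set" where
  "AutH p = {f. f permutes Zp5 p \<and>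
      (\<forall>x\<in>Zp5 p. \<forall>y\<in>Zp5 p. f (vadd p x y) = vadd p (f x) (f y))}"

definition perm_group :: "'a set \<Rightarrow> ('a \<Rightarrow> 'a) set \<Rightarrow> bool" where
  "perm_group X A \<longleftrightarrow> (\<forall>f\<in>A. f permutes X) \<and> id \<in> A \<and>
      (\<forall>f\<in>A. \<forall>g\<in>A. f \<circ> g \<in> A) \<and> (\<forall>f\<in>A. inv f \<in> A)"

definition centR :: "nat \<Rightarrow> ((nat \<Rightarrow> int) \<Rightarrow> (nat \<Rightarrow> int)) set
    \<Rightarrow> ((nat \<Rightarrow> int) \<Rightarrow> (nat \<Rightarrow> int)) set" where
  "centR p A = {transl p h | h. h \<in> Zp5 p \<and> (\<forall>a\<in>A. transl p h \<circ> a = a \<circ> transl p h)}"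

text \<open>Group algebra QH: functions H -> rat (zero off H); product is convolution.\<close>
definition gconv :: "nat \<Rightarrow> ((nat \<Rightarrow> int) \<Rightarrow> rat) \<Rightarrow> ((nat \<Rightarrow> int) \<Rightarrow> rat) \<Rightarrow> (nat \<Rightarrow> int) \<Rightarrow> rat" where
  "gconv p u v = (\<lambda>x. \<Sum>y\<in>Zp5 p. \<Sum>z\<in>Zp5 p. if vadd p y z = x then u y * v z else 0)"

text \<open>underline T = sum of the elements of T.\<close>
definition uline :: "(nat \<Rightarrow> int) set \<Rightarrow> (nat \<Rightarrow> int) \<Rightarrow> rat" where
  "uline T = (\<lambda>x. if x \<in> T then 1 else 0)"

definition qspan :: "(nat \<Rightarrow> int) set set \<Rightarrow> ((nat \<Rightarrow> int) \<Rightarrow> rat) set" where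
  "qspan S = {u. \<exists>c. u = (\<lambda>x. \<Sum>T\<in>S. c T * uline T x)}"

text \<open>S is the set of basic sets of an S-ring over H.\<close>
definition schur_ring :: "nat \<Rightarrow> (nat \<Rightarrow> int) set set \<Rightarrow> bool" where
  "schur_ring p S \<longleftrightarrow>
     (\<forall>T\<in>S. T \<noteq> {}) \<and> \<Union>S = Zp5 p \<and> (\<forall>T1\<in>S. \<forall>T2\<in>S. T1 \<noteq> T2 \<longrightarrow> T1 \<inter> T2 = {}) \<and>
     {vzero} \<in> S \<and> (\<forall>T\<in>S. vneg p ` T \<in> S) \<and>
     (\<forall>u\<in>qspan S. \<forall>v\<in>qspan S. gconv p u v \<in> qspan S)"

definition VHA :: "nat \<Rightarrow> ((nat \<Rightarrow> int) \<Rightarrow> (nat \<Rightarrow> int)) set \<Rightarrow> (nat \<Rightarrow> int) set set" where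
  "VHA p A = (\<lambda>x. (\<lambda>a. a x) ` A) ` Zp5 p"

definition cay :: "nat \<Rightarrow> (nat \<Rightarrow> int) set \<Rightarrow> ((nat \<Rightarrow> int) \<times> (nat \<Rightarrow> int)) set" where
  "cay p T = {(x, vadd p x s) | x s. x \<in> Zp5 p \<and> s \<in> T}"

definition AutS :: "nat \<Rightarrow> (nat \<Rightarrow> int) set set \<Rightarrow> ((nat \<Rightarrow> int) \<Rightarrow> (nat \<Rightarrow> int)) set" where
  "AutS p S = {f. f permutes Zp5 p \<and> (\<forall>T\<in>S. map_prod f f ` cay p T = cay p T)}"

definition IsoS :: "nat \<Rightarrow> (nat \<Rightarrow> int) set set \<Rightarrow> ((nat \<Rightarrow> int) \<Rightarrow> (nat \<Rightarrow> int)) set" where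
  "IsoS p S = {f. f permutes Zp5 p \<and>
      (\<exists>B. schur_ring p B \<and> (\<lambda>T. map_prod f f ` cay p T) ` S = cay p ` B)}"

text \<open>CI-S-ring: Iso(A) = Aut(A) Aut(H), products of permutations composed left to right
  (first the element of Aut(A), then the element of Aut(H)).\<close>
definition CI_schur_ring :: "nat \<Rightarrow> (nat \<Rightarrow> int) set set \<Rightarrow> bool" where
  "CI_schur_ring p S \<longleftrightarrow> schur_ring p S \<and>
     IsoS p S = {\<sigma> \<circ> a | a \<sigma>. a \<in> AutS p S \<and> \<sigma> \<in> AutH p}"

end

(*
  A function f commutes with the orbit relation of the p-group A if f (x + T) = f x + f T for all orbits T.
  By Schur's theorem on multipliers, x |-> (1/t) f (t x) has the same effect on orbits as f for every t
  prime to p; averaging these functions along an A-invariant flag makes f homogeneous, f (k x) = k f x,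
  without changing f T for any orbit T. Homogeneity is the key: a homogeneous function that is additive
  (modulo a subgroup) along a subspace of codimension 1 is additive. Hence, writing H > N > W > 0 with
  W fixed by A, |W| = p^2 and |N| = p^3, f is linear modulo f N and on N, so one may assume that
  f x = x + h(x) e + phi(x) with N = W + <e> and phi with values in W. If h is linear, linear algebra in
  the plane W yields a linear L with L T = f T for all orbits T. Otherwise every orbit outside N moves in
  direction e along a parabola, and its curvature either vanishes modulo the stabiliser of the orbit in W
  or forces h to be affine along one direction q; as p is odd, q is unique modulo N, and L can be read off
  from the values of f at q and at one further vector.
*)
theory Submission
  imports Defs "HOL-Library.Function_Algebras" "HOL-Number_Theory.Cong"
begin

subsection \<open>Integer multiples and subgroups\<close>

text \<open>An isomorphism with \<open>f 0 = 0\<close> satisfies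
  \<open>f (x + v) = f x + f (a v)\<close> for some \<open>a\<close> in \<open>A\<close> that
  depends on both \<open>x\<close> and \<open>v\<close>. If \<open>L\<close> is linear and every
  \<open>f v\<close> has the form \<open>L (a v)\<close>, then \<open>b\<close>, the inverse of
  \<open>L\<close> after \<open>f\<close>, satisfies \<open>b (x + v) - b x \<in> orb v\<close>. So
  \<open>b\<close> preserves the Cayley digraph of every orbit, and \<open>f\<close> is the product
  of \<open>b\<close> and \<open>L\<close>: the CI property is the existence of \<open>L\<close>.
  The obstacle is the free choice of \<open>a\<close>. The function \<open>f\<close> is additive
  only up to orbits, and the corrections that different orbits allow have to be met by one linear
  map. The ranks are just small enough for this: \<open>W\<close> has rank 2, so distinct lines in
  it meet in 0; \<open>H/W\<close> has rank 3, so two directions of additivity over \<open>W\<close>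
  already reach codimension 1; and \<open>H/N\<close> has rank 2, so one exceptional direction and
  one further vector span it. Oddness of \<open>p\<close> is used for halving, both to write an
  orbit as a parabola and to cancel the factor 2 in second differences of \<open>h\<close>.\<close>

definition ism :: "int \<Rightarrow> 'v::ab_group_add \<Rightarrow> 'v"  (infixr "\<cdot>" 75)
  where "k \<cdot> x = (\<Sum>i<nat k. x) - (\<Sum>i<nat (- k). x)"

text \<open>Every splitting of an integer into two naturals gives the same value, so later
  identities for \<open>ism\<close> reduce to sums over naturals without a distinction of
  signs.\<close>

lemma ism_diff_nat: "(int a - int b) \<cdot> x = (\<Sum>i<a. x) - (\<Sum>i<b. x)" for x :: "'v::ab_group_add"
proof -
  have add: "(\<Sum>i<m + n. x) = (\<Sum>i<m. x) + (\<Sum>i<n. x)" for m n :: nat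
    by (induction n) (simp_all add: algebra_simps)
  show ?thesis
  proof (cases "b \<le> a")
    case True
    then show ?thesis using add[of b "a - b"] by (simp add: ism_def nat_diff_distrib')
  next
    case False
    then show ?thesis using add[of a "b - a"] by (simp add: ism_def nat_diff_distrib')
  qed
qed

lemma ism_add_left: "(k + l) \<cdot> x = k \<cdot> x + l \<cdot> x" for x :: "'v::ab_group_add"
proof -
  obtain a b c d where k: "k = int a - int b" and l: "l = int c - int d"
    by (metis int_diff_cases)
  have add: "(\<Sum>i<m + n. x) = (\<Sum>i<m. x) + (\<Sum>i<n. x)" for m n :: nat
    by (induction n) (simp_all add: algebra_simps)
  have "k + l = int (a + c) - int (b + d)" using k l by simp
  then have "(k + l) \<cdot> x = (\<Sum>i<a + c. x) - (\<Sum>i<b + d. x)" by (simp only: ism_diff_nat)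
  then show ?thesis unfolding k l ism_diff_nat add by (simp add: algebra_simps)
qed

lemma ism_1 [simp]: "1 \<cdot> x = x" by (simp add: ism_def)

lemma ism_0 [simp]: "0 \<cdot> x = 0" by (simp add: ism_def)

lemma ism_minus_left [simp]: "(- k) \<cdot> x = - (k \<cdot> x)"
  using ism_add_left[of k "- k" x] by (simp add: eq_neg_iff_add_eq_0 add.commute)

lemma ism_diff_left: "(k - l) \<cdot> x = k \<cdot> x - l \<cdot> x"
  using ism_add_left[of k "- l" x] by simp

lemma ism_add_right: "k \<cdot> (x + y) = k \<cdot> x + k \<cdot> y"
  by (simp add: ism_def sum.distrib algebra_simps)

lemma ism_zero_right [simp]: "k \<cdot> 0 = 0" by (simp add: ism_def)

lemma ism_minus_right [simp]: "k \<cdot> (- x) = - (k \<cdot> x)"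
  by (simp add: ism_def sum_negf)

lemma ism_diff_right: "k \<cdot> (x - y) = k \<cdot> x - k \<cdot> y"
  using ism_add_right[of k x "- y"] by simp

lemma ism_mult: "(k * l) \<cdot> x = k \<cdot> l \<cdot> x"
proof (induction k rule: int_induct[where k = 0])
  case (step1 i) then show ?case by (simp add: ism_add_left distrib_right)
next
  case (step2 i) then show ?case by (simp add: ism_diff_left left_diff_distrib)
qed simp

lemma ism_sum: "k \<cdot> sum g S = (\<Sum>i\<in>S. k \<cdot> g i)"
  by (induction S rule: infinite_finite_induct) (simp_all add: ism_add_right)

lemmas ism_distribs = ism_add_left ism_add_right ism_diff_left ism_diff_right

section \<open>Subgroups and functions additive on them\<close>

definition asub :: "'v::ab_group_add set \<Rightarrow> bool"
  where "asub N \<longleftrightarrow> 0 \<in> N \<and> (\<forall>x\<in>N. \<forall>y\<in>N. x - y \<in> N)"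

lemma asub_0: "asub N \<Longrightarrow> 0 \<in> N" by (simp add: asub_def)
lemma asub_diff: "asub N \<Longrightarrow> x \<in> N \<Longrightarrow> y \<in> N \<Longrightarrow> x - y \<in> N" by (simp add: asub_def)
lemma asub_minus: "asub N \<Longrightarrow> x \<in> N \<Longrightarrow> - x \<in> N" by (metis asub_def diff_0)
lemma asub_add: "asub N \<Longrightarrow> x \<in> N \<Longrightarrow> y \<in> N \<Longrightarrow> x + y \<in> N"
  by (metis asub_diff asub_minus diff_minus_eq_add)

lemma asub_sum: "asub N \<Longrightarrow> (\<And>i. i \<in> S \<Longrightarrow> g i \<in> N) \<Longrightarrow> sum g S \<in> N"
  by (induction S rule: infinite_finite_induct) (auto simp: asub_0 asub_add)

lemma asub_ism: "asub N \<Longrightarrow> x \<in> N \<Longrightarrow> k \<cdot> x \<in> N"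
  by (simp add: ism_def asub_diff asub_sum)

lemmas asub_intros = asub_0 asub_diff asub_minus asub_add asub_ism

lemma asub_add_iff: "asub N \<Longrightarrow> x \<in> N \<Longrightarrow> x + y \<in> N \<longleftrightarrow> y \<in> N"
  by (metis add_diff_cancel_left' asub_add asub_diff)

text \<open>For a subgroup \<open>N\<close> this is the subgroup generated by \<open>N\<close> and
  \<open>v\<close>. Adjoining vectors one at a time, together with counting elements, stands in for
  bases and dimension.\<close>

definition adj :: "'v::ab_group_add set \<Rightarrow> 'v \<Rightarrow> 'v set"
  where "adj N v = {n + k \<cdot> v | n k. n \<in> N}"

lemma adjI: "n \<in> N \<Longrightarrow> n + k \<cdot> v \<in> adj N v" by (auto simp: adj_def)

lemma adjE:
  assumes "x \<in> adj N v" obtains n k where "n \<in> N" "x = n + k \<cdot> v"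
  using assms by (auto simp: adj_def)

lemma asub_adj: assumes "asub N" shows "asub (adj N v)"
  unfolding asub_def
proof (intro conjI ballI)
  show "0 \<in> adj N v" using adjI[OF asub_0[OF assms], of 0 v] by simp
next
  fix x y assume "x \<in> adj N v" "y \<in> adj N v"
  then obtain n k m l where "n \<in> N" "x = n + k \<cdot> v" "m \<in> N" "y = m + l \<cdot> v" by (metis adjE)
  then have "x - y = (n - m) + (k - l) \<cdot> v" "n - m \<in> N"
    using assms by (simp_all add: ism_diff_left asub_diff)
  then show "x - y \<in> adj N v" using adjI by metis
qed

lemma adj_superset: "N \<subseteq> adj N v"
proof
  fix n assume "n \<in> N" then show "n \<in> adj N v" using adjI[of n N 0 v] by simp
qed

lemma adj_self: "asub N \<Longrightarrow> v \<in> adj N v" using adjI[OF asub_0, of N 1 v] by simp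

lemma adj_subset: "asub M \<Longrightarrow> N \<subseteq> M \<Longrightarrow> v \<in> M \<Longrightarrow> adj N v \<subseteq> M"
  by (auto simp: adj_def intro!: asub_intros)

definition add_on :: "'v::ab_group_add set \<Rightarrow> ('v \<Rightarrow> 'w::ab_group_add) \<Rightarrow> bool"
  where "add_on N g \<longleftrightarrow> (\<forall>x\<in>N. \<forall>y\<in>N. g (x + y) = g x + g y)"

lemma add_onD: "add_on N g \<Longrightarrow> x \<in> N \<Longrightarrow> y \<in> N \<Longrightarrow> g (x + y) = g x + g y"
  by (simp add: add_on_def)

lemma add_on_0: "asub N \<Longrightarrow> add_on N g \<Longrightarrow> g 0 = 0"
  using add_onD[of N g 0 0] asub_0 by force

lemma add_on_minus: "asub N \<Longrightarrow> add_on N g \<Longrightarrow> x \<in> N \<Longrightarrow> g (- x) = - g x"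
  using add_onD[of N g x "- x"] add_on_0[of N g] asub_minus[of N x]
  by (simp add: eq_neg_iff_add_eq_0 add.commute)

lemma add_on_diff: "asub N \<Longrightarrow> add_on N g \<Longrightarrow> x \<in> N \<Longrightarrow> y \<in> N \<Longrightarrow> g (x - y) = g x - g y"
  using add_onD[of N g x "- y"] add_on_minus[of N g y] asub_minus[of N y] by simp

lemma add_on_ism: assumes "asub N" "add_on N g" "x \<in> N" shows "g (k \<cdot> x) = k \<cdot> g x"
proof (induction k rule: int_induct[where k = 0])
  case base show ?case using add_on_0 assms by simp
next
  case (step1 i) then show ?case using add_onD[OF assms(2), of "i \<cdot> x" x] assms
    by (simp add: ism_add_left asub_ism)
next
  case (step2 i) then show ?case using add_on_diff[OF assms(1,2), of "i \<cdot> x" x] assms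
    by (simp add: ism_diff_left asub_ism)
qed

lemma add_on_inj:
  assumes "asub N" "add_on N g" "\<And>x. x \<in> N \<Longrightarrow> g x = 0 \<Longrightarrow> x = 0"
  shows "inj_on g N"
proof (rule inj_onI)
  fix x y assume "x \<in> N" "y \<in> N" "g x = g y"
  then have "g (x - y) = 0" "x - y \<in> N" using add_on_diff[OF assms(1,2)] assms(1) by (auto intro: asub_diff)
  then show "x = y" using assms(3) by fastforce
qed

section \<open>Linear algebra over the prime field inside a group type\<close>

locale elem_ab =
  fixes p :: nat and H :: "'v::ab_group_add set"
  assumes prime_p: "prime p" and asub_H: "asub H" and fin_H: "finite H"
    and p_H: "\<And>x. x \<in> H \<Longrightarrow> int p \<cdot> x = 0"
begin

lemma p_pos: "p > 0" "p > 1" using prime_p prime_gt_1_nat prime_gt_0_nat by auto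

lemma ism_cong: "x \<in> H \<Longrightarrow> [k = l] (mod int p) \<Longrightarrow> k \<cdot> x = l \<cdot> x"
proof -
  assume x: "x \<in> H" and "[k = l] (mod int p)"
  then obtain m where "k - l = m * int p" by (metis cong_iff_dvd_diff dvd_def mult.commute)
  then have "(k - l) \<cdot> x = 0" using p_H[OF x] by (simp add: ism_mult)
  then show ?thesis by (simp add: ism_diff_left)
qed

lemma inverse_mod_p:
  assumes "\<not> int p dvd k" obtains l where "[l * k = 1] (mod int p)"
proof -
  have "coprime k (int p)" using assms prime_p
    by (metis coprime_commute prime_imp_coprime prime_nat_int_transfer)
  then show ?thesis using that by (metis cong_solve_coprime_int mult.commute)
qed

lemma ism_mem_cancel:
  assumes "asub N" "v \<in> H" "k \<cdot> v \<in> N" "\<not> int p dvd k" shows "v \<in> N"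
proof -
  obtain l where "[l * k = 1] (mod int p)" using inverse_mod_p[OF assms(4)] .
  then have "(l * k) \<cdot> v = v" using ism_cong[OF assms(2)] by (metis ism_1)
  then show ?thesis using asub_ism[OF assms(1,3), of l] by (simp add: ism_mult)
qed

lemma ism_mem_iff:
  assumes "asub N" "v \<in> H" "v \<notin> N" shows "k \<cdot> v \<in> N \<longleftrightarrow> int p dvd k"
proof
  show "k \<cdot> v \<in> N \<Longrightarrow> int p dvd k" using ism_mem_cancel assms by blast
  assume "int p dvd k"
  then have "k \<cdot> v = 0" using ism_cong[OF assms(2), of k 0] by (simp add: cong_0_iff)
  then show "k \<cdot> v \<in> N" using asub_0 assms by simp
qed

lemma adj_unique:
  assumes "asub N" "v \<in> H" "v \<notin> N" "n \<in> N" "m \<in> N" "n + k \<cdot> v = m + l \<cdot> v"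
  shows "n = m" "[k = l] (mod int p)"
proof -
  have "(k - l) \<cdot> v = m - n" using assms(6) by (simp add: ism_diff_left algebra_simps)
  then have "(k - l) \<cdot> v \<in> N" using assms asub_diff by metis
  then show "[k = l] (mod int p)" using ism_mem_iff assms by (simp add: cong_iff_dvd_diff)
  then show "n = m" using assms ism_cong by (metis add_right_cancel)
qed

lemma adj_nonneg:
  assumes "v \<in> H" "x \<in> adj N v" obtains n k where "n \<in> N" "x = n + k \<cdot> v" "0 \<le> k" "k < int p"
proof -
  obtain n k where "n \<in> N" "x = n + k \<cdot> v" using assms adjE by metis
  moreover have "k \<cdot> v = (k mod int p) \<cdot> v" using ism_cong[OF assms(1)] by simp
  ultimately show ?thesis using that[of n "k mod int p"] p_pos by simp
qed

lemma card_adj: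
  assumes "asub N" "N \<subseteq> H" "v \<in> H" "v \<notin> N" shows "card (adj N v) = p * card N"
proof -
  have "adj N v = (\<lambda>(n, k). n + k \<cdot> v) ` (N \<times> {0..<int p})"
  proof
    show "adj N v \<subseteq> (\<lambda>(n, k). n + k \<cdot> v) ` (N \<times> {0..<int p})"
    proof
      fix x assume "x \<in> adj N v"
      then obtain n k where "n \<in> N" "x = n + k \<cdot> v" "0 \<le> k" "k < int p"
        using adj_nonneg assms(3) by metis
      then show "x \<in> (\<lambda>(n, k). n + k \<cdot> v) ` (N \<times> {0..<int p})" by force
    qed
  qed (auto intro: adjI)
  moreover have "inj_on (\<lambda>(n, k). n + k \<cdot> v) (N \<times> {0..<int p})"
  proof (rule inj_onI, clarify)
    fix n k m l assume a: "n \<in> N" "m \<in> N" "k \<in> {0..<int p}" "l \<in> {0..<int p}" "n + k \<cdot> v = m + l \<cdot> v"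
    show "n = m \<and> k = l"
      using adj_unique[OF assms(1,3,4) a(1,2,5)] a(3,4) by (simp add: cong_def)
  qed
  ultimately show ?thesis by (simp add: card_image card_cartesian_product mult.commute)
qed

lemma adj_in_H: "N \<subseteq> H \<Longrightarrow> v \<in> H \<Longrightarrow> adj N v \<subseteq> H" using adj_subset asub_H by blast

lemma proper_extend:
  assumes "asub N" "N \<subseteq> H" "card N = p ^ j" "card H = p ^ i" "j < i"
  obtains v where "v \<in> H" "v \<notin> N" "asub (adj N v)" "adj N v \<subseteq> H" "card (adj N v) = p ^ Suc j"
proof -
  have "card N < card H" using assms p_pos by (simp add: power_strict_increasing)
  then obtain v where "v \<in> H" "v \<notin> N" using assms(2) by (metis nat_less_le subset_antisym subsetI)
  then show ?thesis using that card_adj[of N v] assms asub_adj adj_in_H by auto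
qed

lemma adj_eq_H:
  assumes "asub N" "N \<subseteq> H" "card N = p ^ j" "card H = p ^ Suc j" "v \<in> H" "v \<notin> N"
  shows "adj N v = H"
  using card_subset_eq[OF fin_H adj_in_H] card_adj assms by simp

text \<open>In \<open>n + k \<cdot> v\<close> the part \<open>n\<close> is determined and
  \<open>k\<close> is determined modulo \<open>p\<close>; the value \<open>u\<close> at
  \<open>v\<close> can be prescribed because \<open>p\<close> annihilates it.\<close>

lemma extend_adj:
  fixes g :: "'v \<Rightarrow> 'w::ab_group_add"
  assumes N: "asub N" "N \<subseteq> H" and v: "v \<in> H" "v \<notin> N" and g: "add_on N g"
    and u: "int p \<cdot> u = 0"
  obtains g' where "add_on (adj N v) g'" "\<And>n k. n \<in> N \<Longrightarrow> g' (n + k \<cdot> v) = g n + k \<cdot> u"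
proof -
  define g' where "g' x = (SOME y. \<exists>n k. n \<in> N \<and> x = n + k \<cdot> v \<and> y = g n + k \<cdot> u)" for x
  have val: "g' (n + k \<cdot> v) = g n + k \<cdot> u" if n: "n \<in> N" for n k
  proof -
    let ?P = "\<lambda>y. \<exists>m l. m \<in> N \<and> n + k \<cdot> v = m + l \<cdot> v \<and> y = g m + l \<cdot> u"
    have "?P (g' (n + k \<cdot> v))" unfolding g'_def by (rule someI[of ?P "g n + k \<cdot> u"]) (use n in blast)
    then obtain m l where ml: "m \<in> N" "n + k \<cdot> v = m + l \<cdot> v" "g' (n + k \<cdot> v) = g m + l \<cdot> u" by blast
    have "n = m" "[k = l] (mod int p)" using adj_unique[OF N(1) v n ml(1,2)] by auto
    moreover obtain c where "k - l = c * int p"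
      by (metis calculation(2) cong_iff_dvd_diff dvd_def mult.commute)
    then have "(k - l) \<cdot> u = 0" using u by (simp add: ism_mult)
    ultimately show ?thesis using ml by (simp add: ism_diff_left)
  qed
  have "add_on (adj N v) g'" unfolding add_on_def
  proof (intro ballI)
    fix x y assume "x \<in> adj N v" "y \<in> adj N v"
    then obtain n k m l where *: "n \<in> N" "x = n + k \<cdot> v" "m \<in> N" "y = m + l \<cdot> v" by (metis adjE)
    then have "x + y = (n + m) + (k + l) \<cdot> v" "n + m \<in> N"
      using N by (simp_all add: ism_add_left asub_add)
    then have "g' (x + y) = g (n + m) + (k + l) \<cdot> u" using val by metis
    then show "g' (x + y) = g' x + g' y" using * val[of n k] val[of m l] add_onD[OF g]
      by (simp add: ism_add_left)
  qed
  then show ?thesis using that val by blast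
qed

text \<open>Vectors outside \<open>N\<close> are adjoined one at a time and sent to their values
  under \<phi>. As \<phi> is linear modulo \<open>M\<close>, the extension stays within
  \<open>M\<close> of \<phi>.\<close>

lemma extend_add_mod:
  fixes g \<phi> :: "'v \<Rightarrow> 'w::ab_group_add"
  assumes "asub N" "N \<subseteq> H" "add_on N g" "\<forall>n\<in>N. g n - \<phi> n \<in> M"
    and M: "asub M" and \<phi>p: "\<And>x. x \<in> H \<Longrightarrow> int p \<cdot> \<phi> x = 0"
    and \<phi>k: "\<And>x k. x \<in> H \<Longrightarrow> \<phi> (k \<cdot> x) - k \<cdot> \<phi> x \<in> M"
    and \<phi>add: "\<And>x y. x \<in> H \<Longrightarrow> y \<in> H \<Longrightarrow> \<phi> (x + y) - \<phi> x - \<phi> y \<in> M"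
  shows "\<exists>g'. add_on H g' \<and> (\<forall>n\<in>N. g' n = g n) \<and> (\<forall>x\<in>H. g' x - \<phi> x \<in> M)"
  using assms(1-4)
proof (induction "card H - card N" arbitrary: N g rule: less_induct)
  case less
  show ?case
  proof (cases "N = H")
    case True then show ?thesis using less.prems by blast
  next
    case False
    then obtain v where v: "v \<in> H" "v \<notin> N" using less.prems by blast
    obtain g' where g': "add_on (adj N v) g'" "\<And>n k. n \<in> N \<Longrightarrow> g' (n + k \<cdot> v) = g n + k \<cdot> \<phi> v"
      using extend_adj[OF less.prems(1,2) v less.prems(3) \<phi>p[OF v(1)]] by blast
    have sub: "adj N v \<subseteq> H" using less.prems(2) adj_in_H v by blast
    have "N \<subset> adj N v" using adj_superset adj_self less.prems(1) v by blast
    then have "card N < card (adj N v)" using sub fin_H by (meson finite_subset psubset_card_mono)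
    then have small: "card H - card (adj N v) < card H - card N"
      using sub fin_H by (meson card_mono diff_less_mono2 less_le_trans)
    have near: "\<forall>x\<in>adj N v. g' x - \<phi> x \<in> M"
    proof
      fix x assume "x \<in> adj N v"
      then obtain n k where x: "n \<in> N" "x = n + k \<cdot> v" by (metis adjE)
      have nH: "n \<in> H" "k \<cdot> v \<in> H" using x(1) v less.prems(2) asub_H asub_ism by blast+
      \<comment> \<open>The error at \<open>n + k \<cdot> v\<close> is the error at
        \<open>n\<close>, corrected by an additivity defect and a homogeneity defect of
        \<phi>.\<close>
      have "(g n - \<phi> n) - (\<phi> (n + k \<cdot> v) - \<phi> n - \<phi> (k \<cdot> v)) - (\<phi> (k \<cdot> v) - k \<cdot> \<phi> v) \<in> M"
        using asub_diff[OF M asub_diff[OF M bspec[OF less.prems(4) x(1)] \<phi>add[OF nH]] \<phi>k[OF v(1)]] .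
      then show "g' x - \<phi> x \<in> M" using g'(2)[OF x(1), of k] x(2) by (simp add: algebra_simps)
    qed
    obtain g'' where g'': "add_on H g''" "\<forall>n\<in>adj N v. g'' n = g' n" "\<forall>x\<in>H. g'' x - \<phi> x \<in> M"
      using less.hyps[OF small asub_adj[OF less.prems(1)] sub g'(1) near] by blast
    moreover have "g'' n = g n" if "n \<in> N" for n
      using g''(2) adj_superset[of N v] that g'(2)[OF that, of 0] by auto
    ultimately show ?thesis by blast
  qed
qed

end

subsection \<open>Orbits and isomorphisms\<close>

locale lin_act = elem_ab p H for p :: nat and H :: "'v::ab_group_add set" +
  fixes A :: "('v \<Rightarrow> 'v) set"
  assumes perm_A: "perm_group H A" and add_A: "\<And>a. a \<in> A \<Longrightarrow> add_on H a"
begin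

definition orb :: "'v \<Rightarrow> 'v set" where "orb v = (\<lambda>a. a v) ` A"

text \<open>The image of an out-neighbourhood \<open>x + T\<close> is \<open>f x\<close> plus the
  image of \<open>T\<close>; that is, the Cayley digraph of each orbit goes to a Cayley digraph.
  Fixing 0 is a normalisation, reached by a translation.\<close>

definition iso :: "('v \<Rightarrow> 'v) \<Rightarrow> bool" where
  "iso f \<longleftrightarrow> bij_betw f H H \<and> f 0 = 0 \<and>
     (\<forall>x\<in>H. \<forall>v\<in>H. f ` (+) x ` orb v = (+) (f x) ` f ` orb v)"

lemma A_H [simp, intro]: "a \<in> A \<Longrightarrow> x \<in> H \<Longrightarrow> a x \<in> H"
  using perm_A permutes_in_image unfolding perm_group_def by metis

lemma A_comp: "a \<in> A \<Longrightarrow> b \<in> A \<Longrightarrow> a \<circ> b \<in> A"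
  using perm_A unfolding perm_group_def by blast

lemma A_inverse: assumes "a \<in> A" obtains b where "b \<in> A" "\<And>x. b (a x) = x" "\<And>x. a (b x) = x"
proof
  have "a permutes H" using perm_A assms unfolding perm_group_def by blast
  then show "inv a (a x) = x" "a (inv a x) = x" for x by (simp_all add: permutes_inverses)
  show "inv a \<in> A" using perm_A assms unfolding perm_group_def by blast
qed

lemma A_add: "a \<in> A \<Longrightarrow> x \<in> H \<Longrightarrow> y \<in> H \<Longrightarrow> a (x + y) = a x + a y"
  using add_A add_onD by blast

lemma A_ism: "a \<in> A \<Longrightarrow> x \<in> H \<Longrightarrow> a (k \<cdot> x) = k \<cdot> a x"
  using add_A add_on_ism asub_H by blast

lemma A_0 [simp]: "a \<in> A \<Longrightarrow> a 0 = 0"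
  using add_A add_on_0 asub_H by blast

lemma orb_self [simp, intro]: "v \<in> orb v"
  using perm_A unfolding perm_group_def orb_def by (metis id_apply image_eqI)

lemma orb_mem_A: "w \<in> orb v \<Longrightarrow> a \<in> A \<Longrightarrow> a w \<in> orb v"
  unfolding orb_def using A_comp by (metis (no_types, lifting) comp_apply image_iff)

lemma orb_trans: "u \<in> orb w \<Longrightarrow> w \<in> orb v \<Longrightarrow> u \<in> orb v"
  using orb_mem_A unfolding orb_def[of w] by blast

lemma orb_sym: "w \<in> orb v \<Longrightarrow> v \<in> orb w"
  unfolding orb_def using A_inverse by (metis (no_types, lifting) image_iff)

lemma orb_eq: "w \<in> orb v \<Longrightarrow> orb w = orb v"
  using orb_sym orb_trans by blast

lemma orb_H: "v \<in> H \<Longrightarrow> orb v \<subseteq> H"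
  by (auto simp: orb_def)

lemma finite_orb: "v \<in> H \<Longrightarrow> finite (orb v)"
  using orb_H fin_H finite_subset by blast

lemma orb_ism: "v \<in> H \<Longrightarrow> orb (k \<cdot> v) = (\<cdot>) k ` orb v"
  by (auto simp: orb_def A_ism image_image)

text \<open>The third assumption yields one inclusion of sets. Both sides have
  \<open>card (orb v)\<close> elements by injectivity, so the inclusion is an equality.\<close>

lemma isoI:
  assumes "bij_betw f H H" "f 0 = 0"
    "\<And>x v. x \<in> H \<Longrightarrow> v \<in> H \<Longrightarrow> \<exists>a\<in>A. f (x + v) = f x + f (a v)"
  shows "iso f"
  unfolding iso_def
proof (intro conjI ballI assms(1,2))
  fix x v assume x: "x \<in> H" and v: "v \<in> H"
  have sub: "f ` (+) x ` orb v \<subseteq> (+) (f x) ` f ` orb v"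
  proof
    fix y assume "y \<in> f ` (+) x ` orb v"
    then obtain w where w: "w \<in> orb v" "y = f (x + w)" by blast
    then obtain a where "a \<in> A" "y = f x + f (a w)" using assms(3)[OF x, of w] orb_H v by blast
    then show "y \<in> (+) (f x) ` f ` orb v" using orb_mem_A w by blast
  qed
  have inj: "inj_on f S" if "S \<subseteq> H" for S
    using assms(1) that unfolding bij_betw_def by (meson inj_on_subset)
  have "(+) x ` orb v \<subseteq> H" using orb_H v x asub_H by (auto intro: asub_add)
  then have "card (f ` (+) x ` orb v) = card (orb v)" by (simp add: card_image inj)
  moreover have "card ((+) (f x) ` f ` orb v) = card (orb v)"
    using orb_H v by (simp add: card_image inj)
  ultimately show "f ` (+) x ` orb v = (+) (f x) ` f ` orb v"
    using sub finite_orb[OF v] by (intro card_subset_eq) auto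
qed

lemma iso_bij: "iso f \<Longrightarrow> bij_betw f H H" and iso_0: "iso f \<Longrightarrow> f 0 = 0"
  by (simp_all add: iso_def)

lemma iso_H: "iso f \<Longrightarrow> x \<in> H \<Longrightarrow> f x \<in> H"
  using iso_bij bij_betwE by blast

lemma iso_inj: "iso f \<Longrightarrow> x \<in> H \<Longrightarrow> y \<in> H \<Longrightarrow> f x = f y \<longleftrightarrow> x = y"
  using iso_bij by (metis bij_betw_def inj_on_eq_iff)

lemma iso_image: "iso f \<Longrightarrow> x \<in> H \<Longrightarrow> v \<in> H \<Longrightarrow> f ` (+) x ` orb v = (+) (f x) ` f ` orb v"
  by (simp add: iso_def)

lemma iso_step:
  assumes "iso f" "x \<in> H" "v \<in> H" obtains a where "a \<in> A" "f (x + v) = f x + f (a v)"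
proof -
  have "f (x + v) \<in> (+) (f x) ` f ` orb v" using iso_image[OF assms] orb_self by blast
  then show ?thesis using that by (auto simp: orb_def)
qed

lemma iso_step_rev:
  assumes "iso f" "x \<in> H" "v \<in> H" obtains a where "a \<in> A" "f (x + a v) = f x + f v"
proof -
  have "f x + f v \<in> f ` (+) x ` orb v" using iso_image[OF assms] orb_self by blast
  then show ?thesis using that by (auto simp: orb_def)
qed

text \<open>The same statement for in-neighbours: the step by \<open>w\<close> from
  \<open>x - w\<close> ends at \<open>x\<close>. Equality again comes from counting.\<close>

lemma iso_image_diff:
  assumes "iso f" "x \<in> H" "v \<in> H"
  shows "f ` (-) x ` orb v = (-) (f x) ` f ` orb v"
proof -
  have sub: "f ` (-) x ` orb v \<subseteq> (-) (f x) ` f ` orb v"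
  proof
    fix y assume "y \<in> f ` (-) x ` orb v"
    then obtain w where w: "w \<in> orb v" "y = f (x - w)" by blast
    then have "w \<in> H" using orb_H assms by blast
    then obtain a where "a \<in> A" "f (x - w + w) = f (x - w) + f (a w)"
      using iso_step[of f "x - w" w] assms asub_H by (metis asub_diff)
    then have "y = f x - f (a w)" using w by (simp add: algebra_simps)
    then show "y \<in> (-) (f x) ` f ` orb v" using orb_mem_A[OF w(1) \<open>a \<in> A\<close>] by blast
  qed
  have inj: "inj_on f S" if "S \<subseteq> H" for S
    using assms(1) that iso_bij unfolding bij_betw_def by (meson inj_on_subset)
  have "(-) x ` orb v \<subseteq> H" using orb_H assms asub_H by (auto intro: asub_diff)
  then have "card (f ` (-) x ` orb v) = card ((-) x ` orb v)" by (rule card_image[OF inj])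
  also have "\<dots> = card (orb v)" by (simp add: card_image inj_on_def)
  finally have "card (f ` (-) x ` orb v) = card (orb v)" .
  moreover have "card ((-) (f x) ` f ` orb v) = card (orb v)"
    using orb_H assms by (simp add: card_image inj inj_on_def[of "(-) (f x)"])
  ultimately show ?thesis
    using sub finite_orb assms by (intro card_subset_eq) auto
qed

end

subsection \<open>Schur's theorem on multipliers\<close>

text \<open>The number of ways to reach \<open>x\<close> from 0 by \<open>k\<close> steps from
  \<open>S\<close>, that is, the coefficient of \<open>x\<close> in the \<open>k\<close>-th power of
  the sum of \<open>S\<close> in the group ring.\<close>

fun walks :: "'v::ab_group_add set \<Rightarrow> nat \<Rightarrow> 'v \<Rightarrow> nat" where
  "walks S 0 x = (if x = 0 then 1 else 0)"
| "walks S (Suc k) x = (\<Sum>s\<in>S. walks S k (x - s))"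

text \<open>The binomial theorem in the commutative group ring; \<open>j\<close> counts the factors
  equal to \<open>s\<close>.\<close>

lemma walks_insert:
  assumes "finite S" "s \<notin> S"
  shows "walks (insert s S) k x = (\<Sum>j\<le>k. (k choose j) * walks S (k - j) (x - int j \<cdot> s))"
proof (induction k arbitrary: x)
  case (Suc k)
  let ?w = "\<lambda>i j. walks S i (x - int j \<cdot> s)"
  have "walks (insert s S) (Suc k) x =
      (\<Sum>j\<le>k. (k choose j) * ?w (k - j) (Suc j)) + (\<Sum>t\<in>S. \<Sum>j\<le>k. (k choose j) * walks S (k - j) (x - t - int j \<cdot> s))"
    using assms by (simp add: Suc.IH ism_add_left algebra_simps)
  also have "(\<Sum>t\<in>S. \<Sum>j\<le>k. (k choose j) * walks S (k - j) (x - t - int j \<cdot> s))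
      = (\<Sum>j\<le>k. (k choose j) * ?w (Suc k - j) j)"
    by (subst sum.swap) (simp add: sum_distrib_left Suc_diff_le algebra_simps)
  also have "\<dots> = ?w (Suc k) 0 + (\<Sum>j\<le>k. (k choose Suc j) * ?w (k - j) (Suc j))"
  proof -
    have "(\<Sum>j\<le>k. (k choose j) * ?w (Suc k - j) j) = (\<Sum>j\<le>Suc k. (k choose j) * ?w (Suc k - j) j)" by simp
    also have "\<dots> = ?w (Suc k) 0 + (\<Sum>j\<le>k. (k choose Suc j) * ?w (k - j) (Suc j))"
      by (subst sum.atMost_Suc_shift) simp
    finally show ?thesis .
  qed
  also have "(\<Sum>j\<le>k. (k choose j) * ?w (k - j) (Suc j)) + (?w (Suc k) 0 + (\<Sum>j\<le>k. (k choose Suc j) * ?w (k - j) (Suc j)))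
     = ?w (Suc k) 0 + (\<Sum>j\<le>k. (Suc k choose Suc j) * ?w (k - j) (Suc j))"
    by (simp add: sum.distrib algebra_simps)
  also have "\<dots> = (\<Sum>j\<le>Suc k. (Suc k choose j) * ?w (Suc k - j) j)"
    using sum.atMost_Suc_shift[of "\<lambda>j. (Suc k choose j) * ?w (Suc k - j) j" k]
    by (simp del: walks.simps sum.atMost_Suc binomial_Suc_Suc)
  finally show ?case .
qed simp

text \<open>The Frobenius congruence: modulo a prime \<open>l\<close> the \<open>l\<close>-th power
  of a sum is the sum of the \<open>l\<close>-th powers, and the \<open>l\<close>-th power of a
  group element \<open>s\<close> is \<open>int l \<cdot> s\<close> in additive notation.\<close>

lemma walks_prime_cong:
  assumes "prime l" "finite S"
  shows "[walks S l x = card {s\<in>S. int l \<cdot> s = x}] (mod l)"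
  using assms(2)
proof (induction S arbitrary: x rule: finite_induct)
  case empty
  obtain k where "l = Suc k" using prime_gt_0_nat[OF assms(1)] gr0_implies_Suc by blast
  then show ?case by simp
next
  case (insert s S)
  have l: "l > 0" using prime_gt_0_nat[OF assms(1)] .
  let ?g = "\<lambda>j. (l choose j) * walks S (l - j) (x - int j \<cdot> s)"
  have split: "{..l} = insert 0 (insert l {1..<l})" using l by auto
  have sub: "{t \<in> insert s S. int l \<cdot> t = x} = {t\<in>S. int l \<cdot> t = x} \<union> (if int l \<cdot> s = x then {s} else {})"
    by auto
  have "(\<Sum>j\<le>l. ?g j) = ?g 0 + (?g l + (\<Sum>j\<in>{1..<l}. ?g j))"
    unfolding split using l by (subst sum.insert; simp)+
  \<comment> \<open>Only \<open>j = 0\<close> and \<open>j = l\<close> survive, since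
    \<open>l\<close> divides the other binomial coefficients. The term \<open>j = l\<close> records
    whether \<open>s\<close> itself satisfies \<open>int l \<cdot> s = x\<close>.\<close>
  moreover have "[(\<Sum>j\<in>{1..<l}. ?g j) = (\<Sum>j\<in>{1..<l}. 0)] (mod l)"
    by (rule cong_sum) (use dvd_choose_prime[OF _ _ _ assms(1)] in \<open>auto simp: cong_0_iff intro!: dvd_mult2\<close>)
  ultimately have "[walks (insert s S) l x = ?g 0 + (?g l + 0)] (mod l)"
    by (simp only: walks_insert[OF insert.hyps] sum.neutral_const cong_add_lcancel_nat)
  also have "[?g 0 + (?g l + 0) = card {t\<in>S. int l \<cdot> t = x} + (?g l + 0)] (mod l)"
    using insert.IH[of x] by (simp add: cong_add_rcancel_nat)
  also have "card {t\<in>S. int l \<cdot> t = x} + (?g l + 0) = card {t \<in> insert s S. int l \<cdot> t = x}"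
    unfolding sub using insert.hyps by (subst card_Un_disjoint) auto
  finally show ?case .
qed

context lin_act
begin

text \<open>\<open>f\<close> fixes 0 and carries arcs to arcs, hence walks to walks. The induction
  removes the last step of a walk, which calls for in-neighbours.\<close>

lemma walks_iso:
  assumes "iso f" "v \<in> H" "x \<in> H"
  shows "walks (f ` orb v) k (f x) = walks (orb v) k x"
  using assms(3)
proof (induction k arbitrary: x)
  case 0
  then show ?case using iso_inj[OF assms(1), of x 0] iso_0[OF assms(1)] asub_0[OF asub_H] by auto
next
  case (Suc k)
  have inH: "(-) x ` orb v \<subseteq> H" using orb_H assms Suc asub_H by (auto intro: asub_diff)
  then have inj: "inj_on f ((-) x ` orb v)"
    using iso_bij[OF assms(1)] unfolding bij_betw_def by (meson inj_on_subset)
  have "walks (f ` orb v) (Suc k) (f x) = (\<Sum>y\<in>(-) (f x) ` f ` orb v. walks (f ` orb v) k y)"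
    by (simp add: sum.reindex inj_on_def)
  also have "\<dots> = (\<Sum>y\<in>f ` (-) x ` orb v. walks (f ` orb v) k y)"
    using iso_image_diff assms Suc by simp
  also have "\<dots> = (\<Sum>y\<in>(-) x ` orb v. walks (f ` orb v) k (f y))"
    using inj by (simp add: sum.reindex)
  also have "\<dots> = (\<Sum>y\<in>(-) x ` orb v. walks (orb v) k y)"
    using Suc.IH inH by (intro sum.cong) auto
  also have "\<dots> = walks (orb v) (Suc k) x"
    by (simp add: sum.reindex inj_on_def)
  finally show ?case .
qed

text \<open>As \<open>l\<close> is invertible modulo \<open>p\<close>, only \<open>v\<close> itself
  among the elements of its orbit has \<open>int l \<cdot> v\<close> as its \<open>l\<close>-fold
  multiple, so the number of walks of length \<open>l\<close> to that point is 1 modulo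
  \<open>l\<close>. If no element of the image orbit had the required multiple, the equal number of
  walks on the image side would be 0 modulo \<open>l\<close>.\<close>

lemma prime_multiplier:
  assumes "iso f" "v \<in> H" "prime l" "l \<noteq> p"
  shows "f (int l \<cdot> v) \<in> (\<cdot>) (int l) ` f ` orb v"
proof (rule ccontr)
  assume "f (int l \<cdot> v) \<notin> (\<cdot>) (int l) ` f ` orb v"
  then have none: "{s \<in> f ` orb v. int l \<cdot> s = f (int l \<cdot> v)} = {}" by force
  have "\<not> int p dvd int l" using assms(3,4) prime_p primes_dvd_imp_eq by auto
  then have inj: "int l \<cdot> s = int l \<cdot> v \<longleftrightarrow> s = v" if "s \<in> H" for s
    using ism_mem_cancel[of "{0}" "s - v" "int l"] that assms(2) asub_H
    by (auto simp: ism_diff_right asub_diff asub_def[of "{0}"])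
  have "{s \<in> orb v. int l \<cdot> s = int l \<cdot> v} = {v}" using orb_H[OF assms(2)] inj by auto
  then have "[walks (orb v) l (int l \<cdot> v) = 1] (mod l)"
    using walks_prime_cong[OF assms(3) finite_orb[OF assms(2)], of "int l \<cdot> v"] by simp
  moreover have "[walks (f ` orb v) l (f (int l \<cdot> v)) = 0] (mod l)"
    using walks_prime_cong[OF assms(3), of "f ` orb v" "f (int l \<cdot> v)"] finite_orb assms(2) none by simp
  ultimately have "[1 = 0] (mod l)"
    using walks_iso[OF assms(1,2), of "int l \<cdot> v"] asub_H assms(2) by (metis asub_ism cong_sym cong_trans)
  then show False using prime_gt_1_nat[OF assms(3)] by (simp add: cong_0_iff)
qed

text \<open>Induction over the prime factors of \<open>t\<close>; \<open>orb_ism\<close> brings the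
  remaining factor out of the orbit of a multiple of \<open>v\<close>.\<close>

lemma multiplier:
  assumes "iso f" "v \<in> H" "\<not> p dvd t"
  shows "f (int t \<cdot> v) \<in> (\<cdot>) (int t) ` f ` orb v"
  using assms(2,3)
proof (induction t arbitrary: v rule: less_induct)
  case (less t)
  show ?case
  proof (cases "t = 1")
    case True then show ?thesis by simp
  next
    case False
    then obtain l where l: "prime l" "l dvd t" using prime_factor_nat by blast
    then obtain u where u: "t = l * u" by blast
    have nd: "\<not> p dvd u" "l \<noteq> p" using less.prems u by auto
    have "u < t" "t \<noteq> 0" using u nd l prime_gt_1_nat[of l] by (cases "u = 0"; simp)+
    have uv: "int u \<cdot> v \<in> H" using less.prems asub_H asub_ism by blast
    obtain w where w: "w \<in> orb (int u \<cdot> v)" "f (int l \<cdot> int u \<cdot> v) = int l \<cdot> f w"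
      using prime_multiplier[OF assms(1) uv l(1) nd(2)] by blast
    obtain v' where v': "v' \<in> orb v" "w = int u \<cdot> v'" using w(1) orb_ism less.prems by blast
    then have "f w \<in> (\<cdot>) (int u) ` f ` orb v'" using less.IH[OF \<open>u < t\<close> _ nd(1)] orb_H less.prems by blast
    then obtain z where "z \<in> orb v'" "f w = int u \<cdot> f z" by blast
    then show ?thesis using w orb_eq[OF v'(1)] u by (auto simp: ism_mult)
  qed
qed

end

subsection \<open>Making an isomorphism homogeneous\<close>

context elem_ab
begin

lemma ism_inj: "\<not> int p dvd k \<Longrightarrow> x \<in> H \<Longrightarrow> y \<in> H \<Longrightarrow> k \<cdot> x = k \<cdot> y \<longleftrightarrow> x = y"
  using ism_mem_cancel[of "{0}" "x - y" k] asub_H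
  by (auto simp: ism_diff_right asub_diff asub_def[of "{0}"])

lemma ism_bij: assumes "\<not> int p dvd k" shows "bij_betw ((\<cdot>) k) H H"
proof -
  have "inj_on ((\<cdot>) k) H" using ism_inj assms by (auto simp: inj_on_def)
  moreover have "(\<cdot>) k ` H \<subseteq> H" using asub_H asub_ism by blast
  ultimately show ?thesis using fin_H by (simp add: bij_betw_def endo_inj_surj)
qed

text \<open>Homogeneity up to a subgroup \<open>M\<close>. The averaging argument reaches the exact
  form only by shrinking \<open>M\<close> along a flag.\<close>

definition homog :: "'v set \<Rightarrow> ('v \<Rightarrow> 'v) \<Rightarrow> bool" where
  "homog M f \<longleftrightarrow> (\<forall>x\<in>H. \<forall>k. f (k \<cdot> x) - k \<cdot> f x \<in> M)"

end

context lin_act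
begin

text \<open>A linear map that agrees with \<open>g\<close> on every orbit also agrees with
  \<open>f\<close>, so the search for it may exchange one for the other.\<close>

definition same :: "('v \<Rightarrow> 'v) \<Rightarrow> ('v \<Rightarrow> 'v) \<Rightarrow> bool" where
  "same f g \<longleftrightarrow> iso f \<and> iso g \<and> (\<forall>v\<in>H. f ` orb v = g ` orb v)"

lemma same_refl: "iso f \<Longrightarrow> same f f" and same_sym: "same f g \<Longrightarrow> same g f"
  and same_trans: "same f g \<Longrightarrow> same g h \<Longrightarrow> same f h"
  by (auto simp: same_def)

lemma sameE:
  assumes "same f g" "v \<in> H" obtains a where "a \<in> A" "f v = g (a v)"
proof -
  have "f v \<in> g ` orb v" using assms unfolding same_def by blast
  then show ?thesis using that by (auto simp: orb_def)
qed

lemma sameI: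
  assumes "iso f" "iso g" "\<And>v. v \<in> H \<Longrightarrow> f v \<in> g ` orb v"
  shows "same f g"
  unfolding same_def
proof (intro conjI ballI assms(1,2))
  fix v assume v: "v \<in> H"
  have "f ` orb v \<subseteq> g ` orb v" using assms(3) orb_H[OF v] orb_eq by blast
  moreover have "card (f ` orb v) = card (orb v)" "card (g ` orb v) = card (orb v)"
    using iso_bij[OF assms(1)] iso_bij[OF assms(2)] orb_H[OF v]
    by (auto simp: bij_betw_def intro!: card_image intro: inj_on_subset)
  ultimately show "f ` orb v = g ` orb v" using finite_orb[OF v] by (intro card_subset_eq) auto
qed

text \<open>\<theta> is the inverse of \<open>g\<close> after \<open>f\<close>. It maps every orbit
  to itself and preserves all orbit digraphs, so an isomorphism may be preceded by it without a
  change on orbits.\<close>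

lemma same_quotient:
  assumes "same f g"
  obtains \<theta> where "\<And>x. x \<in> H \<Longrightarrow> \<theta> x \<in> H" "\<And>x. x \<in> H \<Longrightarrow> g (\<theta> x) = f x"
    "\<And>F. iso F \<Longrightarrow> same (F \<circ> \<theta>) F"
proof -
  have f: "iso f" and g: "iso g" using assms by (auto simp: same_def)
  define \<theta> where "\<theta> = inv_into H g \<circ> f"
  have bij: "bij_betw \<theta> H H" unfolding \<theta>_def
    by (rule bij_betw_trans[OF iso_bij[OF f] bij_betw_inv_into[OF iso_bij[OF g]]])
  have H: "\<theta> x \<in> H" if "x \<in> H" for x using bij bij_betwE that by blast
  have g\<theta>: "g (\<theta> x) = f x" if "x \<in> H" for x
    using bij_betw_inv_into_right[OF iso_bij[OF g] iso_H[OF f that]] by (simp add: \<theta>_def)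
  have orb\<theta>: "\<theta> x \<in> orb x" if x: "x \<in> H" for x
  proof -
    obtain a where a: "a \<in> A" "f x = g (a x)" using sameE assms x by metis
    then have "\<theta> x = a x" using g\<theta>[OF x] iso_inj[OF g H[OF x], of "a x"] x by auto
    then show ?thesis using a by (auto simp: orb_def)
  qed
  have onto: "\<theta> ` orb v = orb v" if v: "v \<in> H" for v
  proof (rule card_subset_eq[OF finite_orb[OF v]])
    show "\<theta> ` orb v \<subseteq> orb v" using orb\<theta> orb_H[OF v] orb_eq by blast
    show "card (\<theta> ` orb v) = card (orb v)"
      using bij orb_H[OF v] by (auto simp: bij_betw_def intro!: card_image intro: inj_on_subset)
  qed
  have \<theta>0: "\<theta> 0 = 0" using g\<theta>[of 0] iso_0[OF f] iso_0[OF g] iso_inj[OF g H, of 0 0] asub_0[OF asub_H] by simp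
  have "same (F \<circ> \<theta>) F" if F: "iso F" for F
  proof (rule sameI[OF _ F])
    show "(F \<circ> \<theta>) v \<in> F ` orb v" if "v \<in> H" for v using orb\<theta> that by simp
    show "iso (F \<circ> \<theta>)"
    proof (rule isoI)
      show "bij_betw (F \<circ> \<theta>) H H" using bij_betw_trans[OF bij iso_bij[OF F]] .
      show "(F \<circ> \<theta>) 0 = 0" using \<theta>0 iso_0[OF F] by simp
      fix x v assume x: "x \<in> H" and v: "v \<in> H"
      obtain a where a: "a \<in> A" "f (x + v) = f x + f (a v)" using iso_step f x v .
      obtain b where b: "b \<in> A" "f (a v) = g (b (a v))" using sameE assms a v by (metis A_H)
      let ?u = "b (a v)"
      have uH: "?u \<in> H" "?u \<in> orb v" using a b v orb_mem_A orb_self by auto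
      obtain c where c: "c \<in> A" "g (\<theta> x + c ?u) = g (\<theta> x) + g ?u" using iso_step_rev g H[OF x] uH(1) .
      \<comment> \<open>Both sides equal \<open>f x + f (a v)\<close>. Injectivity of
        \<open>g\<close> then exhibits the displacement of \<theta> as \<open>c ?u\<close>, an
        element of \<open>orb v\<close>.\<close>
      have "g (\<theta> (x + v)) = g (\<theta> x + c ?u)" using a b c g\<theta> x v asub_H by (simp add: asub_add)
      then have eq: "\<theta> (x + v) = \<theta> x + c ?u"
        using iso_inj[OF g, of "\<theta> (x + v)" "\<theta> x + c ?u"] H x v c uH asub_H by (simp add: asub_add)
      obtain d where d: "d \<in> A" "F (\<theta> x + c ?u) = F (\<theta> x) + F (d (c ?u))"
        using iso_step F H[OF x] A_H[OF c(1) uH(1)] .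
      have "d (c ?u) \<in> \<theta> ` orb v" using onto[OF v] uH c d orb_mem_A by blast
      then show "\<exists>a\<in>A. (F \<circ> \<theta>) (x + v) = (F \<circ> \<theta>) x + (F \<circ> \<theta>) (a v)"
        using eq d by (auto simp: orb_def)
    qed
  qed
  then show ?thesis using that H g\<theta> by blast
qed

text \<open>By Schur's theorem \<open>f (t \<cdot> v)\<close> is \<open>t\<close> times an element
  of the image of \<open>orb v\<close>; the factor \<open>s\<close>, inverse to \<open>t\<close>,
  brings it back into that image.\<close>

lemma same_scale:
  assumes f: "iso f" and t: "[s * t = 1] (mod int p)" "\<not> int p dvd t" "\<not> int p dvd s"
  shows "same (\<lambda>x. s \<cdot> f (t \<cdot> x)) f"
proof (rule sameI[OF _ f])
  have st: "s \<cdot> t \<cdot> x = x" if "x \<in> H" for x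
    using ism_cong[OF that t(1)] by (simp add: ism_mult)
  have tH: "t \<cdot> x \<in> H" if "x \<in> H" for x using that asub_H asub_ism by blast
  show "s \<cdot> f (t \<cdot> v) \<in> f ` orb v" if v: "v \<in> H" for v
  proof -
    \<comment> \<open>\<open>multiplier\<close> speaks of natural numbers, so \<open>t\<close> is
      replaced by its residue.\<close>
    define n where "n = nat (t mod int p)"
    have n: "int n = t mod int p" using p_pos by (simp add: n_def)
    then have "int n \<cdot> v = t \<cdot> v" using ism_cong[OF v, of "int n" t] by simp
    moreover have "\<not> p dvd n" using n t(2) by (metis dvd_mod_iff dvd_refl int_dvd_int_iff)
    ultimately obtain w where w: "w \<in> orb v" "f (t \<cdot> v) = int n \<cdot> f w" using multiplier[OF f v] by force
    have fw: "f w \<in> H" using iso_H f orb_H[OF v] w by blast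
    then have "int n \<cdot> f w = t \<cdot> f w" using n by (intro ism_cong) simp_all
    then show ?thesis using w st[OF fw] by simp
  qed
  show "iso (\<lambda>x. s \<cdot> f (t \<cdot> x))"
  proof (rule isoI)
    show "bij_betw (\<lambda>x. s \<cdot> f (t \<cdot> x)) H H"
      using bij_betw_trans[OF bij_betw_trans[OF ism_bij[OF t(2)] iso_bij[OF f]] ism_bij[OF t(3)]]
      by (simp add: comp_def)
    show "s \<cdot> f (t \<cdot> 0) = 0" using iso_0[OF f] by simp
    fix x v assume x: "x \<in> H" and v: "v \<in> H"
    obtain a where "a \<in> A" "f (t \<cdot> x + t \<cdot> v) = f (t \<cdot> x) + f (a (t \<cdot> v))" using iso_step f tH[OF x] tH[OF v] .
    then show "\<exists>a\<in>A. s \<cdot> f (t \<cdot> (x + v)) = s \<cdot> f (t \<cdot> x) + s \<cdot> f (t \<cdot> a v)"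
      using v by (auto simp: ism_add_right A_ism)
  qed
qed

definition invar :: "'v set \<Rightarrow> bool" where
  "invar M \<longleftrightarrow> asub M \<and> M \<subseteq> H \<and> (\<forall>a\<in>A. \<forall>v\<in>M. a v \<in> M)"

text \<open>Subtraction walks backwards along an arc: \<open>f u - f v\<close> is
  \<open>f (u - w)\<close> for some \<open>w\<close> in the orbit of \<open>v\<close>, and
  invariance keeps \<open>u - w\<close> in \<open>M\<close>.\<close>

lemma asub_image: assumes "iso f" "invar M" shows "asub (f ` M)"
  unfolding asub_def
proof (intro conjI ballI)
  have M: "asub M" "M \<subseteq> H" using assms(2) by (auto simp: invar_def)
  show "0 \<in> f ` M" using iso_0[OF assms(1)] asub_0[OF M(1)] by force
  fix x y assume "x \<in> f ` M" "y \<in> f ` M"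
  then obtain u v where uv: "u \<in> M" "v \<in> M" "x = f u" "y = f v" by blast
  obtain w where w: "w \<in> orb v" "f u = f (u - w) + f v"
  proof -
    have "f u - f v \<in> (-) (f u) ` f ` orb v" using orb_self by blast
    then have "f u - f v \<in> f ` (-) u ` orb v" using iso_image_diff[OF assms(1), of u v] uv M by blast
    then show ?thesis using that by (force simp: algebra_simps)
  qed
  then have "u - w \<in> M" using uv assms(2) M by (auto simp: orb_def invar_def intro!: asub_diff)
  then show "x - y \<in> f ` M" using w uv by force
qed

lemma same_image: assumes "same f g" "invar M" shows "f ` M = g ` M"
proof -
  have "f ` M \<subseteq> g ` M" if s: "same f g" for f g
  proof
    fix y assume "y \<in> f ` M"
    then obtain v where v: "v \<in> M" "y = f v" by blast
    then have "v \<in> H" using assms(2) by (auto simp: invar_def)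
    then obtain a where "a \<in> A" "f v = g (a v)" using sameE[OF s] by metis
    then show "y \<in> g ` M" using v assms(2) by (auto simp: invar_def)
  qed
  then show ?thesis using assms(1) same_sym by blast
qed

text \<open>The elements of \<open>A\<close> that intervene move \<open>v\<close> only within
  \<open>v + N'\<close>, and \<open>f\<close> maps this coset into \<open>f v\<close> plus the image
  of \<open>N'\<close>. Modulo that image, all functions with the same effect on orbits as
  \<open>f\<close> thus have one common increment in direction \<open>v\<close>.\<close>

lemma same_add_mod:
  assumes G: "same G f" and N: "asub N" "N \<subseteq> H" and N': "invar N'" "N' \<subseteq> N"
    and comm: "\<And>a v. a \<in> A \<Longrightarrow> v \<in> N \<Longrightarrow> a v - v \<in> N'"
    and x: "x \<in> H" and v: "v \<in> N"
  shows "G (x + v) - G x - f v \<in> f ` N'"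
proof -
  have iso: "iso G" "iso f" using G by (auto simp: same_def)
  have vH: "v \<in> H" using v N by blast
  obtain a where a: "a \<in> A" "G (x + v) = G x + G (a v)" using iso_step iso(1) x vH .
  obtain b where b: "b \<in> A" "G (a v) = f (b (a v))" using sameE G a vH by (metis A_H)
  let ?n = "b (a v) - v"
  have n: "?n \<in> N'" using comm[OF A_comp[OF b(1) a(1)] v] by simp
  then have nH: "?n \<in> H" using N'(1) by (auto simp: invar_def)
  obtain c where c: "c \<in> A" "f (v + ?n) = f v + f (c ?n)" using iso_step iso(2) vH nH .
  then have "c ?n \<in> N'" using n N'(1) by (auto simp: invar_def)
  then show ?thesis using a b c by (simp add: algebra_simps)
qed

text \<open>With \<open>s t\<close> inverse to \<open>t\<close>, the functions
  \<open>g t x = s t \<cdot> f (t \<cdot> x)\<close> are permuted, up to the factor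
  \<open>k\<close>, when \<open>x\<close> is replaced by \<open>k \<cdot> x\<close>. Hence minus
  their sum over \<open>0 < t < p\<close> is homogeneous, and this is their average because -(p - 1)
  is 1 modulo \<open>p\<close>. A sum of isomorphisms need not be an isomorphism. The average is
  therefore realised only modulo the image of \<open>N'\<close>, by composing \<open>f\<close> with
  the orbit-preserving maps \<theta> that satisfy \<open>g t (\<theta> x) = f x\<close>; each of
  them contributes \<open>f x - g t x\<close>.\<close>

lemma homog_step:
  assumes f: "iso f" and N: "invar N" and N': "invar N'" "N' \<subseteq> N"
    and comm: "\<And>a v. a \<in> A \<Longrightarrow> v \<in> N \<Longrightarrow> a v - v \<in> N'"
    and hom: "homog (f ` N) f"
  shows "\<exists>F. same F f \<and> homog (f ` N') F"
proof -
  let ?K = "f ` N'"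
  have K: "asub ?K" using asub_image f N' by blast
  have NH: "asub N" "N \<subseteq> H" using N by (auto simp: invar_def)
  define s where "s t = (SOME l. [l * int t = 1] (mod int p))" for t
  have s: "[s t * int t = 1] (mod int p)" if "\<not> p dvd t" for t
    unfolding s_def by (rule someI_ex) (use inverse_mod_p[of "int t"] that in auto)
  have s': "\<not> int p dvd s t" if "\<not> p dvd t" for t
  proof
    assume "int p dvd s t"
    then have "int p dvd 1" using s[OF that] by (meson cong_dvd_iff dvd_mult2)
    then show False using p_pos by simp
  qed
  define g where "g t x = s t \<cdot> f (int t \<cdot> x)" for t x
  have g: "same (g t) f" if "\<not> p dvd t" for t
    unfolding g_def using same_scale[OF f s[OF that]] s'[OF that] that by simp
  have iso_g: "iso (g t)" if "\<not> p dvd t" for t using g[OF that] by (simp add: same_def)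
  \<comment> \<open>After all \<open>p - 1\<close> compositions the expression is
    \<open>int p \<cdot> f x\<close> minus the sum of the \<open>g t x\<close>, and its first term
    is 0.\<close>
  have main: "\<exists>F. same F f \<and> (\<forall>x\<in>H. F x - (f x + (\<Sum>t\<in>{1..j}. f x - g t x)) \<in> ?K)" if "j < p" for j
    using that
  proof (induction j)
    case 0
    then show ?case using same_refl[OF f] asub_0[OF K] by (intro exI[of _ f]) simp
  next
    case (Suc j)
    then obtain F where F: "same F f" "\<forall>x\<in>H. F x - (f x + (\<Sum>t\<in>{1..j}. f x - g t x)) \<in> ?K" by auto
    let ?t = "Suc j"
    have t: "\<not> p dvd ?t" using Suc.prems by (auto dest: dvd_imp_le)
    obtain \<theta> where \<theta>: "\<And>x. x \<in> H \<Longrightarrow> \<theta> x \<in> H" "\<And>x. x \<in> H \<Longrightarrow> g ?t (\<theta> x) = f x"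
      "\<And>F. iso F \<Longrightarrow> same (F \<circ> \<theta>) F"
      using same_quotient[OF same_sym[OF g[OF t]]] by blast
    have "same (F \<circ> \<theta>) f" using \<theta>(3) F(1) same_trans by (auto simp: same_def)
    moreover have "(F \<circ> \<theta>) x - (f x + (\<Sum>t\<in>{1..Suc j}. f x - g t x)) \<in> ?K" if x: "x \<in> H" for x
    proof -
      let ?n = "\<theta> x - x"
      have nH: "?n \<in> H" using \<theta>(1) x asub_H asub_diff by blast
      obtain a where a: "a \<in> A" "g ?t (x + ?n) = g ?t x + g ?t (a ?n)" using iso_step iso_g[OF t] x nH .
      \<comment> \<open>Homogeneity modulo the image of \<open>N\<close> keeps the displacement
        \<open>?n\<close> of \<theta> inside \<open>N\<close>, where \<open>same_add_mod\<close>
        applies.\<close>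
      have "f (int ?t \<cdot> x) - int ?t \<cdot> f x \<in> f ` N" using hom x unfolding homog_def by blast
      then have "s ?t \<cdot> (f (int ?t \<cdot> x) - int ?t \<cdot> f x) \<in> f ` N"
        using asub_ism[OF asub_image[OF f N]] by blast
      moreover have "s ?t \<cdot> int ?t \<cdot> f x = f x"
        using ism_cong[OF iso_H[OF f x] s[OF t]] by (simp add: ism_mult)
      ultimately have "g ?t x - f x \<in> f ` N" by (simp add: g_def ism_diff_right)
      then have "- (g ?t x - f x) \<in> f ` N" using asub_minus asub_image[OF f N] by blast
      moreover have "- (g ?t x - f x) = g ?t (a ?n)" using \<theta>(2)[OF x] a by (simp add: algebra_simps)
      ultimately have "g ?t (a ?n) \<in> g ?t ` N" using same_image[OF g[OF t] N] by simp
      then have "a ?n \<in> N" using iso_inj[OF iso_g[OF t] A_H[OF a(1) nH]] NH by (metis (no_types, lifting) imageE subsetD)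
      moreover obtain b where "b \<in> A" "b (a ?n) = ?n" using A_inverse[OF a(1)] by metis
      ultimately have n: "?n \<in> N" using N by (metis invar_def)
      have 1: "g ?t (x + ?n) - g ?t x - f ?n \<in> ?K"
        by (rule same_add_mod[OF g[OF t] NH N' _ x n]) (rule comm)
      have 2: "F (x + ?n) - F x - f ?n \<in> ?K"
        by (rule same_add_mod[OF F(1) NH N' _ x n]) (rule comm)
      \<comment> \<open>Modulo \<open>?K\<close>, \<open>F\<close> and \<open>g ?t\<close> have the
        same increment along \<open>?n\<close>, and for \<open>g ?t\<close> this increment is
        \<open>f x - g ?t x\<close>.\<close>
      have "(F x - (f x + (\<Sum>t\<in>{1..j}. f x - g t x))) + ((F (x + ?n) - F x - f ?n) - (g ?t (x + ?n) - g ?t x - f ?n)) \<in> ?K"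
        using F(2) x 1 2 K by (blast intro: asub_add asub_diff)
      then have "F (\<theta> x) - (f x + (\<Sum>t\<in>{1..j}. f x - g t x) + (f x - g ?t x)) \<in> ?K"
        using \<theta>(2)[OF x] by (simp add: algebra_simps)
      then show ?thesis by (simp add: algebra_simps)
    qed
    ultimately show ?case by blast
  qed
  have "p - 1 < p" using p_pos by simp
  then obtain F where F: "same F f" "\<And>x. x \<in> H \<Longrightarrow> F x - (f x + (\<Sum>t\<in>{1..p - 1}. f x - g t x)) \<in> ?K"
    using main by blast
  define av where "av x = (\<Sum>t\<in>{1..p - 1}. g t x)" for x
  have F': "F x + av x \<in> ?K" if x: "x \<in> H" for x
  proof -
    have "(\<Sum>t\<in>{1..p - 1}. f x) = int (p - 1) \<cdot> f x" by (simp add: ism_def sum.atLeast1_atMost_eq)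
    then have "f x + (\<Sum>t\<in>{1..p - 1}. f x) = int p \<cdot> f x"
      using p_pos ism_add_left[of 1 "int (p - 1)" "f x"] by simp
    then have "f x + (\<Sum>t\<in>{1..p - 1}. f x - g t x) = - av x"
      using p_H[OF iso_H[OF f x]] by (simp add: sum_subtractf av_def add_diff_eq)
    then show ?thesis using F(2)[OF x] by simp
  qed
  have avk: "av (k \<cdot> x) = k \<cdot> av x" if x: "x \<in> H" and k: "\<not> int p dvd k" for k x
  proof -
    \<comment> \<open>Multiplication by \<open>k\<close> as a permutation of the nonzero residues.
      Modulo \<open>p\<close>, \<open>s t\<close> is \<open>k * s (\<sigma> t)\<close>, which yields
      \<open>g t (k \<cdot> x) = k \<cdot> g (\<sigma> t) x\<close>.\<close>
    define \<sigma> where "\<sigma> t = nat ((int t * k) mod int p)" for t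
    have \<sigma>: "int (\<sigma> t) = (int t * k) mod int p" for t using p_pos by (simp add: \<sigma>_def)
    have nd: "\<not> p dvd t" if "t \<in> {1..p - 1}" for t using that p_pos by (auto dest: dvd_imp_le)
    have \<sigma>mem: "\<sigma> t \<in> {1..p - 1}" if "t \<in> {1..p - 1}" for t
    proof -
      have "\<not> int p dvd int t * k" using nd[OF that] k prime_p
        by (simp add: prime_dvd_mult_iff)
      then have "int (\<sigma> t) \<noteq> 0" using \<sigma> by (simp add: dvd_eq_mod_eq_0)
      moreover have "int (\<sigma> t) < int p" using \<sigma> p_pos by simp
      ultimately show ?thesis by auto
    qed
    have inj: "inj_on \<sigma> {1..p - 1}"
    proof (rule inj_onI)
      fix t u assume tu: "t \<in> {1..p - 1}" "u \<in> {1..p - 1}" "\<sigma> t = \<sigma> u"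
      then have "[int t * k = int u * k] (mod int p)" using \<sigma> by (metis cong_def)
      moreover have "coprime k (int p)" using k prime_p
        by (metis coprime_commute prime_imp_coprime prime_nat_int_transfer)
      ultimately have "[int t = int u] (mod int p)" by (simp add: cong_mult_rcancel)
      then show "t = u" using tu by (auto simp: cong_def)
    qed
    have img: "\<sigma> ` {1..p - 1} = {1..p - 1}" using \<sigma>mem inj by (intro endo_inj_surj) auto
    have "g t (k \<cdot> x) = k \<cdot> g (\<sigma> t) x" if t: "t \<in> {1..p - 1}" for t
    proof -
      have c1: "[int (\<sigma> t) = int t * k] (mod int p)" using \<sigma> by (simp add: cong_def)
      have "[s t = s t * (s (\<sigma> t) * int (\<sigma> t))] (mod int p)"
        using cong_scalar_left[OF s[OF nd[OF \<sigma>mem[OF t]]], of "s t"] by (simp add: cong_sym)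
      also have "[s t * (s (\<sigma> t) * int (\<sigma> t)) = s t * (s (\<sigma> t) * (int t * k))] (mod int p)"
        using c1 by (intro cong_mult cong_refl)
      also have "s t * (s (\<sigma> t) * (int t * k)) = (s t * int t) * (k * s (\<sigma> t))" by simp
      also have "[(s t * int t) * (k * s (\<sigma> t)) = 1 * (k * s (\<sigma> t))] (mod int p)"
        using s[OF nd[OF t]] by (intro cong_mult cong_refl)
      finally have c2: "[s t = k * s (\<sigma> t)] (mod int p)" by simp
      have "int t \<cdot> k \<cdot> x = int (\<sigma> t) \<cdot> x" using ism_cong[OF x c1] by (simp add: ism_mult)
      moreover have "f (int (\<sigma> t) \<cdot> x) \<in> H" using iso_H f x asub_H asub_ism by blast
      ultimately show ?thesis using ism_cong[OF _ c2] by (simp add: g_def ism_mult)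
    qed
    then have "av (k \<cdot> x) = (\<Sum>t\<in>{1..p - 1}. k \<cdot> g (\<sigma> t) x)" by (simp add: av_def)
    also have "\<dots> = (\<Sum>u\<in>\<sigma> ` {1..p - 1}. k \<cdot> g u x)" using inj by (simp add: sum.reindex)
    finally show ?thesis unfolding img by (simp add: av_def ism_sum)
  qed
  have "F (k \<cdot> x) - k \<cdot> F x \<in> ?K" if x: "x \<in> H" for x k
  proof (cases "int p dvd k")
    case True
    have FH: "F x \<in> H" using F(1) iso_H x by (auto simp: same_def)
    have "k \<cdot> x = 0" "k \<cdot> F x = 0" using ism_cong[OF x, of k 0] ism_cong[OF FH, of k 0] True
      by (simp_all add: cong_0_iff)
    moreover have "F 0 = 0" using F(1) iso_0 by (auto simp: same_def)
    ultimately show ?thesis using asub_0[OF K] by simp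
  next
    case False
    have "F (k \<cdot> x) + av (k \<cdot> x) - k \<cdot> (F x + av x) \<in> ?K"
      by (intro asub_diff[OF K] asub_ism[OF K] F' x asub_ism[OF asub_H])
    then show ?thesis using avk[OF x False] by (simp add: ism_add_right)
  qed
  then show ?thesis using F(1) unfolding homog_def by blast
qed

text \<open>Modulo the image of \<open>N m = H\<close> homogeneity says nothing;
  \<open>homog_step\<close> then descends one level at a time to \<open>N 0 = {0}\<close>, where it
  is exact. The images of the \<open>N i\<close> stay the same throughout, as all functions involved
  agree on orbits.\<close>

lemma homogenize:
  fixes N :: "nat \<Rightarrow> 'v set"
  assumes f: "iso f" and N: "\<And>i. invar (N i)" "\<And>i. N i \<subseteq> N (Suc i)" "N 0 = {0}" "N m = H"
    and comm: "\<And>i a v. a \<in> A \<Longrightarrow> v \<in> N (Suc i) \<Longrightarrow> a v - v \<in> N i"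
  obtains F where "same F f" "\<And>x k. x \<in> H \<Longrightarrow> F (k \<cdot> x) = k \<cdot> F x"
proof -
  have "\<exists>F. same F f \<and> homog (f ` N (m - j)) F" if "j \<le> m" for j
    using that
  proof (induction j)
    case 0
    have "f (k \<cdot> x) - k \<cdot> f x \<in> f ` H" if "x \<in> H" for x k
    proof -
      have "f ` H = H" using iso_bij[OF f] by (simp add: bij_betw_def)
      then show ?thesis using that asub_H iso_H[OF f] by (auto intro!: asub_diff intro: asub_ism)
    qed
    then show ?case using same_refl[OF f] N(4) by (auto simp: homog_def)
  next
    case (Suc j)
    then obtain F where F: "same F f" "homog (f ` N (m - j)) F" by auto
    have m: "m - j = Suc (m - Suc j)" using Suc.prems by simp
    have iF: "iso F" using F(1) by (simp add: same_def)
    have im: "F ` N i = f ` N i" for i using same_image[OF F(1) N(1)] .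
    have "\<exists>F'. same F' F \<and> homog (F ` N (m - Suc j)) F'"
    proof (rule homog_step[OF iF N(1) N(1) N(2)])
      show "a v - v \<in> N (m - Suc j)" if "a \<in> A" "v \<in> N (Suc (m - Suc j))" for a v
        using comm that .
      show "homog (F ` N (Suc (m - Suc j))) F" using F(2) im m by simp
    qed
    then obtain F' where "same F' F" "homog (F ` N (m - Suc j)) F'" by blast
    then show ?case using F(1) same_trans im by metis
  qed
  from this[of m] obtain F where F: "same F f" "homog (f ` N 0) F" by auto
  then have "F (k \<cdot> x) = k \<cdot> F x" if "x \<in> H" for x k
    using that N(3) iso_0[OF f] by (auto simp: homog_def)
  then show ?thesis using that F(1) by blast
qed

end

subsection \<open>Invariant flags\<close>

context lin_act
begin

lemma finite_A: "finite A"
proof -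
  have "A \<subseteq> {f. f permutes H}" using perm_A unfolding perm_group_def by blast
  then show ?thesis using finite_permutations[OF fin_H] finite_subset by blast
qed

lemma invar_0: "invar {0}"
  using asub_H by (auto simp: invar_def asub_def)

lemma invar_H: "invar H"
  using asub_H by (auto simp: invar_def)

lemma adj_invar:
  assumes M: "invar M" and v: "v \<in> H" "\<forall>a\<in>A. a v - v \<in> M"
    and comm: "\<forall>a\<in>A. \<forall>u\<in>M. a u - u \<in> M'" and "M' \<subseteq> M"
  shows "invar (adj M v)" "\<And>a u. a \<in> A \<Longrightarrow> u \<in> adj M v \<Longrightarrow> a u - u \<in> M"
proof -
  have M': "asub M" "M \<subseteq> H" using M by (auto simp: invar_def)
  show *: "a u - u \<in> M" if a: "a \<in> A" and u: "u \<in> adj M v" for a u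
  proof -
    obtain n k where n: "n \<in> M" "u = n + k \<cdot> v" using u by (metis adjE)
    have "a u = a n + k \<cdot> a v"
      using n a v M' asub_H by (metis A_add A_ism asub_ism subsetD)
    then have "a u - u = (a n - n) + k \<cdot> (a v - v)" using n by (simp add: ism_diff_right)
    then show ?thesis using bspec[OF bspec[OF comm a] n(1)] bspec[OF v(2) a] M' \<open>M' \<subseteq> M\<close> by (auto intro: asub_add asub_ism)
  qed
  have "a u \<in> adj M v" if "a \<in> A" "u \<in> adj M v" for a u
    using asub_add[OF asub_adj[OF M'(1)], of "a u - u" v u] *[OF that] adj_superset[of M v] that(2) by auto
  then show "invar (adj M v)"
    unfolding invar_def using asub_adj[OF M'(1)] adj_in_H[OF M'(2) v(1)] by blast
qed

text \<open>A \<open>p\<close>-group fixes a nonzero point of \<open>H/M\<close>. Otherwise every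
  class of \<open>R\<close> below has size divisible by \<open>p ^ Suc m\<close>, and so has
  \<open>card (H - M) = p ^ h - p ^ m\<close>, which is impossible.\<close>

lemma fixed_mod:
  assumes A: "card A = p ^ r" and M: "invar M" and c: "card M = p ^ m" "card H = p ^ h" "m < h"
  shows "\<exists>v\<in>H. v \<notin> M \<and> (\<forall>a\<in>A. a v - v \<in> M)"
proof (rule ccontr)
  assume no: "\<not> ?thesis"
  have M': "asub M" "M \<subseteq> H" "\<And>a v. a \<in> A \<Longrightarrow> v \<in> M \<Longrightarrow> a v \<in> M" using M by (auto simp: invar_def)
  have finM: "finite M" using M'(2) fin_H finite_subset by blast
  have id: "id \<in> A" using perm_A unfolding perm_group_def by blast
  \<comment> \<open>The classes are the preimages in \<open>H\<close> of the \<open>A\<close>-orbits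
    of nonzero elements of \<open>H/M\<close>.\<close>
  define R where "R = {(x, y). x \<in> H - M \<and> y \<in> H - M \<and> (\<exists>a\<in>A. y - a x \<in> M)}"
  have out: "a x + u \<in> H - M" if x: "x \<in> H - M" "a \<in> A" "u \<in> M" for a x u
  proof -
    obtain b where b: "b \<in> A" "b (a x) = x" using A_inverse[OF x(2)] by metis
    have "a x \<notin> M" using M'(3)[OF b(1)] b(2) x(1) by force
    then have "a x + u \<notin> M" using asub_add_iff[OF M'(1) x(3), of "a x"] by (simp add: add.commute)
    moreover have "a x + u \<in> H" using x M'(2) asub_H by (auto intro: asub_add)
    ultimately show ?thesis by blast
  qed
  have "equiv (H - M) R"
  proof (rule equivI)
    show "R \<subseteq> (H - M) \<times> (H - M)" by (auto simp: R_def)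
    show "refl_on (H - M) R" using id asub_0[OF M'(1)] by (auto simp: R_def refl_on_def intro!: bexI[of _ id])
    show "sym R"
    proof (rule symI)
      fix x y assume "(x, y) \<in> R"
      then obtain a where a: "x \<in> H - M" "y \<in> H - M" "a \<in> A" "y - a x \<in> M" by (auto simp: R_def)
      obtain b where b: "b \<in> A" "b (a x) = x" using A_inverse[OF a(3)] by metis
      have "b (y - a x) = b y - x" using add_on_diff[OF asub_H add_A[OF b(1)], of y "a x"] a b by auto
      then have "x - b y \<in> M" using M'(3)[OF b(1) a(4)] asub_minus[OF M'(1)] by (metis minus_diff_eq)
      then show "(y, x) \<in> R" using a b by (auto simp: R_def)
    qed
    show "trans R"
    proof (rule transI)
      fix x y z assume "(x, y) \<in> R" "(y, z) \<in> R"
      then obtain a b where a: "x \<in> H - M" "y \<in> H - M" "a \<in> A" "y - a x \<in> M"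
        and b: "z \<in> H - M" "b \<in> A" "z - b y \<in> M" by (auto simp: R_def)
      have "b (y - a x) = b y - b (a x)" using add_on_diff[OF asub_H add_A[OF b(2)], of y "a x"] a by auto
      then have "b y - b (a x) \<in> M" using M'(3)[OF b(2) a(4)] by simp
      then have "(z - b y) + (b y - b (a x)) \<in> M" using b(3) asub_add[OF M'(1)] by blast
      then show "(x, z) \<in> R" using a b A_comp[OF b(2) a(3)]
        by (auto simp: R_def intro!: bexI[of _ "b \<circ> a"])
    qed
  qed
  moreover have "p ^ Suc m dvd card X" if X: "X \<in> (H - M) // R" for X
  proof -
    obtain x where x: "x \<in> H - M" "X = R `` {x}" using X by (auto simp: quotient_def)
    \<comment> \<open>The class is the image of \<open>A \<times> M\<close> under \<Phi>, and all
      fibres have the size of \<open>St\<close>, the stabiliser of the coset \<open>x + M\<close>.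
      So the size of the class divides \<open>p ^ (r + m)\<close>.\<close>
    define \<Phi> :: "('v \<Rightarrow> 'v) \<times> 'v \<Rightarrow> 'v" where "\<Phi> = (\<lambda>(a, u). a x + u)"
    define St where "St = {b\<in>A. b x - x \<in> M}"
    have X\<Phi>: "X = \<Phi> ` (A \<times> M)"
    proof
      show "X \<subseteq> \<Phi> ` (A \<times> M)"
      proof
        fix y assume "y \<in> X"
        then obtain a where "a \<in> A" "y - a x \<in> M" using x by (auto simp: R_def)
        then have "(a, y - a x) \<in> A \<times> M" "y = \<Phi> (a, y - a x)" by (auto simp: \<Phi>_def)
        then show "y \<in> \<Phi> ` (A \<times> M)" by blast
      qed
      show "\<Phi> ` (A \<times> M) \<subseteq> X"
      proof clarify
        fix a u assume "a \<in> A" "u \<in> M"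
        then have "a x + u \<in> H - M" "(a x + u) - a x \<in> M" "a \<in> A" using out[OF x(1)] by auto
        then have "(x, a x + u) \<in> R" using x(1) unfolding R_def by blast
        then show "\<Phi> (a, u) \<in> X" by (simp add: x(2) \<Phi>_def)
      qed
    qed
    have fib: "card {z \<in> A \<times> M. \<Phi> z = y} = card St" if "y \<in> X" for y
    proof -
      obtain a0 m0 where y: "a0 \<in> A" "m0 \<in> M" "y = a0 x + m0" using \<open>y \<in> X\<close> X\<Phi> by (auto simp: \<Phi>_def)
      obtain c0 where c0: "c0 \<in> A" "\<And>x. c0 (a0 x) = x" "\<And>x. a0 (c0 x) = x" using A_inverse[OF y(1)] by metis
      have "bij_betw (\<lambda>b. (a0 \<circ> b, y - a0 (b x))) St {z \<in> A \<times> M. \<Phi> z = y}"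
      proof (rule bij_betwI[where g = "\<lambda>z. c0 \<circ> fst z"])
        show "(\<lambda>b. (a0 \<circ> b, y - a0 (b x))) \<in> St \<rightarrow> {z \<in> A \<times> M. \<Phi> z = y}"
        proof
          fix b assume b: "b \<in> St"
          have "a0 (b x - x) = a0 (b x) - a0 x"
            using add_on_diff[OF asub_H add_A[OF y(1)], of "b x" x] b x by (auto simp: St_def)
          then have "y - a0 (b x) = m0 - a0 (b x - x)" using y by simp
          moreover have "m0 - a0 (b x - x) \<in> M" using b y M' by (auto simp: St_def intro: asub_diff)
          ultimately have "y - a0 (b x) \<in> M" by simp
          then show "(a0 \<circ> b, y - a0 (b x)) \<in> {z \<in> A \<times> M. \<Phi> z = y}"
            using b y A_comp by (auto simp: St_def \<Phi>_def)
        qed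
        show "(\<lambda>z. c0 \<circ> fst z) \<in> {z \<in> A \<times> M. \<Phi> z = y} \<rightarrow> St"
        proof
          fix z assume "z \<in> {z \<in> A \<times> M. \<Phi> z = y}"
          then obtain a u where z: "z = (a, u)" "a \<in> A" "u \<in> M" "a x + u = y" by (auto simp: \<Phi>_def)
          have xH: "x \<in> H" using x by blast
          have "c0 (a x - a0 x) = c0 (a x) - x"
            using add_on_diff[OF asub_H add_A[OF c0(1)], of "a x" "a0 x"] z(2) y(1) xH c0(2) by auto
          moreover have "a x - a0 x = m0 - u" using z y by (simp add: algebra_simps)
          moreover have "m0 - u \<in> M" using z y M' by (auto intro: asub_diff)
          ultimately have "c0 (a x) - x \<in> M" using M'(3)[OF c0(1)] by metis
          then show "c0 \<circ> fst z \<in> St" using z A_comp[OF c0(1)] by (simp add: St_def)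
        qed
        show "c0 \<circ> fst (a0 \<circ> b, y - a0 (b x)) = b" for b using c0 by (auto simp: comp_def)
        show "(a0 \<circ> (c0 \<circ> fst z), y - a0 ((c0 \<circ> fst z) x)) = z" if "z \<in> {z \<in> A \<times> M. \<Phi> z = y}" for z
          using that c0 by (auto simp: \<Phi>_def comp_def)
      qed
      from bij_betw_same_card[OF this] show ?thesis by simp
    qed
    have "card (A \<times> M) = (\<Sum>y\<in>\<Phi> ` (A \<times> M). card {z \<in> A \<times> M. \<Phi> z = y})"
      using sum.image_gen[of "A \<times> M" "\<lambda>_. 1::nat" \<Phi>] finite_A finM by simp
    also have "\<dots> = card X * card St" using fib unfolding X\<Phi>[symmetric] by simp
    finally have "card X * card St = p ^ (r + m)" using A c by (simp add: card_cartesian_product power_add)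
    then obtain i where i: "card X = p ^ i" using prime_p
      by (metis divides_primepow_nat dvd_triv_left)
    have "\<exists>a\<in>A. a x - x \<notin> M" using no x(1) by blast
    then obtain a where a: "a \<in> A" "a x - x \<notin> M" by blast
    \<comment> \<open>The class contains the whole coset \<open>x + M\<close> and a point outside
      it, so its size, a power of \<open>p\<close>, exceeds \<open>p ^ m\<close>.\<close>
    have "\<Phi> (a, 0) \<in> X" "\<And>u. u \<in> M \<Longrightarrow> \<Phi> (id, u) \<in> X"
      unfolding X\<Phi> using a(1) id asub_0[OF M'(1)] by (auto simp del: id_apply)
    then have "insert (a x) ((+) x ` M) \<subseteq> X" by (auto simp: \<Phi>_def)
    moreover have "a x \<notin> (+) x ` M" using a(2) by auto
    then have "card (insert (a x) ((+) x ` M)) = Suc (card M)" using finM by (simp add: card_image)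
    moreover have "finite X" using X\<Phi> finite_A finM by simp
    ultimately have "p ^ m < p ^ i" using i c card_mono by (metis Suc_le_lessD)
    then have "m < i" using p_pos by (simp add: power_strict_increasing_iff)
    then show ?thesis using i le_imp_power_dvd[of "Suc m" i p] by simp
  qed
  ultimately have "p ^ Suc m dvd card (H - M)"
    using equiv_imp_dvd_card[of "H - M" R "p ^ Suc m"] fin_H by blast
  then have "p ^ Suc m dvd p ^ h - p ^ m" using c M'(2) finM by (simp add: card_Diff_subset)
  moreover have "p ^ Suc m dvd p ^ h" using c(3) le_imp_power_dvd[of "Suc m" h p] by simp
  moreover have "p ^ m \<le> p ^ h" using c(3) p_pos by (simp add: power_increasing)
  ultimately have "p ^ Suc m dvd p ^ m" by (metis diff_diff_cancel dvd_diff_nat)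
  then show False using p_pos by (simp add: dvd_imp_le nat_dvd_not_less)
qed

end

subsection \<open>Functions that are additive modulo subgroups\<close>

context elem_ab
begin

text \<open>Modulo \<open>M\<close>, \<open>\<phi> (n + k \<cdot> r)\<close> is
  \<open>\<phi> n + k \<cdot> \<phi> r\<close>: additivity along \<open>N\<close> splits off
  \<open>n\<close>, and homogeneity handles the single remaining direction.\<close>

lemma codim1_additive:
  fixes \<phi> :: "'v \<Rightarrow> 'w::ab_group_add"
  assumes N: "asub N" "N \<subseteq> H" and r: "r \<in> H" "adj N r = H" and M: "asub M"
    and hom: "\<And>x k. x \<in> H \<Longrightarrow> \<phi> (k \<cdot> x) - k \<cdot> \<phi> x \<in> M"
    and add: "\<And>x n. x \<in> H \<Longrightarrow> n \<in> N \<Longrightarrow> \<phi> (x + n) - \<phi> x - \<phi> n \<in> M"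
    and x: "x \<in> H" and y: "y \<in> H"
  shows "\<phi> (x + y) - \<phi> x - \<phi> y \<in> M"
proof -
  have val: "\<phi> (n + k \<cdot> r) - \<phi> n - k \<cdot> \<phi> r \<in> M" if "n \<in> N" for n k
    using asub_add[OF M add[of "k \<cdot> r" n] hom[OF r(1), of k]] that r asub_ism[OF asub_H]
    by (simp add: algebra_simps)
  obtain n k where n: "n \<in> N" "x = n + k \<cdot> r" using x r by (metis adjE)
  obtain m l where m: "m \<in> N" "y = m + l \<cdot> r" using y r by (metis adjE)
  have nm: "n + m \<in> N" using n m N asub_add by blast
  have xy: "x + y = (n + m) + (k + l) \<cdot> r" using n m by (simp add: ism_add_left)
  have 1: "\<phi> (n + m) - \<phi> n - \<phi> m \<in> M" using add n m N by blast
  have "(\<phi> (x + y) - \<phi> (n + m) - (k + l) \<cdot> \<phi> r) + (\<phi> (n + m) - \<phi> n - \<phi> m) -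
      (\<phi> x - \<phi> n - k \<cdot> \<phi> r) - (\<phi> y - \<phi> m - l \<cdot> \<phi> r) \<in> M"
    using asub_diff[OF M asub_diff[OF M asub_add[OF M _ 1]]] val[OF nm, of "k + l", folded xy]
      val[OF n(1), of k, folded n(2)] val[OF m(1), of l, folded m(2)] by blast
  then show ?thesis by (simp add: ism_add_left)
qed

text \<open>The directions along which \<phi> is additive modulo \<open>M\<close> from every base
  point. For homogeneous \<phi> they form a subgroup, so additivity can be tested on
  generators.\<close>

definition adds :: "('v \<Rightarrow> 'w::ab_group_add) \<Rightarrow> 'w set \<Rightarrow> 'v set" where
  "adds \<phi> M = {n\<in>H. \<forall>x\<in>H. \<phi> (x + n) - \<phi> x - \<phi> n \<in> M}"

lemma adds_subset: "adds \<phi> M \<subseteq> H" by (auto simp: adds_def)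

lemma addsD: "n \<in> adds \<phi> M \<Longrightarrow> x \<in> H \<Longrightarrow> \<phi> (x + n) - \<phi> x - \<phi> n \<in> M"
  by (simp add: adds_def)

lemma asub_adds:
  fixes \<phi> :: "'v \<Rightarrow> 'w::ab_group_add"
  assumes M: "asub M" and hom: "\<And>x k. x \<in> H \<Longrightarrow> \<phi> (k \<cdot> x) - k \<cdot> \<phi> x \<in> M"
  shows "asub (adds \<phi> M)"
proof -
  have 0: "\<phi> 0 \<in> M" using hom[OF asub_0[OF asub_H], of 0] by simp
  have neg: "\<phi> (- x) + \<phi> x \<in> M" if "x \<in> H" for x using hom[OF that, of "- 1"] by simp
  have minus: "- n \<in> adds \<phi> M" if n: "n \<in> adds \<phi> M" for n
    unfolding adds_def
  proof (intro CollectI conjI ballI)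
    have nH: "n \<in> H" using n adds_subset by blast
    then show "- n \<in> H" using asub_H asub_minus by blast
    fix x assume x: "x \<in> H"
    then have "\<phi> ((x - n) + n) - \<phi> (x - n) - \<phi> n \<in> M" using addsD[OF n] nH asub_H asub_diff by blast
    from asub_minus[OF M asub_add[OF M this neg[OF nH]]]
    show "\<phi> (x + - n) - \<phi> x - \<phi> (- n) \<in> M" by (simp add: algebra_simps)
  qed
  have add: "n + m \<in> adds \<phi> M" if n: "n \<in> adds \<phi> M" and m: "m \<in> adds \<phi> M" for n m
    unfolding adds_def
  proof (intro CollectI conjI ballI)
    have H: "n \<in> H" "m \<in> H" using n m adds_subset by blast+
    then show "n + m \<in> H" using asub_H asub_add by blast
    fix x assume x: "x \<in> H"
    have "(\<phi> ((x + n) + m) - \<phi> (x + n) - \<phi> m) + (\<phi> (x + n) - \<phi> x - \<phi> n) - (\<phi> (n + m) - \<phi> n - \<phi> m) \<in> M"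
      using asub_diff[OF M asub_add[OF M addsD[OF m asub_add[OF asub_H x H(1)]] addsD[OF n x]] addsD[OF m H(1)]] .
    then show "\<phi> (x + (n + m)) - \<phi> x - \<phi> (n + m) \<in> M" by (simp add: algebra_simps)
  qed
  have "0 \<in> adds \<phi> M"
    using 0 asub_minus[OF M] asub_0[OF asub_H] by (auto simp: adds_def)
  then show ?thesis unfolding asub_def using add minus by (metis diff_conv_add_uminus)
qed

lemma adds_eq_H:
  fixes \<phi> :: "'v \<Rightarrow> 'w::ab_group_add"
  assumes M: "asub M" and hom: "\<And>x k. x \<in> H \<Longrightarrow> \<phi> (k \<cdot> x) - k \<cdot> \<phi> x \<in> M"
    and N: "asub N" "N \<subseteq> adds \<phi> M" and c: "card N = p ^ j" "card H = p ^ Suc j"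
  shows "adds \<phi> M = H"
proof -
  have NH: "N \<subseteq> H" using N adds_subset by blast
  obtain r where r: "r \<in> H" "r \<notin> N" using proper_extend[OF N(1) NH c] by blast
  have "adj N r = H" using adj_eq_H[OF N(1) NH c r] .
  then have "\<phi> (x + y) - \<phi> x - \<phi> y \<in> M" if "x \<in> H" "y \<in> H" for x y
    using codim1_additive[OF N(1) NH r(1) _ M hom] N(2) addsD that by blast
  then show ?thesis by (auto simp: adds_def)
qed

text \<open>A proper subgroup of the plane \<open>W\<close> has at most \<open>p\<close> elements,
  for a second independent vector in it would already span \<open>W\<close>.\<close>

lemma cyclic_of_proper:
  assumes W: "W \<subseteq> H" "card W = p ^ 2" and L: "asub L" "L \<subseteq> W" "L \<noteq> W" and c: "c \<in> L" "c \<noteq> 0"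
  shows "L = adj {0} c"
proof
  have s0: "asub {0}" "{0} \<subseteq> H" using asub_H by (auto simp: asub_def)
  show sub: "adj {0} c \<subseteq> L" using adj_subset[OF L(1)] asub_0[OF L(1)] c by simp
  have cH: "c \<in> H" "c \<notin> {0}" using c L W by auto
  have s1: "asub (adj {0} c)" "adj {0} c \<subseteq> H" "card (adj {0} c) = p"
    using asub_adj[OF s0(1)] adj_in_H[OF s0(2) cH(1)] card_adj[OF s0 cH] by auto
  show "L \<subseteq> adj {0} c"
  proof (rule ccontr)
    assume "\<not> L \<subseteq> adj {0} c"
    then obtain d where d: "d \<in> L" "d \<notin> adj {0} c" by blast
    have "card (adj (adj {0} c) d) = p ^ 2"
      using card_adj[OF s1(1,2) _ d(2)] d L W s1(3) by (auto simp: power2_eq_square)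
    moreover have "adj (adj {0} c) d \<subseteq> W" using adj_subset[OF L(1) sub d(1)] L(2) by blast
    ultimately have "adj (adj {0} c) d = W" using W fin_H finite_subset card_subset_eq by metis
    then show False using adj_subset[OF L(1) sub d(1)] L by blast
  qed
qed

text \<open>\<open>D v\<close> bounds the failure of \<open>\<phi>\<close> to be additive in direction \<open>v\<close>. Either \<open>\<phi>\<close> is
  additive modulo a line \<open>L\<close> of \<open>W\<close>, and then its exactly additive part can be extended into \<open>L\<close>; or any
  two independent vectors \<open>v\<close> with \<open>D v \<noteq> W\<close> have \<open>D v\<close> meeting in \<open>0\<close>, which forces \<open>\<phi>\<close> to
  be additive on their span.\<close>

lemma additive_selection:
  fixes \<phi> :: "'v \<Rightarrow> 'v" and D :: "'v \<Rightarrow> 'v set"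
  assumes W: "asub W" "W \<subseteq> H" "card W = p ^ 2" and cH: "card H = p ^ 5"
    and \<phi>W: "\<And>x. x \<in> H \<Longrightarrow> \<phi> x \<in> W" and \<phi>k: "\<And>x k. x \<in> H \<Longrightarrow> \<phi> (k \<cdot> x) = k \<cdot> \<phi> x"
    and inv: "\<And>x w. x \<in> H \<Longrightarrow> w \<in> W \<Longrightarrow> \<phi> (x + w) = \<phi> x"
    and D: "\<And>v. v \<in> H \<Longrightarrow> asub (D v)" "\<And>v. v \<in> H \<Longrightarrow> D v \<subseteq> W"
    and def: "\<And>x v. x \<in> H \<Longrightarrow> v \<in> H \<Longrightarrow> \<phi> (x + v) - \<phi> x - \<phi> v \<in> D v"
  obtains \<beta> where "add_on H \<beta>" "\<And>w. w \<in> W \<Longrightarrow> \<beta> w = 0" "\<And>x. x \<in> H \<Longrightarrow> \<beta> x \<in> W"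
    "\<And>v. v \<in> H \<Longrightarrow> \<phi> v - \<beta> v \<in> D v"
proof -
  have \<phi>0: "\<phi> w = 0" if "w \<in> W" for w
    using inv[OF asub_0[OF asub_H] that] \<phi>k[OF asub_0[OF asub_H], of 0] by simp
  have \<phi>p: "int p \<cdot> \<phi> x = 0" if "x \<in> H" for x using p_H \<phi>W W that by blast
  have hom: "\<phi> (k \<cdot> x) - k \<cdot> \<phi> x \<in> M" if "asub M" "x \<in> H" for M x k
    using \<phi>k that asub_0 by simp
  have asY: "asub (adds \<phi> M)" if "asub M" for M using asub_adds[OF that hom] that by blast
  have WY: "W \<subseteq> adds \<phi> M" if "asub M" for M
    using inv \<phi>0 W asub_0[OF that] by (auto simp: adds_def)
  have DY: "v \<in> adds \<phi> (D v)" if "v \<in> H" for v using def that by (auto simp: adds_def)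
  \<comment> \<open>\<open>W\<close>, \<open>x\<close> and \<open>y\<close> generate a subgroup of
    order \<open>p ^ 4\<close>, of index \<open>p\<close> in \<open>H\<close>. Two directions of
    additivity that are independent over \<open>W\<close> therefore give all of them.\<close>
  have S1: "adds \<phi> M = H"
    if M: "asub M" and x: "x \<in> adds \<phi> M" "x \<notin> W" and y: "y \<in> adds \<phi> M" "y \<notin> adj W x" for M x y
  proof -
    have xy: "x \<in> H" "y \<in> H" using x y adds_subset by blast+
    have s1: "asub (adj W x)" "adj W x \<subseteq> H" "card (adj W x) = p ^ 3"
      using asub_adj W adj_in_H card_adj x(2) xy by (auto simp: numeral_3_eq_3 power2_eq_square)
    have s2: "asub (adj (adj W x) y)" "card (adj (adj W x) y) = p ^ 4"
      using asub_adj[OF s1(1)] card_adj[OF s1(1,2) xy(2) y(2)] s1(3) by (auto simp: power_numeral_reduce)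
    have "adj (adj W x) y \<subseteq> adds \<phi> M"
      using adj_subset[OF asY[OF M] adj_subset[OF asY[OF M] WY[OF M] x(1)] y(1)] .
    then show ?thesis using adds_eq_H[OF M hom[OF M] s2(1) _ s2(2)] cH by simp
  qed
  show ?thesis
  proof (cases "\<exists>L. asub L \<and> L \<subseteq> W \<and> L \<noteq> W \<and> adds \<phi> L = H")
    case True
    then obtain L where L: "asub L" "L \<subseteq> W" "L \<noteq> W" "adds \<phi> L = H" by blast
    have "add_on W (\<lambda>_. 0 :: 'v)" "\<forall>n\<in>W. 0 - \<phi> n \<in> L" using \<phi>0 asub_0[OF L(1)] by (auto simp: add_on_def)
    then obtain \<mu> where \<mu>: "add_on H \<mu>" "\<forall>n\<in>W. \<mu> n = 0" "\<forall>x\<in>H. \<mu> x - \<phi> x \<in> L"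
      using extend_add_mod[OF W(1,2) _ _ L(1) \<phi>p hom[OF L(1)], of "\<lambda>_. 0"] L(4) addsD by metis
    \<comment> \<open>On \<open>Y\<close> the function \<phi> is exactly additive, so
      \<open>\<phi> - \<mu>\<close> is additive there with values in \<open>L\<close>. Its extension
      \<nu> makes \<open>\<mu> + \<nu>\<close> equal to \<phi> on \<open>Y\<close> and congruent to
      it modulo \<open>L\<close> elsewhere.\<close>
    define Y where "Y = adds \<phi> {0}"
    have s0: "asub {0::'v}" by (simp add: asub_def)
    have Y: "asub Y" "Y \<subseteq> H" "W \<subseteq> Y" using asY[OF s0] adds_subset WY[OF s0] by (auto simp: Y_def)
    have "add_on Y (\<lambda>x. \<phi> x - \<mu> x)"
      unfolding add_on_def
    proof (intro ballI)
      fix x y assume "x \<in> Y" "y \<in> Y"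
      then have "\<phi> (x + y) = \<phi> x + \<phi> y" "x \<in> H" "y \<in> H"
        using addsD[of y \<phi> "{0}" x] Y(2) by (auto simp: Y_def algebra_simps)
      then show "\<phi> (x + y) - \<mu> (x + y) = \<phi> x - \<mu> x + (\<phi> y - \<mu> y)" using add_onD[OF \<mu>(1)] by simp
    qed
    moreover have L': "\<phi> x - \<mu> x \<in> L" if "x \<in> H" for x using asub_minus[OF L(1)] \<mu>(3) that by fastforce
    ultimately obtain \<nu> where \<nu>: "add_on H \<nu>" "\<forall>n\<in>Y. \<nu> n = \<phi> n - \<mu> n" "\<forall>x\<in>H. \<nu> x - 0 \<in> L"
      using extend_add_mod[OF Y(1,2), of "\<lambda>x. \<phi> x - \<mu> x" "\<lambda>_. 0" L] L(1) asub_0[OF L(1)] Y(2) by auto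
    show ?thesis
    proof (rule that[of "\<lambda>x. \<mu> x + \<nu> x"])
      show "add_on H (\<lambda>x. \<mu> x + \<nu> x)" using \<mu>(1) \<nu>(1) by (simp add: add_on_def)
      show "\<mu> w + \<nu> w = 0" if "w \<in> W" for w using \<mu>(2) \<nu>(2) \<phi>0 Y(3) that by auto
      have lW: "\<mu> x + \<nu> x \<in> W" if "x \<in> H" for x
      proof -
        have "\<mu> x - \<phi> x \<in> W" "\<nu> x \<in> W" using \<mu>(3) \<nu>(3) L(2) that by auto
        from asub_add[OF W(1) asub_add[OF W(1) this(1) \<phi>W[OF that]] this(2)] show ?thesis by simp
      qed
      then show "\<mu> x + \<nu> x \<in> W" if "x \<in> H" for x using that .
      show "\<phi> v - (\<mu> v + \<nu> v) \<in> D v" if v: "v \<in> H" for v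
      proof (cases "v \<in> Y")
        case True then show ?thesis using \<nu>(2) asub_0[OF D(1)[OF v]] by simp
      next
        case False
        \<comment> \<open>Outside \<open>Y\<close> some defect in direction \<open>v\<close> is
          nonzero. It lies in \<open>D v\<close> and generates \<open>L\<close>, so an error in
          \<open>L\<close> is admissible at \<open>v\<close>.\<close>
        then obtain x where x: "x \<in> H" "\<phi> (x + v) - \<phi> x - \<phi> v \<noteq> 0" using v by (auto simp: Y_def adds_def)
        let ?c = "\<phi> (x + v) - \<phi> x - \<phi> v"
        have c: "?c \<in> L" "?c \<in> D v" using addsD[of v \<phi> L x] L(4) v x(1) def by auto
        have "L = adj {0} ?c" using cyclic_of_proper[OF W(2,3) L(1-3) c(1) x(2)] .
        then have "L \<subseteq> D v" using adj_subset[OF D(1)[OF v], of "{0}"] asub_0[OF D(1)[OF v]] c(2) by auto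
        moreover have "\<phi> v - (\<mu> v + \<nu> v) \<in> L"
          using asub_diff[OF L(1) L'[OF v], of "\<nu> v"] \<nu>(3) v by (simp add: algebra_simps)
        ultimately show ?thesis by blast
      qed
    qed
  next
    case no: False
    \<comment> \<open>Only vectors in \<open>S\<close> constrain \<beta>; at the others every value
      in \<open>W\<close> is admissible.\<close>
    define S where "S = {v\<in>H. D v \<noteq> W}"
    \<comment> \<open>A common nonzero element would make \<open>D x\<close> and \<open>D y\<close>
      the same line, and \<phi> would be additive modulo it everywhere, against the case
      assumption.\<close>
    have disj: "D x \<inter> D y = {0}" if x: "x \<in> S" "x \<notin> W" and y: "y \<in> S" "y \<notin> adj W x" for x y
    proof (rule ccontr)
      have xy: "x \<in> H" "y \<in> H" "D x \<noteq> W" "D y \<noteq> W" using x y by (auto simp: S_def)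
      assume "D x \<inter> D y \<noteq> {0}"
      then obtain c where c: "c \<in> D x" "c \<in> D y" "c \<noteq> 0"
        using asub_0[OF D(1)[OF xy(1)]] asub_0[OF D(1)[OF xy(2)]] by blast
      have "D x = adj {0} c" "D y = adj {0} c"
        using cyclic_of_proper[OF W(2,3) D(1) D(2) _ _ c(3)] xy c by auto
      then have "adds \<phi> (D x) = H"
        using S1[OF D(1)[OF xy(1)] DY[OF xy(1)] x(2) _ y(2)] DY[OF xy(2)] by simp
      then show False using no D xy by blast
    qed
    \<comment> \<open>The defect is bounded by \<open>D x\<close> when the sum is read as a step
      along \<open>x\<close>, and by \<open>D y\<close> when it is read as a step along
      \<open>y\<close>.\<close>
    have pair: "\<phi> (a \<cdot> x + b \<cdot> y) = a \<cdot> \<phi> x + b \<cdot> \<phi> y"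
      if x: "x \<in> S" "x \<notin> W" and y: "y \<in> S" "y \<notin> adj W x" for x y a b
    proof -
      have xy: "x \<in> H" "y \<in> H" "a \<cdot> x \<in> H" "b \<cdot> y \<in> H" using x y asub_ism[OF asub_H] by (auto simp: S_def)
      have "a \<cdot> x \<in> adds \<phi> (D x)" "b \<cdot> y \<in> adds \<phi> (D y)"
        using asub_ism[OF asY[OF D(1)]] DY xy by auto
      then have "\<phi> (b \<cdot> y + a \<cdot> x) - \<phi> (b \<cdot> y) - \<phi> (a \<cdot> x) \<in> D x"
        "\<phi> (a \<cdot> x + b \<cdot> y) - \<phi> (a \<cdot> x) - \<phi> (b \<cdot> y) \<in> D y"
        using addsD xy by blast+
      then have "\<phi> (a \<cdot> x + b \<cdot> y) - \<phi> (a \<cdot> x) - \<phi> (b \<cdot> y) \<in> D x \<inter> D y" by (simp add: algebra_simps)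
      then show ?thesis using disj[OF x y] \<phi>k xy by (simp add: algebra_simps)
    qed
    have S_H: "S \<subseteq> H" by (auto simp: S_def)
    \<comment> \<open>The cases are the ranks 0 to 3 of \<open>S\<close> modulo \<open>W\<close>.
      Independent vectors of \<open>S\<close> together with \<open>W\<close> span \<open>Z\<close>,
      and at rank 3 this span is \<open>H\<close>.\<close>
    have "\<exists>Z. asub Z \<and> Z \<subseteq> H \<and> W \<subseteq> Z \<and> S \<subseteq> Z \<and> add_on Z \<phi>"
    proof (cases "S \<subseteq> W")
      case True
      have "add_on W \<phi>" using \<phi>0 asub_add[OF W(1)] by (auto simp: add_on_def)
      then show ?thesis using True W by blast
    next
      case False
      then obtain x where x: "x \<in> S" "x \<notin> W" by blast
      have xH: "x \<in> H" using x S_H by blast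
      let ?Z1 = "adj W x"
      have Z1: "asub ?Z1" "?Z1 \<subseteq> H" "W \<subseteq> ?Z1" "x \<in> ?Z1"
        using asub_adj[OF W(1)] adj_in_H[OF W(2) xH] adj_superset[of W x] adj_self[OF W(1)] by auto
      have vW: "\<phi> (w + u) = \<phi> u" if "w \<in> W" "u \<in> H" for w u using inv[OF that(2,1)] by (simp add: add.commute)
      show ?thesis
      proof (cases "S \<subseteq> ?Z1")
        case True
        have "add_on ?Z1 \<phi>"
          unfolding add_on_def
        proof (intro ballI)
          fix u v assume "u \<in> ?Z1" "v \<in> ?Z1"
          then obtain n k m l where u: "n \<in> W" "u = n + k \<cdot> x" and v: "m \<in> W" "v = m + l \<cdot> x" by (metis adjE)
          have "u + v = (n + m) + (k + l) \<cdot> x" using u v by (simp add: ism_add_left)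
          then have "\<phi> (u + v) = (k + l) \<cdot> \<phi> x"
            using vW[OF asub_add[OF W(1) u(1) v(1)] asub_ism[OF asub_H xH]] \<phi>k[OF xH] by simp
          then show "\<phi> (u + v) = \<phi> u + \<phi> v"
            using u v vW asub_ism[OF asub_H xH] \<phi>k[OF xH] by (simp add: ism_add_left)
        qed
        then show ?thesis using True Z1 by blast
      next
        case False
        then obtain y where y: "y \<in> S" "y \<notin> ?Z1" by blast
        have yH: "y \<in> H" using y S_H by blast
        let ?Z2 = "adj ?Z1 y"
        have Z2: "asub ?Z2" "?Z2 \<subseteq> H" "W \<subseteq> ?Z2" "?Z1 \<subseteq> ?Z2" "x \<in> ?Z2" "y \<in> ?Z2"
          using asub_adj[OF Z1(1)] adj_in_H[OF Z1(2) yH] adj_superset[of ?Z1 y] adj_self[OF Z1(1)] Z1 by auto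
        have yW: "y \<notin> W" using y(2) Z1(3) by blast
        have add2: "\<phi> (n + a \<cdot> x + b \<cdot> y) = a \<cdot> \<phi> x + b \<cdot> \<phi> y" if "n \<in> W" for n a b
          using vW[OF that, of "a \<cdot> x + b \<cdot> y"] pair[OF x y] xH yH asub_H
          by (simp add: add.assoc asub_add asub_ism)
        show ?thesis
        proof (cases "S \<subseteq> ?Z2")
          case True
          have "add_on ?Z2 \<phi>"
            unfolding add_on_def
          proof (intro ballI)
            fix u v assume "u \<in> ?Z2" "v \<in> ?Z2"
            then obtain n a b m c d where u: "n \<in> W" "u = n + a \<cdot> x + b \<cdot> y" and v: "m \<in> W" "v = m + c \<cdot> x + d \<cdot> y"
              by (metis adjE)
            have "u + v = (n + m) + (a + c) \<cdot> x + (b + d) \<cdot> y" using u v by (simp add: ism_add_left algebra_simps)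
            then have "\<phi> (u + v) = (a + c) \<cdot> \<phi> x + (b + d) \<cdot> \<phi> y"
              using add2[OF asub_add[OF W(1) u(1) v(1)]] by simp
            moreover have "\<phi> u = a \<cdot> \<phi> x + b \<cdot> \<phi> y" "\<phi> v = c \<cdot> \<phi> x + d \<cdot> \<phi> y"
              using u v add2 by blast+
            ultimately show "\<phi> (u + v) = \<phi> u + \<phi> v" by (simp add: ism_add_left algebra_simps)
          qed
          then show ?thesis using True Z2 by blast
        next
          case False
          then obtain z where z: "z \<in> S" "z \<notin> ?Z2" by blast
          have zH: "z \<in> H" using z S_H by blast
          let ?Z3 = "adj ?Z2 z"
          have Z3: "asub ?Z3" "?Z3 \<subseteq> H" "W \<subseteq> ?Z3"
            using asub_adj[OF Z2(1)] adj_in_H[OF Z2(2) zH] adj_superset[of ?Z2 z] Z2(3) by auto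
          have zx: "z \<notin> adj W x" using z(2) Z2(4) by blast
          have zy: "z \<notin> adj W y" using z(2) adj_subset[OF Z2(1) Z2(3) Z2(6)] by blast
          \<comment> \<open>Steps along \<open>x\<close> and along \<open>y\<close> both reduce the
            triple sum to pairs already treated, and \<open>D x\<close> and \<open>D y\<close> meet
            in 0.\<close>
          have add3: "\<phi> (n + a \<cdot> x + b \<cdot> y + c \<cdot> z) = a \<cdot> \<phi> x + b \<cdot> \<phi> y + c \<cdot> \<phi> z" if n: "n \<in> W" for n a b c
          proof -
            have m: "a \<cdot> x \<in> H" "b \<cdot> y \<in> H" "c \<cdot> z \<in> H" using xH yH zH asub_ism[OF asub_H] by auto
            have "a \<cdot> x \<in> adds \<phi> (D x)" "b \<cdot> y \<in> adds \<phi> (D y)"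
              using asub_ism[OF asY[OF D(1)]] DY xH yH by auto
            then have "\<phi> ((b \<cdot> y + c \<cdot> z) + a \<cdot> x) - \<phi> (b \<cdot> y + c \<cdot> z) - \<phi> (a \<cdot> x) \<in> D x"
              "\<phi> ((a \<cdot> x + c \<cdot> z) + b \<cdot> y) - \<phi> (a \<cdot> x + c \<cdot> z) - \<phi> (b \<cdot> y) \<in> D y"
              using addsD m asub_add[OF asub_H] by blast+
            then have "\<phi> (a \<cdot> x + b \<cdot> y + c \<cdot> z) - (a \<cdot> \<phi> x + b \<cdot> \<phi> y + c \<cdot> \<phi> z) \<in> D x \<inter> D y"
              using pair[OF y(1) yW z(1) zy, of b c] pair[OF x z(1) zx, of a c] \<phi>k xH yH
              by (simp add: algebra_simps)
            then have "\<phi> (a \<cdot> x + b \<cdot> y + c \<cdot> z) = a \<cdot> \<phi> x + b \<cdot> \<phi> y + c \<cdot> \<phi> z"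
              using disj[OF x y] by simp
            then show ?thesis using vW[OF n, of "a \<cdot> x + b \<cdot> y + c \<cdot> z"] m asub_add[OF asub_H]
              by (simp add: add.assoc)
          qed
          have cZ: "card ?Z1 = p ^ 3" "card ?Z2 = p ^ 4" "card ?Z3 = p ^ 5"
            using card_adj[OF W(1,2) xH x(2)] card_adj[OF Z1(1,2) yH y(2)] card_adj[OF Z2(1,2) zH z(2)] W(3)
            by (simp_all add: power_numeral_reduce)
          have "add_on ?Z3 \<phi>"
            unfolding add_on_def
          proof (intro ballI)
            fix u v assume "u \<in> ?Z3" "v \<in> ?Z3"
            then obtain n a b c m a' b' c' where u: "n \<in> W" "u = n + a \<cdot> x + b \<cdot> y + c \<cdot> z"
              and v: "m \<in> W" "v = m + a' \<cdot> x + b' \<cdot> y + c' \<cdot> z"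
              by (metis adjE)
            have "u + v = (n + m) + (a + a') \<cdot> x + (b + b') \<cdot> y + (c + c') \<cdot> z"
              using u v by (simp add: ism_add_left algebra_simps)
            then have "\<phi> (u + v) = (a + a') \<cdot> \<phi> x + (b + b') \<cdot> \<phi> y + (c + c') \<cdot> \<phi> z"
              using add3[OF asub_add[OF W(1) u(1) v(1)]] by simp
            moreover have "\<phi> u = a \<cdot> \<phi> x + b \<cdot> \<phi> y + c \<cdot> \<phi> z"
              "\<phi> v = a' \<cdot> \<phi> x + b' \<cdot> \<phi> y + c' \<cdot> \<phi> z"
              using u v add3 by blast+
            ultimately show "\<phi> (u + v) = \<phi> u + \<phi> v" by (simp add: ism_add_left algebra_simps)
          qed
          moreover have "?Z3 = H" using card_subset_eq[OF fin_H Z3(2)] cZ cH by simp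
          ultimately show ?thesis using Z3 S_H by blast
        qed
      qed
    qed
    then obtain Z where Z: "asub Z" "Z \<subseteq> H" "W \<subseteq> Z" "S \<subseteq> Z" "add_on Z \<phi>" by blast
    have \<phi>d: "\<phi> (x + y) - \<phi> x - \<phi> y \<in> W" if "x \<in> H" "y \<in> H" for x y
      using \<phi>W asub_diff[OF W(1)] asub_add[OF asub_H] that by simp
    have "\<forall>n\<in>Z. \<phi> n - \<phi> n \<in> W" using asub_0[OF W(1)] by simp
    then obtain \<beta> where \<beta>: "add_on H \<beta>" "\<forall>n\<in>Z. \<beta> n = \<phi> n" "\<forall>x\<in>H. \<beta> x - \<phi> x \<in> W"
      using extend_add_mod[OF Z(1,2,5) _ W(1) \<phi>p hom[OF W(1)] \<phi>d] by blast
    have \<beta>W: "\<beta> x \<in> W" if "x \<in> H" for x using asub_add[OF W(1) bspec[OF \<beta>(3) that] \<phi>W[OF that]] by simp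
    show ?thesis
    proof (rule that[OF \<beta>(1) _ \<beta>W])
      show "\<beta> w = 0" if "w \<in> W" for w using \<beta>(2) \<phi>0 Z(3) that by auto
      show "\<phi> v - \<beta> v \<in> D v" if v: "v \<in> H" for v
      proof (cases "v \<in> S")
        case True then show ?thesis using \<beta>(2) Z(4) asub_0[OF D(1)[OF v]] by auto
      next
        case False
        then have "D v = W" using v by (simp add: S_def)
        then show ?thesis using asub_diff[OF W(1) \<phi>W[OF v] \<beta>W[OF v]] by simp
      qed
    qed
  qed
qed

end

subsection \<open>Normalised isomorphisms\<close>

context lin_act
begin

text \<open>When \<open>A\<close> fixes \<open>W\<close> pointwise, this is the group of
  translations by elements of \<open>W\<close> that map \<open>orb v\<close> to itself. It measures
  how far the \<open>W\<close>-part of a point of the orbit is free.\<close>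

definition st :: "'v set \<Rightarrow> 'v \<Rightarrow> 'v set" where "st W v = {w\<in>W. v + w \<in> orb v}"

lemma stI: "w \<in> W \<Longrightarrow> a \<in> A \<Longrightarrow> a v = v + w \<Longrightarrow> w \<in> st W v"
  unfolding st_def orb_def by (metis (no_types, lifting) image_eqI mem_Collect_eq)

lemma stE:
  assumes "w \<in> st W v" obtains a where "w \<in> W" "a \<in> A" "a v = v + w"
  using assms unfolding st_def orb_def by (metis (no_types, lifting) imageE mem_Collect_eq)

lemma asub_st:
  assumes W: "asub W" "W \<subseteq> H" and fixed: "\<And>a w. a \<in> A \<Longrightarrow> w \<in> W \<Longrightarrow> a w = w" and v: "v \<in> H"
  shows "asub (st W v)"
  unfolding asub_def
proof (intro conjI ballI)
  show "0 \<in> st W v" using asub_0[OF W(1)] by (simp add: st_def)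
  fix w u assume "w \<in> st W v" "u \<in> st W v"
  then obtain a b where a: "w \<in> W" "a \<in> A" "a v = v + w" and b: "u \<in> W" "b \<in> A" "b v = v + u" by (metis stE)
  obtain c where c: "c \<in> A" "c (b v) = v" using A_inverse[OF b(2)] by metis
  have "v = c v + u" using A_add[OF c(1) v, of u] b c fixed[OF c(1) b(1)] W by auto
  then have "c v = v - u" by (simp add: algebra_simps)
  then have "a (c v) = v + w - u"
    using add_on_diff[OF asub_H add_A[OF a(2)] v, of u] a fixed[OF a(2) b(1)] b W by auto
  then show "w - u \<in> st W v"
    using stI[of "w - u" W "a \<circ> c" v] a b c A_comp asub_diff[OF W(1)] by (simp add: algebra_simps)
qed

end

locale normal_iso = lin_act p H A for p :: nat and H :: "'v::ab_group_add set" and A +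
  fixes f :: "'v \<Rightarrow> 'v" and W :: "'v set" and e :: 'v
  assumes odd_p: "odd p" and W: "asub W" "W \<subseteq> H" and card_W: "card W = p ^ 2" and card_H: "card H = p ^ 5"
    and fix_W: "\<And>a w. a \<in> A \<Longrightarrow> w \<in> W \<Longrightarrow> a w = w"
    and e: "e \<in> H" "e \<notin> W" and fix_e: "\<And>a. a \<in> A \<Longrightarrow> a e - e \<in> W"
    and iso_f: "iso f" and f_ism: "\<And>x k. x \<in> H \<Longrightarrow> f (k \<cdot> x) = k \<cdot> f x"
    and f_N: "\<And>n. n \<in> adj W e \<Longrightarrow> f n = n"
    and f_mod_N: "\<And>x. x \<in> H \<Longrightarrow> f x - x \<in> adj W e"
begin

abbreviation N where "N \<equiv> adj W e"

text \<open>Together with \<phi> these are the coordinates of \<open>f x - x\<close> along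
  \<open>e\<close> and in \<open>W\<close>. The integer \<open>h x\<close> is an arbitrary
  representative, meaningful only modulo \<open>p\<close>, so all statements about it are
  congruences; \<open>\<phi> x\<close> does not depend on the choice.\<close>

definition h :: "'v \<Rightarrow> int" where "h x = (SOME k. f x - x - k \<cdot> e \<in> W)"
definition \<phi> :: "'v \<Rightarrow> 'v" where "\<phi> x = f x - x - h x \<cdot> e"

lemma N: "asub N" "N \<subseteq> H" "card N = p ^ 3" "W \<subseteq> N" "e \<in> N"
  using asub_adj[OF W(1)] adj_in_H[OF W(2) e(1)] card_adj[OF W e] card_W adj_superset[of W e] adj_self[OF W(1)]
  by (auto simp: numeral_3_eq_3 power2_eq_square)

lemma \<phi>_W: "x \<in> H \<Longrightarrow> \<phi> x \<in> W"
proof -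
  assume "x \<in> H"
  then obtain w k where "w \<in> W" "f x - x = w + k \<cdot> e" using f_mod_N by (metis adjE)
  then have "f x - x - k \<cdot> e \<in> W" by simp
  then show ?thesis unfolding \<phi>_def h_def by (rule someI)
qed

lemma f_eq: "f x = x + h x \<cdot> e + \<phi> x" by (simp add: \<phi>_def)

lemma H_ism [simp]: "x \<in> H \<Longrightarrow> k \<cdot> x \<in> H" and H_add [simp]: "x \<in> H \<Longrightarrow> y \<in> H \<Longrightarrow> x + y \<in> H"
  and H_diff [simp]: "x \<in> H \<Longrightarrow> y \<in> H \<Longrightarrow> x - y \<in> H" and H_minus [simp]: "x \<in> H \<Longrightarrow> - x \<in> H"
  and e_H [simp]: "e \<in> H" and W_H: "w \<in> W \<Longrightarrow> w \<in> H" and N_H: "n \<in> N \<Longrightarrow> n \<in> H"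
  using asub_H e W N by (auto intro: asub_intros)

lemma e_W_unique:
  assumes "w \<in> W" "u \<in> W" "k \<cdot> e + w = l \<cdot> e + u"
  shows "w = u" "k \<cdot> e = l \<cdot> e"
  using adj_unique[OF W(1) e assms(1,2), of k l] assms(3) by (auto simp: add.commute)

lemma e_cong_iff: "k \<cdot> e = l \<cdot> e \<longleftrightarrow> [k = l] (mod int p)"
  using adj_unique(2)[OF W(1) e asub_0[OF W(1)] asub_0[OF W(1)], of k l] ism_cong[OF e(1)] by auto

lemma A_W: "a \<in> A \<Longrightarrow> w \<in> W \<Longrightarrow> x \<in> H \<Longrightarrow> a (x + w) = a x + w"
  using A_add[of a x w] fix_W[of a w] W_H by simp

lemma A_N: assumes "a \<in> A" "n \<in> N" shows "a n - n \<in> W"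
proof -
  obtain w k where w: "w \<in> W" "n = w + k \<cdot> e" using assms by (metis adjE)
  then have "a n - n = k \<cdot> (a e - e)"
    using assms by (simp add: A_add A_ism fix_W W_H ism_diff_right)
  then show ?thesis using fix_e[OF assms(1)] asub_ism[OF W(1)] by simp
qed

lemma f_add_N:
  assumes "x \<in> H" "n \<in> N" obtains a where "a \<in> A" "f (x + n) = f x + a n"
proof -
  obtain a where a: "a \<in> A" "f (x + n) = f x + f (a n)" using iso_step iso_f assms N_H by blast
  have "a n \<in> N" using A_N[OF a(1) assms(2)] asub_add[OF N(1), of "a n - n" n] N(4) assms(2) by auto
  then show ?thesis using that a f_N by simp
qed

text \<open>\<open>A\<close> moves \<open>n\<close> only within \<open>n + W\<close>, and
  \<open>f\<close> is the identity on \<open>N\<close>. Comparing coordinates shows that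
  \<open>h\<close> is a function on \<open>H/N\<close>; likewise \<phi> is one on
  \<open>H/W\<close>, where \<open>A\<close> leaves no choice.\<close>

lemma h_add_N: assumes "x \<in> H" "n \<in> N" shows "[h (x + n) = h x] (mod int p)"
proof -
  obtain a where a: "a \<in> A" "f (x + n) = f x + a n" using f_add_N[OF assms] .
  then have "h (x + n) \<cdot> e + \<phi> (x + n) = h x \<cdot> e + (\<phi> x + (a n - n))"
    by (simp add: f_eq algebra_simps)
  moreover have "\<phi> x + (a n - n) \<in> W" using \<phi>_W assms A_N[OF a(1) assms(2)] asub_add[OF W(1)] by blast
  ultimately show ?thesis
    using e_W_unique(2)[OF \<phi>_W[OF H_add[OF assms(1) N_H[OF assms(2)]]]] e_cong_iff by blast
qed

lemma \<phi>_add_W: assumes "x \<in> H" "w \<in> W" shows "\<phi> (x + w) = \<phi> x"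
proof -
  have wN: "w \<in> N" using assms N by blast
  obtain a where a: "a \<in> A" "f (x + w) = f x + a w" using f_add_N[OF assms(1) wN] .
  then have "h (x + w) \<cdot> e + \<phi> (x + w) = h x \<cdot> e + \<phi> x"
    using fix_W[OF a(1) assms(2)] by (simp add: f_eq algebra_simps)
  then show ?thesis using e_W_unique(1)[OF \<phi>_W \<phi>_W] assms W_H by simp
qed

lemma h_\<phi>_ism:
  assumes "x \<in> H" shows "[h (k \<cdot> x) = k * h x] (mod int p)" "\<phi> (k \<cdot> x) = k \<cdot> \<phi> x"
proof -
  have "h (k \<cdot> x) \<cdot> e + \<phi> (k \<cdot> x) = (k * h x) \<cdot> e + k \<cdot> \<phi> x"
    using f_ism[OF assms, of k] f_eq[of "k \<cdot> x"] f_eq[of x] by (simp add: ism_add_right ism_mult algebra_simps)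
  moreover have "\<phi> (k \<cdot> x) \<in> W" "k \<cdot> \<phi> x \<in> W" using \<phi>_W assms asub_ism[OF W(1)] by auto
  ultimately show "[h (k \<cdot> x) = k * h x] (mod int p)" "\<phi> (k \<cdot> x) = k \<cdot> \<phi> x"
    using e_W_unique e_cong_iff by metis+
qed

lemma h_\<phi>_N: assumes "n \<in> N" shows "[h n = 0] (mod int p)" "\<phi> n = 0"
proof -
  have "h n \<cdot> e + \<phi> n = 0 \<cdot> e + 0" using f_N[OF assms] f_eq[of n] by simp
  then show "[h n = 0] (mod int p)" "\<phi> n = 0"
    using e_W_unique[OF \<phi>_W[OF N_H[OF assms]] asub_0[OF W(1)], of "h n" 0] e_cong_iff[of "h n" 0] by simp_all
qed

text \<open>The source of all information on \<open>h\<close> and \<phi>: the additivity defect of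
  \<open>f\<close> at \<open>x\<close> and \<open>v\<close> appears as a displacement of
  \<open>v\<close> inside its own orbit. As \<open>f\<close> is trivial modulo \<open>N\<close>,
  this displacement lies in \<open>N\<close>, so \<open>h (b v)\<close> may be replaced by
  \<open>h v\<close>.\<close>

lemma step:
  assumes x: "x \<in> H" and v: "v \<in> H"
  obtains b where "b \<in> A" "b v = v + (h (x + v) - h x - h v) \<cdot> e + (\<phi> (x + v) - \<phi> x - \<phi> (b v))"
proof -
  obtain b where b: "b \<in> A" "f (x + v) = f x + f (b v)" using iso_step iso_f x v .
  have bv: "b v \<in> H" using b v by simp
  have "(f (x + v) - (x + v)) - (f x - x) - (f (b v) - b v) \<in> N"
    using asub_diff[OF N(1) asub_diff[OF N(1) f_mod_N[OF H_add[OF x v]] f_mod_N[OF x]] f_mod_N[OF bv]] .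
  then have n: "b v - v \<in> N" using b(2) by (simp add: algebra_simps)
  then have "h (b v) \<cdot> e = h v \<cdot> e" using h_add_N[OF v n] e_cong_iff by simp
  then have "b v = v + (h (x + v) - h x - h v) \<cdot> e + (\<phi> (x + v) - \<phi> x - \<phi> (b v))"
    unfolding ism_diff_left
    using b(2) f_eq[of "x + v"] f_eq[of x] f_eq[of "b v"] by (simp add: algebra_simps)
  then show ?thesis using that b by blast
qed

lemma asub_stW: "v \<in> H \<Longrightarrow> asub (st W v)" by (rule asub_st[OF W]) (rule fix_W)

definition linearizable where
  "linearizable \<longleftrightarrow> (\<exists>L. bij_betw L H H \<and> add_on H L \<and> (\<forall>v\<in>H. \<exists>a\<in>A. f v = L (a v)))"

text \<open>\<open>g\<close> maps \<open>H\<close> into \<open>N\<close> and kills \<open>N\<close>,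
  so it squares to zero and the identity plus \<open>g\<close> is invertible.\<close>

lemma unipotent_bij:
  assumes "add_on H g" "\<And>n. n \<in> N \<Longrightarrow> g n = 0" "\<And>x. x \<in> H \<Longrightarrow> g x \<in> N"
  shows "bij_betw (\<lambda>x. x + g x) H H" "add_on H (\<lambda>x. x + g x)"
proof -
  show add: "add_on H (\<lambda>x. x + g x)" using assms(1) by (simp add: add_on_def algebra_simps)
  have "inj_on (\<lambda>x. x + g x) H"
  proof (rule add_on_inj[OF asub_H add])
    fix x assume x: "x \<in> H" "x + g x = 0"
    then have "x = - g x" by (simp add: eq_neg_iff_add_eq_0)
    then have "x \<in> N" using assms(3)[OF x(1)] asub_minus[OF N(1)] by metis
    then show "x = 0" using assms(2) x(2) by force
  qed
  moreover have "(\<lambda>x. x + g x) ` H \<subseteq> H" using assms(3) N_H by auto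
  ultimately show "bij_betw (\<lambda>x. x + g x) H H" using fin_H by (simp add: bij_betw_def endo_inj_surj)
qed

text \<open>The displacements supplied by \<open>step\<close> now have no part along
  \<open>e\<close>, so the defect of \<phi> in direction \<open>v\<close> lies in
  \<open>st W v\<close>. This is the situation of \<open>additive_selection\<close> with
  \<open>D = st W\<close>.\<close>

lemma linearizable_if_h_additive:
  assumes add: "\<And>x y. x \<in> H \<Longrightarrow> y \<in> H \<Longrightarrow> [h (x + y) = h x + h y] (mod int p)"
  shows linearizable
proof -
  define L1 where "L1 x = x + h x \<cdot> e" for x
  have he: "add_on H (\<lambda>x. h x \<cdot> e)" "\<And>n. n \<in> N \<Longrightarrow> h n \<cdot> e = 0" "\<And>x. x \<in> H \<Longrightarrow> h x \<cdot> e \<in> N"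
    using add h_\<phi>_N(1) e_cong_iff[of _ 0] asub_ism[OF N(1) N(5)]
    by (auto simp: add_on_def e_cong_iff ism_add_left[symmetric])
  have L1: "bij_betw L1 H H" "add_on H L1" "\<And>n. n \<in> N \<Longrightarrow> L1 n = n"
    using unipotent_bij[OF he] he(2) unfolding L1_def by auto
  have f_L1: "f x = L1 x + \<phi> x" for x by (simp add: L1_def f_eq)
  have "\<phi> (x + v) - \<phi> x - \<phi> v \<in> st W v" if x: "x \<in> H" and v: "v \<in> H" for x v
  proof -
    obtain b where b: "b \<in> A" "b v = v + (h (x + v) - h x - h v) \<cdot> e + (\<phi> (x + v) - \<phi> x - \<phi> (b v))"
      using step[OF x v] .
    have "(h (x + v) - h x - h v) \<cdot> e = 0"
      using add[OF x v] e_cong_iff[of "h (x + v) - h x - h v" 0] by (simp add: cong_iff_dvd_diff cong_0_iff algebra_simps)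
    then have bv: "b v = v + (\<phi> (x + v) - \<phi> x - \<phi> (b v))" using b(2) by simp
    have w: "\<phi> (x + v) - \<phi> x - \<phi> (b v) \<in> W" using \<phi>_W x v b by (auto intro!: asub_diff[OF W(1)])
    then have "\<phi> (b v) = \<phi> v" using bv \<phi>_add_W[OF v w] by simp
    then show ?thesis using stI[OF w b(1) bv] by simp
  qed
  note def = this
  have stW: "st W v \<subseteq> W" for v by (auto simp: st_def)
  obtain \<beta> where \<beta>: "add_on H \<beta>" "\<And>w. w \<in> W \<Longrightarrow> \<beta> w = 0" "\<And>x. x \<in> H \<Longrightarrow> \<beta> x \<in> W"
    "\<And>v. v \<in> H \<Longrightarrow> \<phi> v - \<beta> v \<in> st W v"
    using additive_selection[OF W card_W card_H \<phi>_W h_\<phi>_ism(2) \<phi>_add_W asub_stW stW def] by blast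
  have add2: "add_on H (\<lambda>x. L1 x + \<beta> x)" using L1(2) \<beta>(1) by (simp add: add_on_def)
  have "inj_on (\<lambda>x. L1 x + \<beta> x) H"
  proof (rule add_on_inj[OF asub_H add2])
    fix x assume x: "x \<in> H" "L1 x + \<beta> x = 0"
    have "- \<beta> x \<in> W" using \<beta>(3) asub_minus[OF W(1)] x by blast
    moreover have "L1 x = - \<beta> x" using x(2) by (simp add: eq_neg_iff_add_eq_0)
    ultimately have "L1 x = L1 (- \<beta> x)" "- \<beta> x \<in> W" using L1(3)[of "- \<beta> x"] N(4) by auto
    then have "x \<in> W" using L1(1) x W_H by (metis bij_betw_def inj_onD)
    then show "x = 0" using \<beta>(2) x L1(3) N(4) by auto
  qed
  moreover have "(\<lambda>x. L1 x + \<beta> x) ` H \<subseteq> H" using L1(1) \<beta>(3) W_H bij_betwE by fastforce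
  ultimately have "bij_betw (\<lambda>x. L1 x + \<beta> x) H H" using fin_H by (simp add: bij_betw_def endo_inj_surj)
  moreover have "\<exists>a\<in>A. f v = L1 (a v) + \<beta> (a v)" if v: "v \<in> H" for v
  proof -
    obtain a where a: "\<phi> v - \<beta> v \<in> W" "a \<in> A" "a v = v + (\<phi> v - \<beta> v)" using \<beta>(4)[OF v] by (metis stE)
    have "L1 (a v) = L1 v + (\<phi> v - \<beta> v)" "\<beta> (a v) = \<beta> v"
      unfolding a(3) using a(1) add_onD[OF L1(2) v] add_onD[OF \<beta>(1) v] L1(3) \<beta>(2) N(4) W_H by auto
    then have "f v = L1 (a v) + \<beta> (a v)" using f_L1 by simp
    then show ?thesis using a(2) by blast
  qed
  ultimately show ?thesis unfolding linearizable_def using add2 by blast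
qed

end

subsection \<open>The nonlinear case\<close>

context normal_iso
begin

text \<open>The second differences of \<open>h\<close> in direction \<open>q\<close> vanish, so
  along every line parallel to \<open>q\<close> its values form an arithmetic progression modulo
  \<open>p\<close>.\<close>

definition mid_affine :: "'v \<Rightarrow> bool" where
  "mid_affine q \<longleftrightarrow> (\<forall>x\<in>H. [h (x + q + q) + h x = 2 * h (x + q)] (mod int p))"

lemma mid_affine_line:
  assumes q: "q \<in> H" "mid_affine q" and x: "x \<in> H"
  shows "[h (x + k \<cdot> q) = h x + k * (h (x + q) - h x)] (mod int p)"
proof -
  have nat: "[h (x + int b \<cdot> q) = h x + int b * (h (x + q) - h x)] (mod int p)" for b
  proof (induction b rule: nat_less_induct)
    case (1 b)
    consider "b = 0" | "b = 1" | c where "b = Suc (Suc c)"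
      by (metis One_nat_def not0_implies_Suc)
    then show ?case
    proof cases
      case (3 c)
      let ?y = "x + int c \<cdot> q" and ?d = "h (x + q) - h x"
      have y: "?y + q = x + int (Suc c) \<cdot> q" "?y + q + q = x + int b \<cdot> q"
        using 3 ism_add_left[of 1 1 q] by (simp_all add: ism_add_left algebra_simps)
      have "[h (x + int b \<cdot> q) + h ?y = 2 * h (x + int (Suc c) \<cdot> q)] (mod int p)"
        using q x unfolding mid_affine_def y[symmetric] by simp
      moreover have "[h ?y = h x + int c * ?d] (mod int p)"
        "[h (x + int (Suc c) \<cdot> q) = h x + int (Suc c) * ?d] (mod int p)" using 1 3 by auto
      ultimately have "[h (x + int b \<cdot> q) + h ?y - h ?y =
          2 * (h x + int (Suc c) * ?d) - (h x + int c * ?d)] (mod int p)"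
        by (meson cong_diff cong_scalar_left cong_trans)
      then show ?thesis using 3 by (simp add: algebra_simps)
    qed simp_all
  qed
  define b where "b = nat (k mod int p)"
  have b: "[int b = k] (mod int p)" using p_pos by (simp add: b_def cong_def)
  have "int b \<cdot> q = k \<cdot> q" using ism_cong[OF q(1) b] .
  moreover have "[h x + int b * (h (x + q) - h x) = h x + k * (h (x + q) - h x)] (mod int p)"
    using b by (intro cong_add cong_mult cong_refl)
  ultimately show ?thesis using nat[of b] cong_trans by metis
qed

lemma mid_affine_ism:
  assumes q: "q \<in> H" "mid_affine q" shows "mid_affine (k \<cdot> q)"
  unfolding mid_affine_def
proof
  fix x assume x: "x \<in> H"
  let ?d = "h (x + q) - h x"
  have "[h (x + (2 * k) \<cdot> q) + h x = (h x + (2 * k) * ?d) + h x] (mod int p)"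
    using mid_affine_line[OF q x, of "2 * k"] by (intro cong_add cong_refl)
  moreover have "[2 * h (x + k \<cdot> q) = 2 * (h x + k * ?d)] (mod int p)"
    using mid_affine_line[OF q x, of k] by (intro cong_mult cong_refl)
  moreover have "(2 * k) \<cdot> q = k \<cdot> q + k \<cdot> q" using ism_add_left[of k k q] by simp
  ultimately show "[h (x + k \<cdot> q + k \<cdot> q) + h x = 2 * h (x + k \<cdot> q)] (mod int p)"
    by (simp add: add.assoc cong_def algebra_simps)
qed

text \<open>The midpoint relations at \<open>u\<close> along \<open>v\<close> and at
  \<open>v\<close> along \<open>u\<close> read h(u+v) + h(u-v) = 2 h(u) and h(u+v) + h(v-u) = 2
  h(v). As \<open>h\<close> is odd, their sum leaves 2 h(u+v), and the factor 2 cancels because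
  \<open>p\<close> is odd.\<close>

lemma mid_affine_add:
  assumes u: "u \<in> H" "mid_affine u" and v: "v \<in> H" "mid_affine v"
  shows "[h (u + v) = h u + h v] (mod int p)"
proof -
  have 1: "[h (u + v) + h (u - v) = 2 * h u] (mod int p)"
    using v u unfolding mid_affine_def by (metis H_diff diff_add_cancel)
  have "v - u + u + u = u + v" "v - u + u = v" by (simp_all add: algebra_simps)
  then have 2: "[h (u + v) + h (v - u) = 2 * h v] (mod int p)"
    using u v unfolding mid_affine_def by (metis H_diff)
  have "(- 1) \<cdot> (u - v) = v - u" by simp
  then have 3: "[h (v - u) = - h (u - v)] (mod int p)"
    using h_\<phi>_ism(1)[of "u - v" "- 1"] u v by simp
  have "[(h (u + v) + h (u - v)) + (h (u + v) + h (v - u)) = 2 * h u + 2 * h v] (mod int p)"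
    using 1 2 by (rule cong_add)
  moreover have "[(h (u + v) + h (u - v)) + (h (u + v) + h (v - u)) =
      (h (u + v) + h (u - v)) + (h (u + v) + - h (u - v))] (mod int p)"
    using 3 by (intro cong_add cong_refl)
  ultimately have "[2 * h (u + v) = 2 * (h u + h v)] (mod int p)"
    by (simp add: cong_def algebra_simps)
  moreover have "coprime 2 (int p)" using odd_p by simp
  ultimately show ?thesis using cong_mult_lcancel by blast
qed

lemma span3:
  assumes q: "q \<in> H" "q \<notin> N" and r: "r \<in> H" "r \<notin> adj N q" and x: "x \<in> H"
  obtains n a b where "n \<in> N" "x = n + a \<cdot> q + b \<cdot> r"
proof -
  have s: "asub (adj N q)" "adj N q \<subseteq> H" "card (adj N q) = p ^ 4"
    using asub_adj[OF N(1)] adj_in_H[OF N(2) q(1)] card_adj[OF N(1,2) q] N(3) by (simp_all add: power_numeral_reduce)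
  have "adj (adj N q) r = H" using adj_eq_H[OF s _ r] card_H by simp
  then show ?thesis using x that by (metis adjE)
qed

text \<open>The two directions and \<open>N\<close> span \<open>H\<close>, and \<open>h\<close> is
  then a linear form in the coefficients of \<open>q\<close> and \<open>r\<close>. So a nonlinear
  \<open>h\<close> has at most one such direction modulo \<open>N\<close>.\<close>

lemma h_additive_if_two_mid_affine:
  assumes q: "q \<in> H" "q \<notin> N" "mid_affine q" and r: "r \<in> H" "r \<notin> adj N q" "mid_affine r"
    and x: "x \<in> H" and y: "y \<in> H"
  shows "[h (x + y) = h x + h y] (mod int p)"
proof -
  have val: "[h (n + a \<cdot> q + b \<cdot> r) = a * h q + b * h r] (mod int p)" if n: "n \<in> N" for n a b
  proof -
    have "[h (n + a \<cdot> q + b \<cdot> r) = h (a \<cdot> q + b \<cdot> r)] (mod int p)"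
      using h_add_N[OF _ n, of "a \<cdot> q + b \<cdot> r"] q r by (simp add: algebra_simps)
    also have "[h (a \<cdot> q + b \<cdot> r) = h (a \<cdot> q) + h (b \<cdot> r)] (mod int p)"
      using mid_affine_add mid_affine_ism q r by simp
    also have "[h (a \<cdot> q) + h (b \<cdot> r) = a * h q + b * h r] (mod int p)"
      using h_\<phi>_ism(1) q r by (intro cong_add)
    finally show ?thesis .
  qed
  obtain n a b where n: "n \<in> N" "x = n + a \<cdot> q + b \<cdot> r" using span3 q(1,2) r(1,2) x .
  obtain m c d where m: "m \<in> N" "y = m + c \<cdot> q + d \<cdot> r" using span3 q(1,2) r(1,2) y .
  have "x + y = (n + m) + (a + c) \<cdot> q + (b + d) \<cdot> r" using n m by (simp add: ism_add_left algebra_simps)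
  then have "[h (x + y) = (a + c) * h q + (b + d) * h r] (mod int p)"
    using val[OF asub_add[OF N(1) n(1) m(1)], of "a + c" "b + d"] by simp
  moreover have "[h x + h y = (a * h q + b * h r) + (c * h q + d * h r)] (mod int p)"
    using val[OF n(1)] val[OF m(1)] n(2) m(2) by (intro cong_add) simp_all
  ultimately show ?thesis by (simp add: cong_def algebra_simps)
qed

end

section \<open>Orbits outside \<open>N\<close> as parabolas\<close>

locale nonlinear_iso = normal_iso +
  assumes nonlinear: "\<exists>x\<in>H. \<exists>y\<in>H. \<not> [h (x + y) = h x + h y] (mod int p)"
begin

text \<open>If \<open>h\<close> were additive along \<open>q\<close>, it would be so along the
  subgroup of index \<open>p\<close> generated by \<open>N\<close> and \<open>q\<close>, hence
  everywhere. So some defect \<open>d\<close> is a unit modulo \<open>p\<close>; \<open>step\<close>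
  moves \<open>q\<close> by \<open>d \<cdot> e\<close> up to \<open>W\<close>, and repeating the
  move as often as the inverse of \<open>d\<close> says gives a move by \<open>e\<close>.\<close>

lemma moves_by_e:
  assumes q: "q \<in> H" "q \<notin> N"
  obtains a w where "a \<in> A" "w \<in> W" "a q = q + e + w"
proof -
  \<comment> \<open>\<open>adds\<close> expects values in a group, so \<open>h\<close> is carried by
    the line of \<open>e\<close>.\<close>
  let ?\<eta> = "\<lambda>x. h x \<cdot> e"
  have s0: "asub {0::'a}" by (simp add: asub_def)
  have hom: "?\<eta> (k \<cdot> x) - k \<cdot> ?\<eta> x \<in> {0}" if "x \<in> H" for x k
    using h_\<phi>_ism(1)[OF that, of k] e_cong_iff[of "h (k \<cdot> x)" "k * h x"] by (simp add: ism_mult)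
  have \<eta>: "n \<in> adds ?\<eta> {0} \<longleftrightarrow> (\<forall>x\<in>H. [h (x + n) = h x + h n] (mod int p))" if "n \<in> H" for n
    using that by (simp add: adds_def e_cong_iff[symmetric] ism_add_left diff_diff_eq)
  have NY: "N \<subseteq> adds ?\<eta> {0}"
  proof
    fix n assume n: "n \<in> N"
    have "[h (x + n) = h x + h n] (mod int p)" if "x \<in> H" for x
    proof -
      have "[h x + h n = h x + 0] (mod int p)" using h_\<phi>_N(1)[OF n] by (intro cong_add cong_refl)
      then show ?thesis using h_add_N[OF that n] by (simp add: cong_def)
    qed
    then show "n \<in> adds ?\<eta> {0}" using \<eta> N_H n by blast
  qed
  have "q \<notin> adds ?\<eta> {0}"
  proof
    assume "q \<in> adds ?\<eta> {0}"
    then have "adj N q \<subseteq> adds ?\<eta> {0}" using adj_subset[OF asub_adds[OF s0 hom] NY] by blast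
    moreover have "card (adj N q) = p ^ 4"
      using card_adj[OF N(1,2) q] N(3) by (simp add: power_numeral_reduce)
    ultimately have "adds ?\<eta> {0} = H"
      using adds_eq_H[OF s0 hom asub_adj[OF N(1)], of q 4] card_H by simp
    then show False using nonlinear \<eta> by blast
  qed
  then obtain x where x: "x \<in> H" "\<not> [h (x + q) = h x + h q] (mod int p)" using \<eta> q by blast
  obtain b where b: "b \<in> A" "b q = q + (h (x + q) - h x - h q) \<cdot> e + (\<phi> (x + q) - \<phi> x - \<phi> (b q))"
    using step[OF x(1) q(1)] .
  define d where "d = h (x + q) - h x - h q"
  define w where "w = \<phi> (x + q) - \<phi> x - \<phi> (b q)"
  have w: "w \<in> W" using \<phi>_W x q b by (auto simp: w_def intro!: asub_diff[OF W(1)])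
  have "\<not> int p dvd d" using x(2) by (simp add: d_def cong_iff_dvd_diff algebra_simps)
  then obtain l where l: "[l * d = 1] (mod int p)" using inverse_mod_p by blast
  define j where "j = nat (l mod int p)"
  have "\<exists>a\<in>A. \<exists>u\<in>W. a q = q + (int j * d) \<cdot> e + u" for j
  proof (induction j)
    case 0
    have "id \<in> A" using perm_A unfolding perm_group_def by blast
    then show ?case using asub_0[OF W(1)] by (intro bexI[of _ id] bexI[of _ 0]) simp_all
  next
    case (Suc j)
    then obtain a u where a: "a \<in> A" "u \<in> W" "a q = q + (int j * d) \<cdot> e + u" by blast
    have "a (b q) = a q + d \<cdot> a e + w"
      using b(2) a(1) q w unfolding d_def[symmetric] w_def[symmetric] by (simp add: A_add A_ism A_W)
    also have "\<dots> = q + (int (Suc j) * d) \<cdot> e + (u + d \<cdot> (a e - e) + w)"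
      using a by (simp add: ism_diff_right ism_add_left algebra_simps)
    finally have "(a \<circ> b) q = q + (int (Suc j) * d) \<cdot> e + (u + d \<cdot> (a e - e) + w)" by simp
    moreover have "u + d \<cdot> (a e - e) + w \<in> W"
      using asub_add[OF W(1) asub_add[OF W(1) a(2) asub_ism[OF W(1) fix_e[OF a(1)]]] w] .
    ultimately show ?case using A_comp[OF a(1) b(1)] by blast
  qed
  then obtain a u where a: "a \<in> A" "u \<in> W" "a q = q + (int j * d) \<cdot> e + u" by blast
  have "[int j = l] (mod int p)" using p_pos by (simp add: j_def cong_def)
  then have "[int j * d = 1] (mod int p)" using l by (meson cong_scalar_right cong_trans)
  then have "(int j * d) \<cdot> e = e" using e_cong_iff[of _ 1] by simp
  then show ?thesis using that a by metis
qed

text \<open>With \<open>a q = q + e + w\<close> and \<open>a e = e + 2 \<cdot> m\<close>, the powers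
  of \<open>a\<close> shift \<open>q + z \<cdot> e\<close> along \<open>e\<close> while the
  \<open>W\<close>-part grows quadratically. Its increments sum the odd numbers 2z+1, 2z+3 and so on
  to (z+d)^2 - z^2, which is why \<open>a e - e\<close> is halved and \<open>s\<close> is
  \<open>w - m\<close>.\<close>

lemma curve:
  assumes q: "q \<in> H" "q \<notin> N"
  obtains s m where "s \<in> W" "m \<in> W"
    "\<And>d. \<exists>c\<in>A. \<forall>z. c (q + z \<cdot> e) = q + (z + d) \<cdot> e + (d \<cdot> s + ((z + d)\<^sup>2 - z\<^sup>2) \<cdot> m)"
proof -
  obtain a w where a: "a \<in> A" "w \<in> W" "a q = q + e + w" using moves_by_e[OF q] .
  \<comment> \<open>The coefficient is the inverse of 2 modulo the odd prime
    \<open>p\<close>.\<close>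
  define m where "m = ((int p + 1) div 2) \<cdot> (a e - e)"
  define s where "s = w - m"
  have ae: "a e - e \<in> W" using fix_e[OF a(1)] .
  have m: "m \<in> W" unfolding m_def using asub_ism[OF W(1) ae] .
  have s: "s \<in> W" unfolding s_def using asub_diff[OF W(1) a(2) m] .
  have "2 * ((int p + 1) div 2) = int p + 1" using odd_p by (intro even_two_times_div_two) simp
  then have "2 \<cdot> m = (int p + 1) \<cdot> (a e - e)" by (simp add: m_def ism_mult[symmetric])
  then have m2: "a e = e + 2 \<cdot> m" using p_H[OF W_H[OF ae]] by (simp add: ism_add_left)
  have nat: "\<exists>c\<in>A. \<forall>z. c (q + z \<cdot> e) = q + (z + int n) \<cdot> e + (int n \<cdot> s + ((z + int n)\<^sup>2 - z\<^sup>2) \<cdot> m)" for n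
  proof (induction n)
    case 0
    have "id \<in> A" using perm_A unfolding perm_group_def by blast
    then show ?case by (intro bexI[of _ id]) simp_all
  next
    case (Suc n)
    then obtain c where c: "c \<in> A"
      "\<And>z. c (q + z \<cdot> e) = q + (z + int n) \<cdot> e + (int n \<cdot> s + ((z + int n)\<^sup>2 - z\<^sup>2) \<cdot> m)" by blast
    have "(a \<circ> c) (q + z \<cdot> e) = q + (z + int (Suc n)) \<cdot> e + (int (Suc n) \<cdot> s + ((z + int (Suc n))\<^sup>2 - z\<^sup>2) \<cdot> m)" for z
    proof -
      have u: "int n \<cdot> s + ((z + int n)\<^sup>2 - z\<^sup>2) \<cdot> m \<in> W"
        using asub_add[OF W(1) asub_ism[OF W(1) s] asub_ism[OF W(1) m]] .
      have "(a \<circ> c) (q + z \<cdot> e) = a q + (z + int n) \<cdot> a e + (int n \<cdot> s + ((z + int n)\<^sup>2 - z\<^sup>2) \<cdot> m)"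
        using A_W[OF a(1) u, of "q + (z + int n) \<cdot> e"] a(1) q c(2) by (simp add: A_add A_ism)
      also have "\<dots> = q + (z + int (Suc n)) \<cdot> e + (int (Suc n) \<cdot> s +
          (1 + (z + int n) * 2 + ((z + int n)\<^sup>2 - z\<^sup>2)) \<cdot> m)"
        unfolding a(3) m2 by (simp add: s_def ism_distribs ism_mult algebra_simps)
      also have "1 + (z + int n) * 2 + ((z + int n)\<^sup>2 - z\<^sup>2) = (z + int (Suc n))\<^sup>2 - z\<^sup>2"
        by (simp add: power2_eq_square algebra_simps)
      finally show ?thesis .
    qed
    then show ?case using A_comp[OF a(1) c(1)] by blast
  qed
  have "\<exists>c\<in>A. \<forall>z. c (q + z \<cdot> e) = q + (z + d) \<cdot> e + (d \<cdot> s + ((z + d)\<^sup>2 - z\<^sup>2) \<cdot> m)" for d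
  proof -
    define n where "n = nat (d mod int p)"
    have n: "[int n = d] (mod int p)" using p_pos by (simp add: n_def cong_def)
    obtain c where c: "c \<in> A"
      "\<And>z. c (q + z \<cdot> e) = q + (z + int n) \<cdot> e + (int n \<cdot> s + ((z + int n)\<^sup>2 - z\<^sup>2) \<cdot> m)" using nat by blast
    have "(z + int n) \<cdot> e = (z + d) \<cdot> e" "int n \<cdot> s = d \<cdot> s"
      "((z + int n)\<^sup>2 - z\<^sup>2) \<cdot> m = ((z + d)\<^sup>2 - z\<^sup>2) \<cdot> m" for z
      using n s m W_H by (auto intro!: ism_cong cong_diff cong_add cong_pow)
    then show ?thesis using c by auto
  qed
  then show ?thesis using that[OF s m] by blast
qed

end

section \<open>Defects of \<phi> along parabolic orbits\<close>

context nonlinear_iso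
begin

text \<open>\<open>s\<close> is the slope and \<open>m\<close> the curvature of the orbit above the
  line through \<open>q\<close> in direction \<open>e\<close>; one group element \<open>c\<close>
  serves all points of that line.\<close>

definition is_curve where
  "is_curve q s m \<longleftrightarrow> s \<in> W \<and> m \<in> W \<and>
     (\<forall>d. \<exists>c\<in>A. \<forall>z. c (q + z \<cdot> e) = q + (z + d) \<cdot> e + (d \<cdot> s + ((z + d)\<^sup>2 - z\<^sup>2) \<cdot> m))"

text \<open>Some element of \<open>A\<close> moves \<open>q\<close> to
  \<open>q + z \<cdot> e\<close> up to \<open>W\<close>. Conjugation by it carries the translations
  preserving one orbit to those preserving the other.\<close>

lemma st_line:
  assumes q: "q \<in> H" and c: "is_curve q s m" and w: "w \<in> st W (q + z \<cdot> e)"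
  shows "w \<in> st W q"
proof -
  obtain c where c: "c \<in> A" "\<forall>y. c (q + y \<cdot> e) = q + (y + z) \<cdot> e + (z \<cdot> s + ((y + z)\<^sup>2 - y\<^sup>2) \<cdot> m)"
    using c unfolding is_curve_def by blast
  define u where "u = z \<cdot> s + ((0 + z)\<^sup>2 - 0\<^sup>2) \<cdot> m"
  have u: "u \<in> W" using assms(2) unfolding u_def is_curve_def
    by (intro asub_add[OF W(1)] asub_ism[OF W(1)]) auto
  have cq: "c q = q + z \<cdot> e + u" using spec[OF c(2), of 0] by (simp add: u_def)
  obtain g where g: "w \<in> W" "g \<in> A" "g (q + z \<cdot> e) = q + z \<cdot> e + w" using w by (metis stE)
  obtain c' where c': "c' \<in> A" "c' (c q) = q" using A_inverse[OF c(1)] by metis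
  have "g (c q) = c q + w" unfolding cq using A_W[OF g(2) u, of "q + z \<cdot> e"] g(3) q by (simp add: algebra_simps)
  then have "(c' \<circ> (g \<circ> c)) q = q + w" using A_W[OF c'(1) g(1), of "c q"] c(1) c'(2) q by simp
  then show ?thesis using stI[OF g(1)] A_comp c(1) c'(1) g(2) by blast
qed

text \<open>\<open>step\<close> and the parabola both move \<open>q + z \<cdot> e\<close> by
  \<open>d \<cdot> e\<close> inside its orbit, so their \<open>W\<close>-parts agree modulo the
  stabiliser.\<close>

lemma defect:
  assumes q: "q \<in> H" and c: "is_curve q s m" and x: "x \<in> H"
    and d: "[d = h (x + q) - h x - h q] (mod int p)"
  shows "\<phi> (x + q + z \<cdot> e) - \<phi> x - \<phi> (q + (z + d) \<cdot> e) - (d \<cdot> s + ((z + d)\<^sup>2 - z\<^sup>2) \<cdot> m) \<in> st W q"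
proof -
  define v where "v = q + z \<cdot> e"
  have v: "v \<in> H" using q by (simp add: v_def)
  have zN: "z \<cdot> e \<in> N" using asub_ism[OF N(1) N(5)] .
  obtain b where b: "b \<in> A" "b v = v + (h (x + v) - h x - h v) \<cdot> e + (\<phi> (x + v) - \<phi> x - \<phi> (b v))"
    using step[OF x v] .
  define w where "w = \<phi> (x + v) - \<phi> x - \<phi> (b v)"
  have w: "w \<in> W" using \<phi>_W x v b by (auto simp: w_def intro!: asub_diff[OF W(1)])
  have "[h (x + v) - h x - h v = h (x + q) - h x - h q] (mod int p)"
    using h_add_N[OF _ zN, of "x + q"] h_add_N[OF q zN] x q
    by (intro cong_diff cong_refl) (simp_all add: v_def add.assoc)
  then have "(h (x + v) - h x - h v) \<cdot> e = d \<cdot> e" using d e_cong_iff cong_trans cong_sym by blast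
  then have bv: "b v = v + d \<cdot> e + w" using b(2) by (simp add: w_def)
  obtain g where g: "g \<in> A" "\<forall>z. g (q + z \<cdot> e) = q + (z + d) \<cdot> e + (d \<cdot> s + ((z + d)\<^sup>2 - z\<^sup>2) \<cdot> m)"
    using c unfolding is_curve_def by blast
  define u where "u = d \<cdot> s + ((z + d)\<^sup>2 - z\<^sup>2) \<cdot> m"
  have u: "u \<in> W" using c unfolding u_def is_curve_def
    by (intro asub_add[OF W(1)] asub_ism[OF W(1)]) auto
  have gv: "g v = v + d \<cdot> e + u" using g(2) by (simp add: v_def u_def ism_add_left add.assoc)
  obtain g' where g': "g' \<in> A" "g' (g v) = v" using A_inverse[OF g(1)] by metis
  have wu: "w - u \<in> W" using asub_diff[OF W(1) w u] .
  have "b v = g v + (w - u)" using bv gv by simp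
  then have "(g' \<circ> b) v = v + (w - u)" using A_W[OF g'(1) wu, of "g v"] g'(2) g(1) v by simp
  then have "w - u \<in> st W v" using stI[OF wu] A_comp[OF g'(1) b(1)] by blast
  then have "w - u \<in> st W q" using st_line[OF q c] unfolding v_def by blast
  moreover have "\<phi> (b v) = \<phi> (q + (z + d) \<cdot> e)"
    unfolding bv \<phi>_add_W[OF H_add[OF v H_ism[OF e_H]] w] by (simp add: v_def ism_add_left add.assoc)
  ultimately show ?thesis by (simp add: w_def u_def v_def add.assoc)
qed

text \<open>The base point \<open>k \<cdot> e\<close> has defect \<open>d = 0\<close>, and there
  \<open>defect\<close> compares \<phi> at two points of one line.\<close>

lemma \<phi>_line:
  assumes q: "q \<in> H" and c: "is_curve q s m"
  shows "\<phi> (q + k \<cdot> e) - \<phi> q \<in> st W q"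
proof -
  have kN: "k \<cdot> e \<in> N" using asub_ism[OF N(1) N(5)] .
  have "[h (k \<cdot> e + q) - h (k \<cdot> e) - h q = h q - 0 - h q] (mod int p)"
    using h_add_N[OF q kN] h_\<phi>_N(1)[OF kN] by (intro cong_diff cong_refl) (simp_all add: add.commute)
  then have "[0 = h (k \<cdot> e + q) - h (k \<cdot> e) - h q] (mod int p)" by (simp add: cong_sym)
  then show ?thesis using defect[OF q c, of "k \<cdot> e" 0 0] h_\<phi>_N(2)[OF kN] by (simp add: add.commute)
qed

lemma defect0:
  assumes q: "q \<in> H" and c: "is_curve q s m" and x: "x \<in> H"
    and d: "[d = h (x + q) - h x - h q] (mod int p)"
  shows "\<phi> (x + q) - \<phi> x - \<phi> q - d \<cdot> s - d\<^sup>2 \<cdot> m \<in> st W q"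
  using asub_add[OF asub_stW[OF q] defect[OF q c x d, of 0] \<phi>_line[OF q c, of d]]
  by (simp add: algebra_simps)

text \<open>\<open>x + q + z \<cdot> e\<close> is reached from \<open>x\<close> by the step
  \<open>q + z \<cdot> e\<close>, and from \<open>x + z \<cdot> e\<close> by the step
  \<open>q\<close>. The quadratic terms of the two readings differ by (z+d)^2 - z^2 - d^2 =
  2zd.\<close>

lemma defect_line:
  assumes q: "q \<in> H" and c: "is_curve q s m" and x: "x \<in> H"
    and d: "[d = h (x + q) - h x - h q] (mod int p)"
  shows "\<phi> (x + z \<cdot> e) - \<phi> x - (2 * z * d) \<cdot> m \<in> st W q"
proof -
  have zN: "z \<cdot> e \<in> N" using asub_ism[OF N(1) N(5)] .
  have "[h (x + q) - h x - h q = h (x + z \<cdot> e + q) - h (x + z \<cdot> e) - h q] (mod int p)"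
    using h_add_N[OF _ zN, of "x + q"] h_add_N[OF x zN] x q
    by (intro cong_diff cong_refl) (simp_all add: cong_sym algebra_simps)
  then have d': "[d = h (x + z \<cdot> e + q) - h (x + z \<cdot> e) - h q] (mod int p)" using d cong_trans by blast
  let ?a = "\<phi> (x + q + z \<cdot> e) - \<phi> x - \<phi> (q + (z + d) \<cdot> e) - (d \<cdot> s + ((z + d)\<^sup>2 - z\<^sup>2) \<cdot> m)"
  let ?b = "\<phi> (x + z \<cdot> e + q) - \<phi> (x + z \<cdot> e) - \<phi> q - d \<cdot> s - d\<^sup>2 \<cdot> m"
  have mem: "?a + (\<phi> (q + (z + d) \<cdot> e) - \<phi> q) - ?b \<in> st W q"
    using asub_diff[OF asub_stW[OF q] asub_add[OF asub_stW[OF q] defect[OF q c x d] \<phi>_line[OF q c]]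
        defect0[OF q c H_add[OF x H_ism[OF e_H]] d']] .
  have eq: "?a + (\<phi> (q + (z + d) \<cdot> e) - \<phi> q) - ?b
      = \<phi> (x + z \<cdot> e) - \<phi> x - ((z + d)\<^sup>2 - z\<^sup>2 - d\<^sup>2) \<cdot> m"
    by (simp add: ism_distribs algebra_simps)
  have sq: "(z + d)\<^sup>2 - z\<^sup>2 - d\<^sup>2 = 2 * z * d" by (simp add: power2_eq_square algebra_simps)
  show ?thesis using mem unfolding eq sq .
qed

text \<open>Modulo the stabiliser, \<phi> changes along \<open>e\<close> by 2dm at \<open>x\<close>
  and by 2d'm at \<open>x + q\<close>, where d and d' are the successive defects of
  \<open>h\<close>. By \<open>defect0\<close> the step \<open>q\<close> has the same effect on
  \<phi> at \<open>x\<close> and at \<open>x + e\<close>. So 2(d' - d)m lies in the stabiliser; as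
  \<open>m\<close> does not, d' and d agree modulo \<open>p\<close>.\<close>

lemma mid_affine_if_curved:
  assumes q: "q \<in> H" and c: "is_curve q s m" and m: "m \<notin> st W q"
  shows "mid_affine q"
  unfolding mid_affine_def
proof
  fix x assume x: "x \<in> H"
  define d where "d = h (x + q) - h x - h q"
  define d' where "d' = h (x + q + q) - h (x + q) - h q"
  have d: "[d = h (x + q) - h x - h q] (mod int p)" "[d' = h (x + q + q) - h (x + q) - h q] (mod int p)"
    by (simp_all add: d_def d'_def)
  have eN: "1 \<cdot> e \<in> N" using N(5) by simp
  have "[h (x + q) - h x - h q = h (x + e + q) - h (x + e) - h q] (mod int p)"
    using h_add_N[OF _ eN, of "x + q"] h_add_N[OF x eN] x q
    by (intro cong_diff cong_refl) (simp_all add: cong_sym algebra_simps)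
  then have d1: "[d = h (x + e + q) - h (x + e) - h q] (mod int p)" by (simp add: d_def)
  have S: "asub (st W q)" using asub_stW[OF q] .
  let ?s = "d \<cdot> s" and ?m = "d\<^sup>2 \<cdot> m"
  have 1: "\<phi> (x + e) - \<phi> x - (2 * d) \<cdot> m \<in> st W q" using defect_line[OF q c x d(1), of 1] by simp
  have 2: "\<phi> (x + q + e) - \<phi> (x + q) - (2 * d') \<cdot> m \<in> st W q"
    using defect_line[OF q c _ d(2), of 1] x q by simp
  have 3: "\<phi> (x + q) - \<phi> x - \<phi> q - ?s - ?m \<in> st W q" using defect0[OF q c x d(1)] .
  have 4: "\<phi> (x + e + q) - \<phi> (x + e) - \<phi> q - ?s - ?m \<in> st W q" using defect0[OF q c _ d1] x by simp
  have "(\<phi> (x + e + q) - \<phi> (x + e) - \<phi> q - ?s - ?m) - (\<phi> (x + q) - \<phi> x - \<phi> q - ?s - ?m)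
      - (\<phi> (x + q + e) - \<phi> (x + q) - (2 * d') \<cdot> m) + (\<phi> (x + e) - \<phi> x - (2 * d) \<cdot> m) \<in> st W q"
    using asub_add[OF S asub_diff[OF S asub_diff[OF S 4 3] 2] 1] .
  moreover have "(\<phi> (x + e + q) - \<phi> (x + e) - \<phi> q - ?s - ?m) - (\<phi> (x + q) - \<phi> x - \<phi> q - ?s - ?m)
      - (\<phi> (x + q + e) - \<phi> (x + q) - (2 * d') \<cdot> m) + (\<phi> (x + e) - \<phi> x - (2 * d) \<cdot> m) = (2 * d' - 2 * d) \<cdot> m"
    by (simp add: ism_diff_left algebra_simps)
  ultimately have "(2 * d' - 2 * d) \<cdot> m \<in> st W q" by simp
  moreover have "m \<in> H" using c W_H by (simp add: is_curve_def)
  ultimately have "int p dvd 2 * d' - 2 * d" using ism_mem_cancel[OF S] m by blast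
  then have "[2 * d' = 2 * d] (mod int p)" by (simp add: cong_iff_dvd_diff)
  moreover have "coprime 2 (int p)" using odd_p by simp
  ultimately have "[d' = d] (mod int p)" using cong_mult_lcancel by blast
  then have "int p dvd d' - d" by (simp add: cong_iff_dvd_diff)
  moreover have "d' - d = h (x + q + q) + h x - 2 * h (x + q)" by (simp add: d_def d'_def)
  ultimately show "[h (x + q + q) + h x = 2 * h (x + q)] (mod int p)" by (simp add: cong_iff_dvd_diff)
qed

text \<open>With \<open>m\<close> in the stabiliser the quadratic terms vanish there, and what is
  left is additive along \<open>N\<close> and along \<open>q\<close>, hence along a subgroup of
  index \<open>p\<close>.\<close>

lemma additive_if_flat:
  assumes q: "q \<in> H" "q \<notin> N" and c: "is_curve q s m" and m: "m \<in> st W q"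
    and x: "x \<in> H" and y: "y \<in> H"
  shows "(\<phi> (x + y) - h (x + y) \<cdot> s) - (\<phi> x - h x \<cdot> s) - (\<phi> y - h y \<cdot> s) \<in> st W q"
proof -
  define G where "G x = \<phi> x - h x \<cdot> s" for x
  have S: "asub (st W q)" using asub_stW[OF q(1)] .
  have sH: "s \<in> H" using c W_H by (simp add: is_curve_def)
  have hom: "G (k \<cdot> x) - k \<cdot> G x \<in> st W q" if "x \<in> H" for x k
  proof -
    have "h (k \<cdot> x) \<cdot> s = k \<cdot> h x \<cdot> s" using ism_cong[OF sH h_\<phi>_ism(1)[OF that]] by (simp add: ism_mult)
    then show ?thesis using h_\<phi>_ism(2)[OF that] asub_0[OF S] by (simp add: G_def ism_diff_right)
  qed
  have "N \<subseteq> adds G (st W q)"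
  proof
    fix n assume n: "n \<in> N"
    then obtain w k where w: "w \<in> W" "n = w + k \<cdot> e" by (metis adjE)
    have "G (x + n) - G x - G n \<in> st W q" if x: "x \<in> H" for x
    proof -
      let ?d = "h (x + q) - h x - h q"
      have "h (x + n) \<cdot> s = h x \<cdot> s" "h n \<cdot> s = 0 \<cdot> s" "\<phi> n = 0"
        using ism_cong[OF sH] h_add_N[OF x n] h_\<phi>_N[OF n] by blast+
      then have G: "G (x + n) - G x - G n = \<phi> (x + n) - \<phi> x" by (simp add: G_def)
      have "\<phi> (x + n) = \<phi> (x + k \<cdot> e)" using \<phi>_add_W[of "x + k \<cdot> e" w] w x by (simp add: algebra_simps)
      moreover have "(\<phi> (x + k \<cdot> e) - \<phi> x - (2 * k * ?d) \<cdot> m) + (2 * k * ?d) \<cdot> m \<in> st W q"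
        using asub_add[OF S defect_line[OF q(1) c x cong_refl] asub_ism[OF S m]] .
      ultimately show ?thesis using G by simp
    qed
    then show "n \<in> adds G (st W q)" using n N_H by (simp add: adds_def)
  qed
  moreover have "q \<in> adds G (st W q)"
  proof -
    have "G (x + q) - G x - G q \<in> st W q" if x: "x \<in> H" for x
    proof -
      let ?d = "h (x + q) - h x - h q"
      have "(\<phi> (x + q) - \<phi> x - \<phi> q - ?d \<cdot> s - ?d\<^sup>2 \<cdot> m) + ?d\<^sup>2 \<cdot> m \<in> st W q"
        using asub_add[OF S defect0[OF q(1) c x cong_refl] asub_ism[OF S m]] .
      then have "\<phi> (x + q) - \<phi> x - \<phi> q - ?d \<cdot> s \<in> st W q" by simp
      then show ?thesis unfolding ism_diff_left by (simp add: G_def algebra_simps)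
    qed
    then show ?thesis using q by (simp add: adds_def)
  qed
  ultimately have "adj N q \<subseteq> adds G (st W q)" using adj_subset[OF asub_adds[OF S hom]] by blast
  moreover have "card (adj N q) = p ^ 4"
    using card_adj[OF N(1,2) q] N(3) by (simp add: power_numeral_reduce)
  ultimately have "adds G (st W q) = H"
    using adds_eq_H[OF S hom asub_adj[OF N(1)], of q 4] card_H by simp
  then have "G (x + y) - G x - G y \<in> st W q" using addsD x y by blast
  then show ?thesis by (simp add: G_def)
qed

lemma linearizable_nonlinear: linearizable
proof -
  have "card N < card H" using N(3) card_H p_pos by (simp add: power_strict_increasing)
  then have "\<exists>q. q \<in> H \<and> q \<notin> N" using N(2) by (metis nat_less_le subset_antisym subsetI)
  \<comment> \<open>\<open>q\<close> is the exceptional direction if there is one; otherwise any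
    vector outside \<open>N\<close> serves.\<close>
  then obtain q where q: "q \<in> H" "q \<notin> N" and q_max: "(\<exists>q\<in>H. q \<notin> N \<and> mid_affine q) \<longrightarrow> mid_affine q"
    by blast
  have s1: "asub (adj N q)" "adj N q \<subseteq> H" "card (adj N q) = p ^ 4"
    using asub_adj[OF N(1)] adj_in_H[OF N(2) q(1)] card_adj[OF N(1,2) q] N(3) by (simp_all add: power_numeral_reduce)
  obtain r where r: "r \<in> H" "r \<notin> adj N q" using proper_extend[OF s1 card_H] by auto
  \<comment> \<open>A second independent direction of this kind would make \<open>h\<close>
    additive.\<close>
  have only: "v \<in> adj N q" if v: "v \<in> H" "v \<notin> N" "mid_affine v" for v
  proof (rule ccontr)
    assume "v \<notin> adj N q"
    moreover have "mid_affine q" using q_max v by blast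
    ultimately show False using h_additive_if_two_mid_affine[OF q _ v(1) _ v(3)] nonlinear by blast
  qed
  define \<psi> where "\<psi> x = f x - x" for x
  have \<psi>: "\<psi> x = h x \<cdot> e + \<phi> x" for x by (simp add: \<psi>_def f_eq)
  have \<psi>N: "\<psi> x \<in> N" if "x \<in> H" for x using f_mod_N[OF that] by (simp add: \<psi>_def)
  have \<psi>p: "int p \<cdot> \<psi> x = 0" if "x \<in> H" for x using p_H N_H \<psi>N that by blast
  have zero: "add_on N (\<lambda>_. 0 :: 'a)" by (simp add: add_on_def)
  \<comment> \<open>\<beta> will vanish on \<open>N\<close> and agree with \<open>f x - x\<close> at
    \<open>q\<close> and at \<open>r\<close>; the linear map sought is the identity plus
    \<beta>.\<close>
  obtain \<beta>1 where \<beta>1: "add_on (adj N q) \<beta>1" "\<And>n k. n \<in> N \<Longrightarrow> \<beta>1 (n + k \<cdot> q) = 0 + k \<cdot> \<psi> q"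
    using extend_adj[OF N(1,2) q zero \<psi>p[OF q(1)]] by blast
  obtain \<beta> where \<beta>: "add_on (adj (adj N q) r) \<beta>" "\<And>n k. n \<in> adj N q \<Longrightarrow> \<beta> (n + k \<cdot> r) = \<beta>1 n + k \<cdot> \<psi> r"
    using extend_adj[OF s1(1,2) r \<beta>1(1) \<psi>p[OF r(1)]] by blast
  have full: "adj (adj N q) r = H" using adj_eq_H[OF s1 _ r] card_H by simp
  have \<beta>H: "add_on H \<beta>" using \<beta>(1) full by simp
  have \<beta>val: "\<beta> (n + a \<cdot> q + b \<cdot> r) = a \<cdot> \<psi> q + b \<cdot> \<psi> r" if "n \<in> N" for n a b
    using \<beta>(2)[OF adjI[OF that, of a q], of b] \<beta>1(2)[OF that, of a] by simp
  have \<beta>N0: "\<beta> n = 0" if "n \<in> N" for n using \<beta>val[OF that, of 0 0] by simp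
  have \<beta>N: "\<beta> x \<in> N" if x: "x \<in> H" for x
  proof -
    obtain n a b where "n \<in> N" "x = n + a \<cdot> q + b \<cdot> r" using span3 q r x .
    then show ?thesis using \<beta>val \<psi>N[OF q(1)] \<psi>N[OF r(1)] by (simp add: asub_add[OF N(1)] asub_ism[OF N(1)])
  qed
  note L = unipotent_bij[OF \<beta>H \<beta>N0 \<beta>N]
  have "\<exists>a\<in>A. f v = a v + \<beta> (a v)" if v: "v \<in> H" for v
  proof (cases "v \<in> N")
    case True
    have "id \<in> A" using perm_A unfolding perm_group_def by blast
    then show ?thesis using f_N[OF True] \<beta>N0[OF True] by (intro bexI[of _ id]) simp_all
  next
    case False
    obtain s m where c: "is_curve v s m" using curve[OF v False] unfolding is_curve_def by metis
    have S: "asub (st W v)" using asub_stW[OF v] .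
    \<comment> \<open>\<beta> is unchanged by moves inside \<open>N\<close>, so \<open>v\<close> has
      to be moved within its orbit by \<open>(h v - k) \<cdot> e\<close> and an element of
      \<open>W\<close>. The parabola supplies the part along \<open>e\<close> together with slope
      and curvature terms; \<open>st\<close> says that the rest is a translation preserving the
      orbit.\<close>
    have key: "\<exists>a\<in>A. f v = a v + \<beta> (a v)"
      if \<beta>v: "\<beta> v = k \<cdot> e + u" "u \<in> W" and st: "\<phi> v - u - (h v - k) \<cdot> s - (h v - k)\<^sup>2 \<cdot> m \<in> st W v" for k u
    proof -
      let ?d = "h v - k" and ?w = "\<phi> v - u - (h v - k) \<cdot> s - (h v - k)\<^sup>2 \<cdot> m"
      obtain g where g: "?w \<in> W" "g \<in> A" "g v = v + ?w" using st by (metis stE)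
      obtain c' where c': "c' \<in> A" "\<forall>z. c' (v + z \<cdot> e) = v + (z + ?d) \<cdot> e + (?d \<cdot> s + ((z + ?d)\<^sup>2 - z\<^sup>2) \<cdot> m)"
        using c unfolding is_curve_def by blast
      have "c' v = v + ?d \<cdot> e + (?d \<cdot> s + ?d\<^sup>2 \<cdot> m)" using spec[OF c'(2), of 0] by simp
      moreover have "c' (g v) = c' v + ?w" using A_W[OF c'(1) g(1) v] g(3) by simp
      ultimately have cg: "(c' \<circ> g) v = v + (?d \<cdot> e + (\<phi> v - u))" by simp
      have n: "?d \<cdot> e + (\<phi> v - u) \<in> N"
        using asub_add[OF N(1) asub_ism[OF N(1) N(5)]] asub_diff[OF W(1) \<phi>_W[OF v] \<beta>v(2)] N(4) by blast
      have "\<beta> ((c' \<circ> g) v) = \<beta> v" unfolding cg using add_onD[OF \<beta>H v N_H[OF n]] \<beta>N0[OF n] by simp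
      then have "f v = (c' \<circ> g) v + \<beta> ((c' \<circ> g) v)"
        using cg \<beta>v(1) f_eq[of v] by (simp add: ism_diff_left)
      then show ?thesis using A_comp[OF c'(1) g(2)] by blast
    qed
    show ?thesis
    proof (cases "m \<in> st W v")
      case True
      \<comment> \<open>Flat case: modulo the stabiliser \<open>G\<close> is additive and vanishes
        on \<open>N\<close>, so its values at \<open>q\<close> and \<open>r\<close> determine it.
        This is the condition in \<open>key\<close>, as the curvature term lies in the
        stabiliser.\<close>
      define G where "G x = \<phi> x - h x \<cdot> s" for x
      have G: "G (x + y) - G x - G y \<in> st W v" if "x \<in> H" "y \<in> H" for x y
        using additive_if_flat[OF v False c True that] by (simp add: G_def)
      have sH: "s \<in> H" using c W_H by (simp add: is_curve_def)
      have Gk: "G (k \<cdot> x) = k \<cdot> G x" if "x \<in> H" for k x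
        using ism_cong[OF sH h_\<phi>_ism(1)[OF that]] h_\<phi>_ism(2)[OF that] by (simp add: G_def ism_diff_right ism_mult)
      obtain n a b where n: "n \<in> N" "v = n + a \<cdot> q + b \<cdot> r" using span3 q r v .
      have "h n \<cdot> s = 0 \<cdot> s" using ism_cong[OF sH h_\<phi>_N(1)[OF n(1)]] .
      then have Gn: "G n = 0" using h_\<phi>_N(2)[OF n(1)] by (simp add: G_def)
      have H: "n \<in> H" "a \<cdot> q \<in> H" "b \<cdot> r \<in> H" "n + a \<cdot> q \<in> H" using N_H n q r by auto
      have "(G (n + a \<cdot> q + b \<cdot> r) - G (n + a \<cdot> q) - G (b \<cdot> r)) + (G (n + a \<cdot> q) - G n - G (a \<cdot> q)) \<in> st W v"
        using asub_add[OF S G[OF H(4,3)] G[OF H(1,2)]] .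
      then have Gv: "G v - a \<cdot> G q - b \<cdot> G r \<in> st W v"
        unfolding n(2)[symmetric] using Gn Gk q r by (simp add: algebra_simps)
      let ?k = "a * h q + b * h r" and ?u = "a \<cdot> \<phi> q + b \<cdot> \<phi> r"
      have 1: "\<beta> v = ?k \<cdot> e + ?u"
        unfolding n(2) \<beta>val[OF n(1)] \<psi> by (simp add: ism_add_right ism_add_left ism_mult algebra_simps)
      have 2: "?u \<in> W" using asub_add[OF W(1)] asub_ism[OF W(1)] \<phi>_W q r by simp
      have "(G v - a \<cdot> G q - b \<cdot> G r) - (h v - ?k)\<^sup>2 \<cdot> m \<in> st W v"
        using asub_diff[OF S Gv asub_ism[OF S True]] .
      moreover have "(G v - a \<cdot> G q - b \<cdot> G r) = \<phi> v - ?u - (h v - ?k) \<cdot> s"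
        by (simp add: G_def ism_diff_right ism_diff_left ism_add_left ism_mult algebra_simps)
      ultimately show ?thesis using key[OF 1 2] by simp
    next
      case curved: False
      \<comment> \<open>Curved case: \<open>v\<close> lies over the exceptional direction, where
        \<beta> and \<open>f x - x\<close> have the same part along \<open>e\<close>. So no move
        along \<open>e\<close> is required, and \<open>\<phi>_line\<close> controls the part in
        \<open>W\<close>.\<close>
      have "v \<in> adj N q" using only[OF v False mid_affine_if_curved[OF v c curved]] .
      then obtain n b where n: "n \<in> N" "v = n + b \<cdot> q" by (metis adjE)
      then obtain w k where w: "w \<in> W" "n = w + k \<cdot> e" by (metis adjE)
      have "h v \<cdot> e = h (b \<cdot> q) \<cdot> e" using h_add_N[of "b \<cdot> q" n] n q e_cong_iff by (simp add: add.commute)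
      also have "\<dots> = (b * h q) \<cdot> e" using h_\<phi>_ism(1)[OF q(1)] e_cong_iff by blast
      finally have 1: "\<beta> v = h v \<cdot> e + b \<cdot> \<phi> q"
        using \<beta>val[OF n(1), of b 0] n(2) \<psi>[of q] by (simp add: ism_add_right ism_mult)
      have 2: "b \<cdot> \<phi> q \<in> W" using asub_ism[OF W(1) \<phi>_W[OF q(1)]] .
      have "b \<cdot> \<phi> q = \<phi> (b \<cdot> q + w)" using h_\<phi>_ism(2) \<phi>_add_W w q by simp
      also have "b \<cdot> q + w = v + (- k) \<cdot> e" using n w by (simp add: algebra_simps)
      finally have "\<phi> v - b \<cdot> \<phi> q \<in> st W v"
        using asub_minus[OF S \<phi>_line[OF v c, of "- k"]] by simp
      then show ?thesis using key[OF 1 2] by simp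
    qed
  qed
  then show ?thesis unfolding linearizable_def using L by blast
qed

end

lemma (in normal_iso) linearizable: linearizable
proof (cases "\<exists>x\<in>H. \<exists>y\<in>H. \<not> [h (x + y) = h x + h y] (mod int p)")
  case True
  then interpret nonlinear_iso p H A f W e by unfold_locales
  show ?thesis by (rule linearizable_nonlinear)
qed (use linearizable_if_h_additive in blast)

subsection \<open>Isomorphisms agree with linear maps on orbits\<close>

context lin_act
begin

lemma iso_linear_inverse:
  assumes F: "iso F" and L: "bij_betw L H H" "add_on H L"
  shows "iso (inv_into H L \<circ> F)"
proof (rule isoI)
  have inv: "bij_betw (inv_into H L) H H" using bij_betw_inv_into[OF L(1)] .
  have invH: "inv_into H L y \<in> H" "L (inv_into H L y) = y" if "y \<in> H" for y
    using inv that bij_betwE bij_betw_inv_into_right[OF L(1)] by blast+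
  show "bij_betw (inv_into H L \<circ> F) H H" using bij_betw_trans[OF iso_bij[OF F] inv] .
  have L0: "L 0 = 0" using add_on_0[OF asub_H L(2)] .
  then show "(inv_into H L \<circ> F) 0 = 0"
    using bij_betw_inv_into_left[OF L(1) asub_0[OF asub_H]] iso_0[OF F] by simp
  fix x v assume x: "x \<in> H" and v: "v \<in> H"
  obtain a where a: "a \<in> A" "F (x + v) = F x + F (a v)" using iso_step F x v .
  have H: "F x \<in> H" "F (a v) \<in> H" using iso_H[OF F] a x v by auto
  have "L (inv_into H L (F x) + inv_into H L (F (a v))) = F x + F (a v)"
    using add_onD[OF L(2) invH(1)[OF H(1)] invH(1)[OF H(2)]] invH(2) H by simp
  then have "inv_into H L (F x + F (a v)) = inv_into H L (F x) + inv_into H L (F (a v))"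
    using bij_betw_inv_into_left[OF L(1) asub_add[OF asub_H invH(1)[OF H(1)] invH(1)[OF H(2)]]] by simp
  then show "\<exists>a\<in>A. (inv_into H L \<circ> F) (x + v) = (inv_into H L \<circ> F) x + (inv_into H L \<circ> F) (a v)"
    using a by auto
qed

theorem iso_agrees_with_linear:
  assumes odd_p: "odd p" and card_H: "card H = p ^ 5" and card_A: "card A = p ^ r"
    and fixed: "card {x\<in>H. \<forall>a\<in>A. a x = x} \<ge> p ^ 2" and f: "iso f"
  shows "\<exists>L. bij_betw L H H \<and> add_on H L \<and> (\<forall>v\<in>H. \<exists>a\<in>A. f v = L (a v))"
proof -
  define Fx where "Fx = {x\<in>H. \<forall>a\<in>A. a x = x}"
  have "x - y \<in> Fx" if "x \<in> Fx" "y \<in> Fx" for x y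
  proof -
    have H: "x \<in> H" "y \<in> H" using that by (auto simp: Fx_def)
    have "a (x - y) = x - y" if a: "a \<in> A" for a
    proof -
      have "a x = x" "a y = y" using \<open>x \<in> Fx\<close> \<open>y \<in> Fx\<close> a unfolding Fx_def by blast+
      then show ?thesis using add_on_diff[OF asub_H add_A[OF a] H] by simp
    qed
    then show ?thesis using asub_diff[OF asub_H H] unfolding Fx_def by blast
  qed
  then have Fx: "asub Fx" "Fx \<subseteq> H" using asub_0[OF asub_H] by (auto simp: asub_def Fx_def)
  have s0: "asub {0::'v}" "{0} \<subseteq> H" using asub_H by (auto simp: asub_def)
  have "p < p ^ 2" using p_pos by (simp add: power2_eq_square)
  then have big: "card M < card Fx" if "card M \<le> p" for M :: "'v set" using fixed that by (simp add: Fx_def)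
  have "\<not> Fx \<subseteq> {0}" using big[of "{0}"] p_pos card_mono[of "{0}" Fx] by auto
  then obtain e1 where e1: "e1 \<in> Fx" "e1 \<notin> {0}" by blast
  then have e1H: "e1 \<in> H" using Fx by blast
  let ?E = "adj {0} e1"
  have E: "asub ?E" "?E \<subseteq> H" "card ?E = p" "?E \<subseteq> Fx"
    using asub_adj[OF s0(1)] adj_in_H[OF s0(2) e1H] card_adj[OF s0 e1H e1(2)]
      adj_subset[OF Fx(1), of "{0}"] e1(1) asub_0[OF Fx(1)]
    by auto
  have "\<not> Fx \<subseteq> ?E" using big[of ?E] E card_mono[of ?E Fx] finite_subset[OF E(2) fin_H] by auto
  then obtain e2 where e2: "e2 \<in> Fx" "e2 \<notin> ?E" by blast
  then have e2H: "e2 \<in> H" using Fx by blast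
  \<comment> \<open>Any two independent fixed vectors serve; they cut the fixed space down to order
    exactly \<open>p ^ 2\<close>.\<close>
  define W where "W = adj ?E e2"
  have W: "asub W" "W \<subseteq> H" "card W = p ^ 2" "W \<subseteq> Fx"
    using asub_adj[OF E(1)] adj_in_H[OF E(2) e2H] card_adj[OF E(1,2) e2H e2(2)]
      adj_subset[OF Fx(1) E(4) e2(1)] E(3)
    by (auto simp: W_def power2_eq_square)
  have fixW: "a w = w" if "a \<in> A" "w \<in> W" for a w using W(4) that by (auto simp: Fx_def)
  have "a w \<in> W" if "a \<in> A" "w \<in> W" for a w using fixW[OF that] that by simp
  then have iW: "invar W" using W by (simp add: invar_def)
  have fixW0: "a w - w \<in> {0}" if "a \<in> A" "w \<in> W" for a w using fixW[OF that] by simp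
  obtain e3 where e3: "e3 \<in> H" "e3 \<notin> W" "\<forall>a\<in>A. a e3 - e3 \<in> W"
    using fixed_mod[OF card_A iW W(3) card_H] by auto
  define N3 where "N3 = adj W e3"
  have N3: "invar N3" "\<And>a u. a \<in> A \<Longrightarrow> u \<in> N3 \<Longrightarrow> a u - u \<in> W" "card N3 = p ^ 3"
  proof -
    have "{0} \<subseteq> W" using asub_0[OF W(1)] by simp
    note * = adj_invar[OF iW e3(1,3) _ this]
    show "invar N3" "\<And>a u. a \<in> A \<Longrightarrow> u \<in> N3 \<Longrightarrow> a u - u \<in> W"
      unfolding N3_def using * fixW0 by blast+
    show "card N3 = p ^ 3"
      using card_adj[OF W(1,2) e3(1,2)] W(3) by (simp add: N3_def numeral_3_eq_3 power2_eq_square)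
  qed
  have N3': "asub N3" "N3 \<subseteq> H" "W \<subseteq> N3" using N3(1) adj_superset[of W e3] by (auto simp: invar_def N3_def)
  obtain e4 where e4: "e4 \<in> H" "e4 \<notin> N3" "\<forall>a\<in>A. a e4 - e4 \<in> N3"
    using fixed_mod[OF card_A N3(1,3) card_H] by auto
  define N4 where "N4 = adj N3 e4"
  have N4: "invar N4" "\<And>a u. a \<in> A \<Longrightarrow> u \<in> N4 \<Longrightarrow> a u - u \<in> N3" "card N4 = p ^ 4"
    using adj_invar[OF N3(1) e4(1,3) _ N3'(3)] N3(2) card_adj[OF N3'(1,2) e4(1,2)] N3(3)
    unfolding N4_def by (simp_all add: power_numeral_reduce)
  have N4': "asub N4" "N4 \<subseteq> H" "N3 \<subseteq> N4" using N4(1) adj_superset[of N3 e4] by (auto simp: invar_def N4_def)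
  obtain e5 where e5: "e5 \<in> H" "e5 \<notin> N4" "\<forall>a\<in>A. a e5 - e5 \<in> N4"
    using fixed_mod[OF card_A N4(1,3) card_H] by auto
  have N5: "adj N4 e5 = H" using adj_eq_H[OF N4'(1,2) N4(3) _ e5(1,2)] card_H by simp
  have comm5: "a u - u \<in> N4" if "a \<in> A" "u \<in> H" for a u
    using adj_invar(2)[OF N4(1) e5(1,3) _ N4'(3)] N4(2) that unfolding N5 by blast
  \<comment> \<open>\<open>A\<close> fixes \<open>W\<close> pointwise, so the flag can pass from 0
    to \<open>W\<close> in one step. From index 4 on it is constantly \<open>H\<close>.\<close>
  define fl where "fl i = (if i = 0 then {0} else if i = 1 then W else if i = 2 then N3 else if i = 3 then N4 else H)"
    for i :: nat
  obtain F where F: "same F f" "\<And>x k. x \<in> H \<Longrightarrow> F (k \<cdot> x) = k \<cdot> F x"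
  proof (rule homogenize[OF f, of fl 4])
    show "invar (fl i)" for i using iW N3(1) N4(1) invar_0 invar_H by (simp add: fl_def)
    show "fl i \<subseteq> fl (Suc i)" for i using asub_0[OF W(1)] N3' N4' by (auto simp: fl_def)
    show "fl 0 = {0}" "fl 4 = H" by (simp_all add: fl_def)
    show "a v - v \<in> fl i" if "a \<in> A" "v \<in> fl (Suc i)" for i a v
      using that fixW0[of a v] N3(2)[of a v] N4(2)[of a v] comm5[of a v] asub_diff[OF asub_H, of "a v" v]
      by (auto simp: fl_def split: if_splits)
  qed blast
  have iF: "iso F" using F(1) by (simp add: same_def)
  have F_W: "F (x + w) = F x + F w" if x: "x \<in> H" and w: "w \<in> W" for x w
  proof -
    have "w \<in> H" using w W by blast
    then obtain a where a: "a \<in> A" "F (x + w) = F x + F (a w)" using iso_step iF x by blast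
    then show ?thesis using fixW[OF a(1) w] by simp
  qed
  \<comment> \<open>Along \<open>W\<close> additivity is exact, because \<open>A\<close> leaves no
    choice there; homogeneity handles the direction \<open>e3\<close>.\<close>
  have F3: "add_on N3 F"
    unfolding add_on_def
  proof (intro ballI)
    fix x y assume "x \<in> N3" "y \<in> N3"
    then obtain w k u l where x: "w \<in> W" "x = w + k \<cdot> e3" and y: "u \<in> W" "y = u + l \<cdot> e3"
      unfolding N3_def by (metis adjE)
    have val: "F (w + k \<cdot> e3) = F w + k \<cdot> F e3" if "w \<in> W" for w k
      using F_W[of "k \<cdot> e3" w] F(2)[OF e3(1)] asub_ism[OF asub_H e3(1)] that by (simp add: add.commute)
    have "x + y = (w + u) + (k + l) \<cdot> e3" using x y by (simp add: ism_add_left)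
    then have "F (x + y) = F (w + u) + (k + l) \<cdot> F e3" using val[OF asub_add[OF W(1) x(1) y(1)]] by simp
    then show "F (x + y) = F x + F y"
      using F_W[of w u] x y W val by (simp add: ism_add_left subset_iff)
  qed
  have K: "asub (F ` N3)" using asub_image[OF iF N3(1)] .
  have hom: "F (k \<cdot> x) - k \<cdot> F x \<in> F ` N3" if "x \<in> H" for x k using F(2)[OF that] asub_0[OF K] by simp
  \<comment> \<open>\<open>A\<close> acts trivially on \<open>N4\<close> modulo \<open>N3\<close>,
    so increments along \<open>N4\<close> are determined modulo the image of \<open>N3\<close>; and
    \<open>N4\<close> has index \<open>p\<close> in \<open>H\<close>.\<close>
  have add4: "F (x + n) - F x - F n \<in> F ` N3" if "x \<in> H" "n \<in> N4" for x n
    by (rule same_add_mod[OF same_refl[OF iF] N4'(1,2) N3(1) N4'(3) _ that]) (rule N4(2))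
  have add: "F (x + y) - F x - F y \<in> F ` N3" if "x \<in> H" "y \<in> H" for x y
    using codim1_additive[OF N4'(1,2) e5(1) N5 K hom add4 that] .
  have Fp: "int p \<cdot> F x = 0" if "x \<in> H" for x using p_H iso_H[OF iF that] by blast
  have "\<forall>n\<in>N3. F n - F n \<in> F ` N3" using asub_0[OF K] by simp
  then obtain L where L: "add_on H L" "\<forall>n\<in>N3. L n = F n" "\<forall>x\<in>H. L x - F x \<in> F ` N3"
    using extend_add_mod[OF N3'(1,2) F3 _ K Fp hom add] by blast
  have KH: "F ` N3 \<subseteq> H" using iso_H[OF iF] N3'(2) by blast
  have LH: "L x \<in> H" if "x \<in> H" for x
    using asub_add[OF asub_H subsetD[OF KH bspec[OF L(3) that]] iso_H[OF iF that]] by simp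
  \<comment> \<open>\<open>L\<close> and \<open>F\<close> differ by elements of the image of
    \<open>N3\<close>, so the kernel of \<open>L\<close> lies in \<open>N3\<close>, where
    \<open>L\<close> equals \<open>F\<close>.\<close>
  have "inj_on L H"
  proof (rule add_on_inj[OF asub_H L(1)])
    fix x assume x: "x \<in> H" "L x = 0"
    then have "F x \<in> F ` N3" using asub_minus[OF K bspec[OF L(3) x(1)]] by simp
    then have "x \<in> N3" using iso_inj[OF iF x(1)] N3'(2) by blast
    then have "F x = F 0" using L(2) x iso_0[OF iF] by simp
    then show "x = 0" using iso_inj[OF iF x(1)] asub_0[OF asub_H] by blast
  qed
  then have bijL: "bij_betw L H H" using LH fin_H by (simp add: bij_betw_def endo_inj_surj image_subset_iff)
  define g where "g = inv_into H L \<circ> F"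
  have ig: "iso g" unfolding g_def using iso_linear_inverse[OF iF bijL L(1)] .
  have Lg: "L (g x) = F x" if "x \<in> H" for x
    unfolding g_def using bij_betw_inv_into_right[OF bijL iso_H[OF iF that]] by simp
  have gL: "g x = y" if "x \<in> H" "y \<in> H" "F x = L y" for x y
    unfolding g_def using bij_betw_inv_into_left[OF bijL that(2)] that(3) by simp
  interpret normal_iso p H A g W e3
  proof unfold_locales
    show "g (k \<cdot> x) = k \<cdot> g x" if x: "x \<in> H" for x k
    proof (rule gL)
      show "F (k \<cdot> x) = L (k \<cdot> g x)"
        using F(2)[OF x] add_on_ism[OF asub_H L(1) iso_H[OF ig x]] Lg[OF x] by simp
    qed (use x iso_H[OF ig x] asub_ism[OF asub_H] in auto)
    show "g n = n" if "n \<in> adj W e3" for n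
      using gL[of n n] L(2) N3'(2) that unfolding N3_def by auto
    show "g x - x \<in> adj W e3" if x: "x \<in> H" for x
    proof -
      have "L (g x - x) = F x - L x" using add_on_diff[OF asub_H L(1) iso_H[OF ig x] x] Lg[OF x] by simp
      also have "\<dots> = - (L x - F x)" by simp
      finally have "L (g x - x) \<in> F ` N3" using asub_minus[OF K bspec[OF L(3) x]] by simp
      then obtain n where n: "n \<in> N3" "L (g x - x) = L n" using L(2) by auto
      then have "g x - x = n"
        using inj_onD[OF \<open>inj_on L H\<close> n(2)] asub_diff[OF asub_H iso_H[OF ig x] x] N3'(2) by blast
      then show ?thesis using n(1) by (simp add: N3_def)
    qed
  qed (use odd_p W e3 fixW card_H ig in auto)
  obtain L' where L': "bij_betw L' H H" "add_on H L'" "\<forall>v\<in>H. \<exists>a\<in>A. g v = L' (a v)"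
    using linearizable unfolding linearizable_def by blast
  have L'H: "L' x \<in> H" if "x \<in> H" for x using L'(1) that bij_betwE by blast
  have "\<exists>a\<in>A. f v = (L \<circ> L') (a v)" if v: "v \<in> H" for v
  proof -
    obtain b where b: "b \<in> A" "f v = F (b v)" using sameE[OF same_sym[OF F(1)] v] .
    obtain a where a: "a \<in> A" "g (b v) = L' (a (b v))" using L'(3) b v by auto
    have "f v = (L \<circ> L') ((a \<circ> b) v)" using b a Lg[of "b v"] v by simp
    then show ?thesis using A_comp[OF a(1) b(1)] by blast
  qed
  moreover have "add_on H (L \<circ> L')" using L(1) L'(2) L'H by (simp add: add_on_def)
  ultimately show ?thesis using bij_betw_trans[OF L'(1) bijL] by blast
qed

end

subsection \<open>Embedding \<open>Zp5\<close> into a type of class \<open>ab_group_add\<close>\<close>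

text \<open>\<open>vadd p\<close> is a group operation only on a subset of its type. The coordinatewise map
  \<open>a \<mapsto> a / p\<close> into vectors over \<open>\<rat> / \<int>\<close> turns it into the addition of a group type.\<close>

quotient_type qz = rat / "\<lambda>x y. x - y \<in> \<int>"
  morphisms rep_qz qz_of
proof (rule equivpI)
  show "reflp (\<lambda>x y :: rat. x - y \<in> \<int>)" by (simp add: reflp_def)
  show "symp (\<lambda>x y :: rat. x - y \<in> \<int>)" by (metis (no_types, lifting) sympI Ints_minus minus_diff_eq)
  show "transp (\<lambda>x y :: rat. x - y \<in> \<int>)"
  proof (rule transpI)
    fix x y z :: rat assume "x - y \<in> \<int>" "y - z \<in> \<int>"
    then have "(x - y) + (y - z) \<in> \<int>" by (rule Ints_add)
    then show "x - z \<in> \<int>" by simp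
  qed
qed

instantiation qz :: ab_group_add
begin

lift_definition zero_qz :: qz is 0 .

lift_definition plus_qz :: "qz \<Rightarrow> qz \<Rightarrow> qz" is "(+)"
proof -
  fix a b c d :: rat assume "a - b \<in> \<int>" "c - d \<in> \<int>"
  then have "(a - b) + (c - d) \<in> \<int>" by (rule Ints_add)
  then show "a + c - (b + d) \<in> \<int>" by (simp add: algebra_simps)
qed

lift_definition uminus_qz :: "qz \<Rightarrow> qz" is uminus
  by (metis Ints_minus minus_diff_minus)

lift_definition minus_qz :: "qz \<Rightarrow> qz \<Rightarrow> qz" is "(-)"
proof -
  fix a b c d :: rat assume "a - b \<in> \<int>" "c - d \<in> \<int>"
  then have "(a - b) - (c - d) \<in> \<int>" by (rule Ints_diff)
  then show "a - c - (b - d) \<in> \<int>" by (simp add: algebra_simps)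
qed

instance by standard (transfer; simp)+

end

lemma ism_fun: "(k \<cdot> v) i = k \<cdot> v i" for v :: "'a \<Rightarrow> 'b::ab_group_add"
proof (induction k rule: int_induct[where k = 0])
  case (step1 k) then show ?case by (simp add: ism_add_left)
next
  case (step2 k) then show ?case by (simp add: ism_diff_left fun_diff_def)
qed simp

lemma qz_of_eq_iff: "qz_of x = qz_of y \<longleftrightarrow> x - y \<in> \<int>"
  by (simp add: qz.abs_eq_iff)

lemma qz_of_add: "qz_of (x + y) = qz_of x + qz_of y"
  by (simp add: plus_qz.abs_eq)

lemma qz_of_0: "qz_of 0 = 0" by (simp add: zero_qz_def)

lemma ism_qz_of: "k \<cdot> qz_of x = qz_of (of_int k * x)"
proof (induction k rule: int_induct[where k = 0])
  case base show ?case by (simp add: qz_of_0)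
next
  case (step1 k) then show ?case by (simp add: ism_add_left qz_of_add distrib_right)
next
  case (step2 k)
  have "qz_of (of_int k * x) = qz_of (of_int (k - 1) * x) + qz_of x"
    by (simp add: qz_of_add[symmetric] left_diff_distrib)
  then show ?case using step2 by (simp add: ism_diff_left)
qed

text \<open>The rationals modulo the integers contain a cyclic group of every order, so one type
  serves for all \<open>p\<close>, which is a variable.\<close>

definition emb :: "nat \<Rightarrow> (nat \<Rightarrow> int) \<Rightarrow> nat \<Rightarrow> qz" where
  "emb p v = (\<lambda>i. qz_of (of_int (v i) / of_nat p))"

context
  fixes p :: nat
  assumes p: "p > 0"
begin

lemma qz_of_frac_eq_iff:
  "qz_of (of_int a / of_nat p) = qz_of (of_int b / of_nat p) \<longleftrightarrow> [a = b] (mod int p)"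
proof -
  have "(of_int a / of_nat p - of_int b / of_nat p :: rat) = of_int (a - b) / of_int (int p)"
    by (simp add: diff_divide_distrib)
  also have "\<dots> \<in> \<int> \<longleftrightarrow> int p dvd a - b"
    using p of_int_div_of_int_in_Ints_iff[of "a - b" "int p", where ?'a = rat] by simp
  finally show ?thesis by (simp add: qz_of_eq_iff cong_iff_dvd_diff)
qed

lemma emb_vadd: "emb p (vadd p x y) = emb p x + emb p y"
proof
  fix i
  have "qz_of (of_int ((x i + y i) mod int p) / of_nat p) = qz_of (of_int (x i + y i) / of_nat p)"
    unfolding qz_of_frac_eq_iff by simp
  then show "emb p (vadd p x y) i = (emb p x + emb p y) i"
    by (simp add: emb_def vadd_def add_divide_distrib qz_of_add)
qed

lemma emb_inj: "inj_on (emb p) (Zp5 p)"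
proof (rule inj_onI)
  fix x y assume x: "x \<in> Zp5 p" and y: "y \<in> Zp5 p" and eq: "emb p x = emb p y"
  show "x = y"
  proof
    fix i
    have "[x i = y i] (mod int p)" using fun_cong[OF eq, of i] by (simp add: emb_def qz_of_frac_eq_iff)
    moreover have "x i = 0 \<and> y i = 0 \<or> (0 \<le> x i \<and> x i < int p \<and> 0 \<le> y i \<and> y i < int p)"
      using x y by (cases "i < 5") (auto simp: Zp5_def)
    ultimately show "x i = y i" by (auto simp: cong_def)
  qed
qed

lemma ism_emb: "int p \<cdot> emb p x = 0"
proof
  fix i
  show "(int p \<cdot> emb p x) i = 0 i"
    using p qz_of_eq_iff[of "of_int (x i)" 0] by (simp add: ism_fun emb_def ism_qz_of qz_of_0)
qed

lemma vzero_Zp5: "vzero \<in> Zp5 p" using p by (simp add: vzero_def Zp5_def)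

lemma vadd_Zp5: "x \<in> Zp5 p \<Longrightarrow> y \<in> Zp5 p \<Longrightarrow> vadd p x y \<in> Zp5 p"
  using p by (auto simp: vadd_def Zp5_def)

lemma vneg_Zp5: "x \<in> Zp5 p \<Longrightarrow> vneg p x \<in> Zp5 p"
  using p by (auto simp: vneg_def Zp5_def)

lemma emb_vzero: "emb p vzero = 0"
  by (auto simp: emb_def vzero_def qz_of_0)

lemma emb_vneg: "emb p (vneg p x) = - emb p x"
proof -
  have "vadd p (vneg p x) x = vzero" by (auto simp: vadd_def vneg_def vzero_def mod_simps)
  then show ?thesis using emb_vadd[of "vneg p x" x] emb_vzero by (simp add: eq_neg_iff_add_eq_0)
qed

lemma asub_emb: "asub (emb p ` Zp5 p)"
  unfolding asub_def
proof (intro conjI ballI)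
  show "0 \<in> emb p ` Zp5 p" using emb_vzero vzero_Zp5 by (metis imageI)
  fix x y assume "x \<in> emb p ` Zp5 p" "y \<in> emb p ` Zp5 p"
  then obtain u v where u: "u \<in> Zp5 p" "x = emb p u" and v: "v \<in> Zp5 p" "y = emb p v" by blast
  have "x - y = emb p (vadd p u (vneg p v))" using u v by (simp add: emb_vadd emb_vneg)
  then show "x - y \<in> emb p ` Zp5 p" using u v vadd_Zp5 vneg_Zp5 by blast
qed

lemma card_Zp5: "card (Zp5 p) = p ^ 5" "finite (Zp5 p)"
proof -
  define S where "S = Pi\<^sub>E {..<5::nat} (\<lambda>_. {0..<int p})"
  have "bij_betw (\<lambda>v. restrict v {..<5}) (Zp5 p) S"
  \<comment> \<open>Beyond the five coordinates \<open>Zp5\<close> has the value 0 and the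
    extensional function space has \<open>undefined\<close>; the two maps exchange these
    defaults.\<close>
  proof (rule bij_betwI[where g = "\<lambda>v i. if i < 5 then v i else 0"])
    show "(\<lambda>v. restrict v {..<5}) \<in> Zp5 p \<rightarrow> S" by (auto simp: Zp5_def S_def)
    show "(\<lambda>v i. if i < 5 then v i else 0) \<in> S \<rightarrow> Zp5 p"
      by (auto simp: Zp5_def S_def PiE_iff)
    show "(\<lambda>i. if i < 5 then restrict x {..<5} i else 0) = x" if "x \<in> Zp5 p" for x
      using that by (auto simp: Zp5_def)
    show "restrict (\<lambda>i. if i < 5 then y i else 0) {..<5} = y" if "y \<in> S" for y
      using that by (auto simp: S_def PiE_iff extensional_def restrict_def)
  qed
  moreover have "finite S" "card S = p ^ 5" by (auto simp: S_def finite_PiE card_PiE)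
  ultimately show "card (Zp5 p) = p ^ 5" "finite (Zp5 p)"
    using bij_betw_same_card bij_betw_finite by metis+
qed

end

subsection \<open>Schur rings of orbits\<close>

locale zp_group =
  fixes p :: nat and A :: "((nat \<Rightarrow> int) \<Rightarrow> (nat \<Rightarrow> int)) set"
  assumes p0: "p > 0" and perm_A: "perm_group (Zp5 p) A" and A_Aut: "A \<subseteq> AutH p"
begin

abbreviation Z where "Z \<equiv> Zp5 p"
definition orbit where "orbit x = (\<lambda>a. a x) ` A"

lemmas fin_Z = card_Zp5(2)[OF p0]

lemma A_permutes: "a \<in> A \<Longrightarrow> a permutes Z" using A_Aut by (auto simp: AutH_def)

lemma A_Z: "a \<in> A \<Longrightarrow> a x \<in> Z \<longleftrightarrow> x \<in> Z" using A_permutes permutes_in_image by metis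

lemma A_vadd: "a \<in> A \<Longrightarrow> x \<in> Z \<Longrightarrow> y \<in> Z \<Longrightarrow> a (vadd p x y) = vadd p (a x) (a y)"
  using A_Aut by (auto simp: AutH_def)

lemma A_id: "id \<in> A" and A_comp: "a \<in> A \<Longrightarrow> b \<in> A \<Longrightarrow> a \<circ> b \<in> A" and A_inv: "a \<in> A \<Longrightarrow> inv a \<in> A"
  using perm_A by (auto simp: perm_group_def)

lemma A_inverse: "a \<in> A \<Longrightarrow> inv a (a x) = x" "a \<in> A \<Longrightarrow> a (inv a x) = x"
  using A_permutes permutes_inverses by metis+

lemma VHA_orbit: "VHA p A = orbit ` Z" by (auto simp: VHA_def orbit_def)

lemma orbit_self: "x \<in> orbit x" unfolding orbit_def using A_id by (metis id_apply image_eqI)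

lemma orbit_A: "a \<in> A \<Longrightarrow> y \<in> orbit x \<Longrightarrow> a y \<in> orbit x"
  unfolding orbit_def using A_comp by (metis (no_types, lifting) comp_apply image_iff)

lemma orbit_sym: "y \<in> orbit x \<Longrightarrow> x \<in> orbit y"
  unfolding orbit_def using A_inv A_inverse(1) by (metis (no_types, lifting) image_iff)

lemma orbit_eq: assumes "y \<in> orbit x" shows "orbit y = orbit x"
proof -
  have "orbit y \<subseteq> orbit x" if "y \<in> orbit x" for x y
    using orbit_A that unfolding orbit_def[of y] by blast
  then show ?thesis using assms orbit_sym by blast
qed

lemma orbit_Z: "x \<in> Z \<Longrightarrow> orbit x \<subseteq> Z" using A_Z by (auto simp: orbit_def)

text \<open>The span of the orbit sums consists of the functions on \<open>Z\<close> that are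
  constant on orbits. In this form closure under convolution becomes a question of
  invariance.\<close>

lemma qspan_VHA_iff:
  "u \<in> qspan (VHA p A) \<longleftrightarrow> (\<forall>x. x \<notin> Z \<longrightarrow> u x = 0) \<and> (\<forall>a\<in>A. \<forall>x\<in>Z. u (a x) = u x)"
proof
  assume "u \<in> qspan (VHA p A)"
  then obtain c where u: "u = (\<lambda>x. \<Sum>T\<in>VHA p A. c T * uline T x)" by (auto simp: qspan_def)
  have "u x = 0" if "x \<notin> Z" for x
    unfolding u using orbit_Z that by (intro sum.neutral) (auto simp: VHA_orbit uline_def)
  moreover have "u (a x) = u x" if "a \<in> A" "x \<in> Z" for a x
  proof -
    have "uline T (a x) = uline T x" if T: "T \<in> VHA p A" for T
    proof -
      have "a x \<in> T \<longleftrightarrow> x \<in> T"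
        using T orbit_A[OF \<open>a \<in> A\<close>] orbit_A[OF A_inv[OF \<open>a \<in> A\<close>], of "a x"] A_inverse(1)[OF \<open>a \<in> A\<close>]
        by (auto simp: VHA_orbit)
      then show ?thesis by (simp add: uline_def)
    qed
    then show ?thesis unfolding u by (intro sum.cong) auto
  qed
  ultimately show "(\<forall>x. x \<notin> Z \<longrightarrow> u x = 0) \<and> (\<forall>a\<in>A. \<forall>x\<in>Z. u (a x) = u x)" by blast
next
  assume u: "(\<forall>x. x \<notin> Z \<longrightarrow> u x = 0) \<and> (\<forall>a\<in>A. \<forall>x\<in>Z. u (a x) = u x)"
  define c where "c T = u (SOME x. x \<in> T)" for T
  have fin: "finite (VHA p A)" using fin_Z by (simp add: VHA_orbit)
  have "u x = (\<Sum>T\<in>VHA p A. c T * uline T x)" for x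
  proof (cases "x \<in> Z")
    case True
    have "(SOME y. y \<in> orbit x) \<in> orbit x" using orbit_self by (metis someI)
    then have "c (orbit x) = u x" unfolding c_def using u True by (auto simp: orbit_def)
    have other: "uline T x = 0" if T: "T \<in> VHA p A - {orbit x}" for T
    proof -
      have "x \<notin> T"
      proof
        assume "x \<in> T"
        then have "T = orbit x" using T orbit_eq by (auto simp: VHA_orbit)
        then show False using T by blast
      qed
      then show ?thesis by (simp add: uline_def)
    qed
    have "(\<Sum>T\<in>VHA p A. c T * uline T x) = c (orbit x) * uline (orbit x) x + (\<Sum>T\<in>VHA p A - {orbit x}. c T * uline T x)"
      using fin True by (intro sum.remove) (auto simp: VHA_orbit)
    also have "(\<Sum>T\<in>VHA p A - {orbit x}. c T * uline T x) = 0" using other by (intro sum.neutral) auto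
    finally show ?thesis using \<open>c (orbit x) = u x\<close> orbit_self by (simp add: uline_def)
  next
    case False
    then have "(\<Sum>T\<in>VHA p A. c T * uline T x) = 0"
      using orbit_Z by (intro sum.neutral) (auto simp: VHA_orbit uline_def)
    then show ?thesis using u False by simp
  qed
  then show "u \<in> qspan (VHA p A)" unfolding qspan_def by blast
qed

lemma emb_eqD: "emb p x = emb p y \<Longrightarrow> x \<in> Z \<Longrightarrow> y \<in> Z \<Longrightarrow> x = y"
  using inj_onD[OF emb_inj[OF p0]] .

text \<open>\<open>vadd\<close> is not a group operation on its whole type, so cancellation takes
  place after applying \<open>emb\<close>.\<close>

lemma A_vzero: assumes "a \<in> A" shows "a vzero = vzero"
proof -
  note z = vzero_Zp5[OF p0]
  have "vadd p vzero vzero = vzero" by (auto simp: vadd_def vzero_def)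
  then have "emb p (a vzero) = emb p (a vzero) + emb p (a vzero)"
    using A_vadd[OF assms z z] emb_vadd[OF p0] by metis
  then have "emb p (a vzero) = emb p vzero" using emb_vzero[OF p0] by simp
  then show ?thesis using emb_eqD A_Z[OF assms] z by blast
qed

lemma vadd_vzero: assumes "s \<in> Z" shows "vadd p vzero s = s"
proof -
  have "emb p (vadd p vzero s) = emb p s" using emb_vadd[OF p0] emb_vzero[OF p0] by simp
  then show ?thesis using emb_eqD vadd_Zp5[OF p0 vzero_Zp5[OF p0]] assms by blast
qed

lemma A_vneg: assumes a: "a \<in> A" and x: "x \<in> Z" shows "a (vneg p x) = vneg p (a x)"
proof -
  have n: "vneg p x \<in> Z" "vneg p (a x) \<in> Z" using vneg_Zp5[OF p0] A_Z[OF a] x by auto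
  have "vadd p (vneg p x) x = vzero" by (auto simp: vadd_def vneg_def vzero_def mod_simps)
  then have "emb p (a (vneg p x)) + emb p (a x) = 0"
    using A_vadd[OF a n(1) x] A_vzero[OF a] emb_vadd[OF p0] emb_vzero[OF p0] by metis
  then have "emb p (a (vneg p x)) = emb p (vneg p (a x))"
    by (simp add: emb_vneg[OF p0] eq_neg_iff_add_eq_0)
  then show ?thesis using emb_eqD A_Z[OF a] n by blast
qed

lemma schur_ring_VHA: "schur_ring p (VHA p A)"
  unfolding schur_ring_def
proof (intro conjI)
  show "\<forall>T\<in>VHA p A. T \<noteq> {}" using orbit_self by (auto simp: VHA_orbit)
  show "\<Union> (VHA p A) = Z" using orbit_self orbit_Z by (force simp: VHA_orbit)
  show "\<forall>T1\<in>VHA p A. \<forall>T2\<in>VHA p A. T1 \<noteq> T2 \<longrightarrow> T1 \<inter> T2 = {}"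
    unfolding VHA_orbit by (metis (no_types, lifting) disjoint_iff imageE orbit_eq)
  have "orbit vzero = {vzero}" using A_vzero A_id by (auto simp: orbit_def)
  then show "{vzero} \<in> VHA p A" using vzero_Zp5[OF p0] unfolding VHA_orbit by (metis imageI)
  show "\<forall>T\<in>VHA p A. vneg p ` T \<in> VHA p A"
  proof
    fix T assume "T \<in> VHA p A"
    then obtain x where x: "x \<in> Z" "T = orbit x" by (auto simp: VHA_orbit)
    then have "vneg p ` T = orbit (vneg p x)" using A_vneg by (auto simp: orbit_def image_image)
    then show "vneg p ` T \<in> VHA p A" using x vneg_Zp5[OF p0] by (simp add: VHA_orbit)
  qed
  show "\<forall>u\<in>qspan (VHA p A). \<forall>v\<in>qspan (VHA p A). gconv p u v \<in> qspan (VHA p A)"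
  proof (intro ballI)
    fix u v assume u: "u \<in> qspan (VHA p A)" and v: "v \<in> qspan (VHA p A)"
    have "gconv p u v x = 0" if "x \<notin> Z" for x
      unfolding gconv_def using vadd_Zp5[OF p0] that by (intro sum.neutral ballI) auto
    moreover have "gconv p u v (a x) = gconv p u v x" if a: "a \<in> A" and x: "x \<in> Z" for a x
    proof -
      have bij: "bij_betw a Z Z" using A_permutes[OF a] by (rule permutes_imp_bij)
      \<comment> \<open>Both summation variables are replaced by their images under
        \<open>a\<close>; as \<open>a\<close> is an automorphism, the condition on their sum is
        preserved.\<close>
      have reindex: "sum g Z = (\<Sum>z\<in>Z. g (a z))" for g :: "(nat \<Rightarrow> int) \<Rightarrow> rat"
        by (rule sum.reindex_bij_betw[OF bij, symmetric])
      let ?F = "\<lambda>y z. if vadd p y z = a x then u y * v z else 0"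
      have "gconv p u v (a x) = (\<Sum>y\<in>Z. \<Sum>z\<in>Z. ?F y (a z))"
        unfolding gconv_def by (intro sum.cong refl reindex)
      also have "\<dots> = (\<Sum>y\<in>Z. \<Sum>z\<in>Z. ?F (a y) (a z))" by (rule reindex)
      also have "\<dots> = gconv p u v x"
        unfolding gconv_def
      proof (intro sum.cong refl)
        fix y z assume y: "y \<in> Z" and z: "z \<in> Z"
        have "vadd p (a y) (a z) = a x \<longleftrightarrow> vadd p y z = x"
          using A_vadd[OF a y z] A_inverse(1)[OF a] by metis
        moreover have "u (a y) = u y" "v (a z) = v z" using u v a y z qspan_VHA_iff by blast+
        ultimately show "(if vadd p (a y) (a z) = a x then u (a y) * v (a z) else 0) =
            (if vadd p y z = x then u y * v z else 0)" by simp
      qed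
      finally show ?thesis .
    qed
    ultimately show "gconv p u v \<in> qspan (VHA p A)" using qspan_VHA_iff by blast
  qed
qed

end

section \<open>Automorphisms of the group acting on orbit S-rings\<close>

lemma AutH_comp: "f \<in> AutH p \<Longrightarrow> g \<in> AutH p \<Longrightarrow> f \<circ> g \<in> AutH p"
  by (auto simp: AutH_def permutes_compose permutes_in_image)

lemma AutH_inv: assumes "p > 0" "f \<in> AutH p" shows "inv f \<in> AutH p"
proof -
  have f: "f permutes Zp5 p" "\<And>x y. x \<in> Zp5 p \<Longrightarrow> y \<in> Zp5 p \<Longrightarrow> f (vadd p x y) = vadd p (f x) (f y)"
    using assms by (auto simp: AutH_def)
  have "inv f (vadd p x y) = vadd p (inv f x) (inv f y)" if "x \<in> Zp5 p" "y \<in> Zp5 p" for x y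
  proof -
    have "inv f x \<in> Zp5 p" "inv f y \<in> Zp5 p" using permutes_in_image[OF permutes_inv[OF f(1)]] that by auto
    from f(2)[OF this] have "f (vadd p (inv f x) (inv f y)) = vadd p x y"
      by (simp add: permutes_inverses(1)[OF f(1)])
    then show ?thesis using permutes_inverses(2)[OF f(1)] by metis
  qed
  then show ?thesis using permutes_inv[OF f(1)] by (simp add: AutH_def)
qed

lemma cay_image:
  assumes "\<sigma> \<in> AutH p" "T \<subseteq> Zp5 p"
  shows "map_prod \<sigma> \<sigma> ` cay p T = cay p (\<sigma> ` T)"
proof -
  have s: "\<sigma> permutes Zp5 p" "\<And>x y. x \<in> Zp5 p \<Longrightarrow> y \<in> Zp5 p \<Longrightarrow> \<sigma> (vadd p x y) = vadd p (\<sigma> x) (\<sigma> y)"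
    using assms(1) by (auto simp: AutH_def)
  have im: "\<sigma> ` Zp5 p = Zp5 p" using permutes_image[OF s(1)] .
  show ?thesis
  proof
    show "map_prod \<sigma> \<sigma> ` cay p T \<subseteq> cay p (\<sigma> ` T)"
    proof clarify
      fix x y assume "(x, y) \<in> cay p T"
      then obtain t where t: "x \<in> Zp5 p" "y = vadd p x t" "t \<in> T" by (auto simp: cay_def)
      then have "\<sigma> y = vadd p (\<sigma> x) (\<sigma> t)" "\<sigma> x \<in> Zp5 p" using s(2) assms(2) im by auto
      then show "(\<sigma> x, \<sigma> y) \<in> cay p (\<sigma> ` T)" using t(3) by (auto simp: cay_def)
    qed
    show "cay p (\<sigma> ` T) \<subseteq> map_prod \<sigma> \<sigma> ` cay p T"
    proof clarify
      fix a b assume "(a, b) \<in> cay p (\<sigma> ` T)"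
      then obtain s' where s': "a \<in> Zp5 p" "b = vadd p a (\<sigma> s')" "s' \<in> T" by (auto simp: cay_def)
      then obtain x where x: "x \<in> Zp5 p" "a = \<sigma> x" using im by blast
      then have "(a, b) = map_prod \<sigma> \<sigma> (x, vadd p x s')" using s' s(2) assms(2) by auto
      moreover have "(x, vadd p x s') \<in> cay p T" using x s' by (auto simp: cay_def)
      ultimately show "(a, b) \<in> map_prod \<sigma> \<sigma> ` cay p T" by blast
    qed
  qed
qed

context zp_group
begin

text \<open>The images of the \<open>A\<close>-orbits under \<sigma> are the orbits of the conjugate
  of \<open>A\<close> by \<sigma>, again a group of automorphisms.\<close>

lemma schur_ring_image:
  assumes \<sigma>: "\<sigma> \<in> AutH p"
  shows "schur_ring p ((`) \<sigma> ` VHA p A)"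
proof -
  have s: "\<sigma> permutes Z" using \<sigma> by (simp add: AutH_def)
  define C where "C = (\<lambda>a. \<sigma> \<circ> a \<circ> inv \<sigma>) ` A"
  have inv_s: "inv \<sigma> (\<sigma> x) = x" "\<sigma> (inv \<sigma> x) = x" for x using permutes_inverses[OF s] by auto
  have CA: "C \<subseteq> AutH p" using A_Aut AutH_comp AutH_inv[OF p0] \<sigma> by (auto simp: C_def)
  have "perm_group Z C"
    unfolding perm_group_def
  proof (intro conjI ballI)
    show "f permutes Z" if "f \<in> C" for f using that CA by (auto simp: AutH_def)
    have "\<sigma> \<circ> id \<circ> inv \<sigma> \<in> C" unfolding C_def using A_id by blast
    moreover have "\<sigma> \<circ> id \<circ> inv \<sigma> = id" using inv_s by auto
    ultimately show "id \<in> C" by simp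
    fix f assume "f \<in> C"
    then obtain a where a: "a \<in> A" "f = \<sigma> \<circ> a \<circ> inv \<sigma>" by (auto simp: C_def)
    have "f \<circ> (\<sigma> \<circ> inv a \<circ> inv \<sigma>) = id" "(\<sigma> \<circ> inv a \<circ> inv \<sigma>) \<circ> f = id"
      unfolding a(2) by (rule ext, simp add: inv_s A_inverse[OF a(1)])+
    then have "inv f = \<sigma> \<circ> inv a \<circ> inv \<sigma>" by (rule inv_unique_comp)
    then show "inv f \<in> C" using A_inv[OF a(1)] by (auto simp: C_def)
    fix g assume "g \<in> C"
    then obtain b where b: "b \<in> A" "g = \<sigma> \<circ> b \<circ> inv \<sigma>" by (auto simp: C_def)
    have "f \<circ> g = \<sigma> \<circ> (a \<circ> b) \<circ> inv \<sigma>" 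
      unfolding a(2) b(2) by (rule ext, simp add: inv_s)
    then show "f \<circ> g \<in> C" using A_comp[OF a(1) b(1)] by (auto simp: C_def)
  qed
  then interpret C: zp_group p C using CA p0 by unfold_locales
  have "(`) \<sigma> ` VHA p A = VHA p C"
  proof -
    have "C.orbit (\<sigma> x) = \<sigma> ` orbit x" for x
      unfolding C.orbit_def orbit_def unfolding C_def by (simp add: image_image inv_s)
    moreover have "\<sigma> ` Z = Z" using permutes_image[OF s] .
    ultimately show ?thesis unfolding VHA_orbit C.VHA_orbit by (metis (no_types, lifting) image_cong image_image)
  qed
  then show ?thesis using C.schur_ring_VHA by simp
qed

text \<open>The easy inclusion: \<open>a\<close> fixes every digraph, and \<sigma> turns the digraph
  of \<open>T\<close> into that of its image.\<close>

lemma AutS_AutH_subset: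
  assumes a: "a \<in> AutS p (VHA p A)" and \<sigma>: "\<sigma> \<in> AutH p"
  shows "\<sigma> \<circ> a \<in> IsoS p (VHA p A)"
proof -
  have "map_prod (\<sigma> \<circ> a) (\<sigma> \<circ> a) ` cay p T = cay p (\<sigma> ` T)" if T: "T \<in> VHA p A" for T
  proof -
    have "T \<subseteq> Z" using T orbit_Z by (auto simp: VHA_orbit)
    moreover have "map_prod a a ` cay p T = cay p T" using a T by (auto simp: AutS_def)
    moreover have "map_prod (\<sigma> \<circ> a) (\<sigma> \<circ> a) ` cay p T = map_prod \<sigma> \<sigma> ` map_prod a a ` cay p T"
      by (auto simp: image_image map_prod_def split_def)
    ultimately show ?thesis using cay_image[OF \<sigma>] by simp
  qed
  then have "(\<lambda>T. map_prod (\<sigma> \<circ> a) (\<sigma> \<circ> a) ` cay p T) ` VHA p A = cay p ` (`) \<sigma> ` VHA p A"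
    by (auto simp: image_image)
  moreover have "\<sigma> \<circ> a permutes Z" using a \<sigma> by (auto simp: AutS_def AutH_def intro: permutes_compose)
  ultimately show ?thesis unfolding IsoS_def using schur_ring_image[OF \<sigma>] by blast
qed

end

subsection \<open>The main theorem\<close>

locale zp_pgroup = zp_group +
  assumes prime_p: "prime p" and odd_p: "odd p" and card_A: "\<exists>k. card A = p ^ k"
    and cent: "card (centR p A) \<ge> p ^ 2"
begin

definition H where "H = emb p ` Z"
text \<open>Transport along \<open>emb\<close>, with the identity off \<open>H\<close> as
  \<open>permutes\<close> demands.\<close>

definition lft where "lft a = (\<lambda>v. if v \<in> H then emb p (a (inv_into Z (emb p) v)) else v)"

lemma bij_emb: "bij_betw (emb p) Z H"
  using emb_inj[OF p0] by (simp add: bij_betw_def H_def)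

lemma lft_emb: "x \<in> Z \<Longrightarrow> lft a (emb p x) = emb p (a x)"
  using inv_into_f_f[OF emb_inj[OF p0]] by (simp add: lft_def H_def)

lemma lft_permutes: "a permutes Z \<Longrightarrow> lft a permutes H"
  unfolding lft_def using permutes_bij_inv_into[OF _ bij_emb] .

lemma lft_comp: assumes "b permutes Z" shows "lft (a \<circ> b) = lft a \<circ> lft b"
proof
  fix v
  show "lft (a \<circ> b) v = (lft a \<circ> lft b) v"
  proof (cases "v \<in> H")
    case True
    then obtain x where "x \<in> Z" "v = emb p x" by (auto simp: H_def)
    then show ?thesis using lft_emb permutes_in_image[OF assms] by simp
  qed (simp add: lft_def)
qed

lemma lft_id: "lft id = id"
  using bij_betw_inv_into_right[OF bij_emb] by (auto simp: lft_def)

lemma lft_inj: "inj_on lft A"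
proof (rule inj_onI)
  fix a b assume a: "a \<in> A" and b: "b \<in> A" and eq: "lft a = lft b"
  show "a = b"
  proof
    fix x
    show "a x = b x"
    proof (cases "x \<in> Z")
      case True
      then have "emb p (a x) = emb p (b x)" using lft_emb eq by metis
      then show ?thesis using emb_eqD A_Z a b True by blast
    next
      case False then show ?thesis using A_permutes a b permutes_not_in by metis
    qed
  qed
qed

lemma lft_inv: assumes "a \<in> A" shows "inv (lft a) = lft (inv a)"
proof (rule inv_unique_comp)
  show "lft a \<circ> lft (inv a) = id" "lft (inv a) \<circ> lft a = id"
    using lft_comp[OF A_permutes[OF A_inv[OF assms]], of a] lft_comp[OF A_permutes[OF assms], of "inv a"]
      permutes_inv_o[OF A_permutes[OF assms]] lft_id by simp_all
qed

sublocale E: lin_act p H "lft ` A"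
proof unfold_locales
  show "prime p" using prime_p .
  show "asub H" unfolding H_def using asub_emb[OF p0] .
  show "finite H" using fin_Z by (simp add: H_def)
  show "int p \<cdot> x = 0" if "x \<in> H" for x using ism_emb[OF p0] that by (auto simp: H_def)
  show "perm_group H (lft ` A)"
    unfolding perm_group_def
  proof (intro conjI ballI)
    show "f permutes H" if "f \<in> lft ` A" for f using that lft_permutes A_permutes by blast
    show "id \<in> lft ` A" using A_id lft_id by (metis imageI)
    show "inv f \<in> lft ` A" if "f \<in> lft ` A" for f using that lft_inv A_inv by auto
    show "f \<circ> g \<in> lft ` A" if fg: "f \<in> lft ` A" "g \<in> lft ` A" for f g
    proof -
      obtain a b where "a \<in> A" "b \<in> A" "f = lft a" "g = lft b" using fg by blast
      then have "f \<circ> g = lft (a \<circ> b)" "a \<circ> b \<in> A" using lft_comp[OF A_permutes, of b a] A_comp by auto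
      then show ?thesis by blast
    qed
  qed
  show "add_on H f" if f: "f \<in> lft ` A" for f
    unfolding add_on_def
  proof (intro ballI)
    fix v w assume "v \<in> H" "w \<in> H"
    then obtain x y where x: "x \<in> Z" "v = emb p x" and y: "y \<in> Z" "w = emb p y" by (auto simp: H_def)
    obtain a where a: "a \<in> A" "f = lft a" using f by blast
    have "f (v + w) = lft a (emb p (vadd p x y))" using x y a emb_vadd[OF p0] by simp
    also have "\<dots> = emb p (a x) + emb p (a y)"
      using lft_emb[OF vadd_Zp5[OF p0 x(1) y(1)]] A_vadd[OF a(1) x(1) y(1)] emb_vadd[OF p0] by simp
    finally show "f (v + w) = f v + f w" using lft_emb x y a by simp
  qed
qed

lemma card_H: "card H = p ^ 5"
  using bij_betw_same_card[OF bij_emb] card_Zp5(1)[OF p0] by simp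

text \<open>If the translation by \<open>h\<close> commutes with \<open>a\<close>, evaluation at 0
  gives \<open>a h = h\<close>; so the centralising translations come from fixed vectors.\<close>

lemma card_fixed: "card {x\<in>H. \<forall>a\<in>lft ` A. a x = x} \<ge> p ^ 2"
proof -
  define F where "F = {x\<in>Z. \<forall>a\<in>A. a x = x}"
  have "centR p A \<subseteq> transl p ` F"
  proof
    fix t assume "t \<in> centR p A"
    then obtain h where h: "t = transl p h" "h \<in> Z" "\<forall>a\<in>A. transl p h \<circ> a = a \<circ> transl p h"
      unfolding centR_def by blast
    note z = vadd_vzero[OF h(2)]
    have "a h = h" if "a \<in> A" for a
    proof -
      have "transl p h (a vzero) = a (transl p h vzero)" using h(3) that by (metis comp_apply)
      then show ?thesis using A_vzero[OF that] z vzero_Zp5[OF p0] by (simp add: transl_def)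
    qed
    then show "t \<in> transl p ` F" using h by (simp add: F_def)
  qed
  moreover have finF: "finite F" using fin_Z by (simp add: F_def)
  ultimately have "card (centR p A) \<le> card F" by (meson card_image_le card_mono finite_imageI le_trans)
  also have "card F = card (emb p ` F)"
    using emb_inj[OF p0] by (intro card_image[symmetric]) (auto simp: F_def inj_on_def)
  also have "\<dots> \<le> card {x\<in>H. \<forall>a\<in>lft ` A. a x = x}"
  proof (rule card_mono)
    show "finite {x\<in>H. \<forall>a\<in>lft ` A. a x = x}" using E.fin_H by simp
    show "emb p ` F \<subseteq> {x\<in>H. \<forall>a\<in>lft ` A. a x = x}" using lft_emb by (auto simp: F_def H_def)
  qed
  finally show ?thesis using cent by simp
qed

text \<open>The linear map is found for \<open>f\<close> minus its value at 0 and transported back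
  to \<sigma>. The remaining factor \<open>b\<close> absorbs the translation, since differences
  along arcs are insensitive to it.\<close>

lemma IsoS_subset:
  assumes f: "f \<in> IsoS p (VHA p A)"
  shows "\<exists>\<sigma>\<in>AutH p. \<exists>a\<in>AutS p (VHA p A). f = \<sigma> \<circ> a"
proof -
  obtain B where fZ: "f permutes Z" and B: "schur_ring p B"
    "(\<lambda>T. map_prod f f ` cay p T) ` VHA p A = cay p ` B"
    using f by (auto simp: IsoS_def)
  note z = vzero_Zp5[OF p0]
  have fmem: "f x \<in> Z \<longleftrightarrow> x \<in> Z" for x using permutes_in_image[OF fZ] .
  have finj: "f x = f y \<longleftrightarrow> x = y" for x y using permutes_inj[OF fZ] by (simp add: inj_eq)
  define g where "g v = lft f v - emb p (f vzero)" for v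
  have g_emb: "g (emb p x) = emb p (f x) - emb p (f vzero)" if "x \<in> Z" for x
    using lft_emb[OF that] by (simp add: g_def)
  have f0H: "emb p (f vzero) \<in> H" using z fmem by (simp add: H_def)
  have "E.iso g"
  proof (rule E.isoI)
    have "bij_betw (lft f) H H" using permutes_imp_bij[OF lft_permutes[OF fZ]] .
    moreover have "bij_betw (\<lambda>v. v - emb p (f vzero)) H H"
      by (rule bij_betwI[where g = "\<lambda>v. v + emb p (f vzero)"])
        (use f0H asub_diff[OF E.asub_H] asub_add[OF E.asub_H] in auto)
    ultimately show "bij_betw g H H"
      using bij_betw_trans unfolding g_def comp_def by fastforce
    show "g 0 = 0" using g_emb[OF z] emb_vzero[OF p0] by simp
    fix v w assume "v \<in> H" "w \<in> H"
    then obtain x y where x: "x \<in> Z" "v = emb p x" and y: "y \<in> Z" "w = emb p y" by (auto simp: H_def)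
    \<comment> \<open>The arc from \<open>x\<close> to \<open>x + y\<close> goes to an arc of a
      Cayley digraph with some difference \<open>t\<close>. The arc with difference \<open>t\<close>
      that starts at the image of 0 belongs to the same digraph; its preimage starts at 0 and ends
      at some \<open>s\<close> in the orbit of \<open>y\<close>, so \<open>f\<close> at
      \<open>s\<close> exceeds \<open>f\<close> at 0 by \<open>t\<close>.\<close>
    have T: "orbit y \<in> VHA p A" using y by (simp add: VHA_orbit)
    then have "map_prod f f ` cay p (orbit y) \<in> cay p ` B" using B(2) by blast
    then obtain T' where T': "T' \<in> B" "map_prod f f ` cay p (orbit y) = cay p T'" by auto
    have "(x, vadd p x y) \<in> cay p (orbit y)" using x orbit_self by (auto simp: cay_def)
    then have "(f x, f (vadd p x y)) \<in> cay p T'" using T'(2) by force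
    then obtain t where t: "t \<in> T'" "f (vadd p x y) = vadd p (f x) t" by (auto simp: cay_def)
    have "(f vzero, vadd p (f vzero) t) \<in> cay p T'" using t z fmem by (auto simp: cay_def)
    then have "(f vzero, vadd p (f vzero) t) \<in> map_prod f f ` cay p (orbit y)" using T'(2) by blast
    then obtain u u' where u: "(u, u') \<in> cay p (orbit y)" "f u = f vzero" "f u' = vadd p (f vzero) t"
      by auto
    then obtain s where s: "s \<in> orbit y" "u' = vadd p vzero s" using finj by (auto simp: cay_def)
    obtain a where a: "a \<in> A" "s = a y" using s(1) by (auto simp: orbit_def)
    have sZ: "s \<in> Z" using a A_Z y by simp
    have "f s = vadd p (f vzero) t" using u s vadd_vzero[OF sZ] by simp
    then have gs: "g (emb p s) = emb p t" using g_emb[OF sZ] emb_vadd[OF p0] by simp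
    have "g (v + w) = emb p (f x) + emb p t - emb p (f vzero)"
      using x y t g_emb[OF vadd_Zp5[OF p0 x(1) y(1)]] emb_vadd[OF p0] by simp
    then have "g (v + w) = g v + g (lft a w)" using gs a x y g_emb lft_emb by simp
    then show "\<exists>a\<in>lft ` A. g (v + w) = g v + g (a w)" using a by blast
  qed
  moreover obtain k where "card (lft ` A) = p ^ k" using card_A lft_inj by (auto simp: card_image)
  ultimately obtain L where L: "bij_betw L H H" "add_on H L" "\<forall>v\<in>H. \<exists>a\<in>lft ` A. g v = L (a v)"
    using E.iso_agrees_with_linear[OF odd_p card_H _ card_fixed] by blast
  define \<sigma> where "\<sigma> x = (if x \<in> Z then inv_into Z (emb p) (L (emb p x)) else x)" for x
  have emb_H: "emb p x \<in> H" if "x \<in> Z" for x using that by (simp add: H_def)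
  have LH: "L v \<in> H" if "v \<in> H" for v using L(1) that bij_betwE by blast
  have \<sigma>: "\<sigma> x \<in> Z" "emb p (\<sigma> x) = L (emb p x)" if "x \<in> Z" for x
    using that bij_betw_inv_into_right[OF bij_emb LH[OF emb_H[OF that]]] inv_into_into[of "L (emb p x)" "emb p" Z]
      LH[OF emb_H[OF that]] by (auto simp: \<sigma>_def H_def)
  have \<sigma>perm: "\<sigma> permutes Z"
  proof (rule bij_imp_permutes)
    have "inj_on \<sigma> Z"
    proof (rule inj_onI)
      fix x y assume x: "x \<in> Z" and y: "y \<in> Z" and "\<sigma> x = \<sigma> y"
      then have "L (emb p x) = L (emb p y)" using \<sigma>(2) by metis
      then have "emb p x = emb p y" using L(1) emb_H x y by (meson bij_betw_def inj_onD)
      then show "x = y" using emb_eqD x y by blast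
    qed
    then show "bij_betw \<sigma> Z Z" using \<sigma>(1) fin_Z by (simp add: bij_betw_def endo_inj_surj image_subset_iff)
    show "\<sigma> x = x" if "x \<notin> Z" for x using that by (simp add: \<sigma>_def)
  qed
  have \<sigma>add: "\<sigma> (vadd p x y) = vadd p (\<sigma> x) (\<sigma> y)" if x: "x \<in> Z" and y: "y \<in> Z" for x y
  proof -
    have "emb p (\<sigma> (vadd p x y)) = L (emb p x + emb p y)"
      using \<sigma>(2)[OF vadd_Zp5[OF p0 x y]] emb_vadd[OF p0] by simp
    also have "\<dots> = emb p (vadd p (\<sigma> x) (\<sigma> y))"
      using add_onD[OF L(2) emb_H[OF x] emb_H[OF y]] \<sigma>(2) x y emb_vadd[OF p0] by simp
    finally show ?thesis
      using emb_eqD \<sigma>(1) vadd_Zp5[OF p0] x y by blast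
  qed
  have \<sigma>Aut: "\<sigma> \<in> AutH p" using \<sigma>perm \<sigma>add by (simp add: AutH_def)
  define b where "b = inv \<sigma> \<circ> f"
  have f_eq: "f = \<sigma> \<circ> b" using permutes_inverses(1)[OF \<sigma>perm] by (auto simp: b_def)
  have fb: "f y = \<sigma> (b y)" for y using permutes_inverses(1)[OF \<sigma>perm] by (simp add: b_def)
  have bZ: "b permutes Z" unfolding b_def using permutes_compose[OF fZ permutes_inv[OF \<sigma>perm]] .
  have "map_prod b b ` cay p T = cay p T" if T: "T \<in> VHA p A" for T
  proof -
    have TZ: "T \<subseteq> Z" using T orbit_Z by (auto simp: VHA_orbit)
    have sub: "map_prod b b ` cay p T \<subseteq> cay p T"
    proof clarify
      fix x x' assume "(x, x') \<in> cay p T"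
      then obtain s where s: "x \<in> Z" "s \<in> T" "x' = vadd p x s" by (auto simp: cay_def)
      have sZ: "s \<in> Z" using s TZ by blast
      obtain c where c: "c \<in> A" "g (emb p x + emb p s) = g (emb p x) + g (lft c (emb p s))"
        using E.iso_step[OF \<open>E.iso g\<close> emb_H[OF s(1)] emb_H[OF sZ]] by blast
      \<comment> \<open>\<open>b\<close> turns the difference \<open>s\<close> into
        \<open>d (c s)\<close>: \<open>c\<close> comes from the isomorphism property of
        \<open>g\<close>, and \<open>d\<close> from its agreement with \<open>L\<close> on
        orbits.\<close>
      let ?t = "c s"
      have tZ: "?t \<in> Z" using A_Z[OF c(1)] sZ by simp
      obtain d where d: "d \<in> A" "g (emb p ?t) = L (lft d (emb p ?t))" using L(3) emb_H[OF tZ] by blast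
      let ?u = "d ?t"
      have uZ: "?u \<in> Z" using A_Z[OF d(1)] tZ by simp
      have uT: "?u \<in> T"
      proof -
        obtain y where "T = orbit y" using T by (auto simp: VHA_orbit)
        then show ?thesis using orbit_A c(1) d(1) s(2) by blast
      qed
      have "emb p (f x') - emb p (f vzero) = emb p (f x) - emb p (f vzero) + L (emb p ?u)"
        using c(2) d(2) lft_emb sZ tZ s g_emb[OF s(1)] g_emb[OF vadd_Zp5[OF p0 s(1) sZ]] emb_vadd[OF p0] by simp
      then have "emb p (f x') = emb p (vadd p (f x) (\<sigma> ?u))"
        using \<sigma>(2)[OF uZ] emb_vadd[OF p0] by (simp add: algebra_simps)
      then have "f x' = vadd p (f x) (\<sigma> ?u)"
        using emb_eqD fmem vadd_Zp5[OF p0] s(1,3) sZ \<sigma>(1)[OF uZ] by simp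
      also have "\<dots> = \<sigma> (vadd p (b x) ?u)"
        using \<sigma>add[OF _ uZ, of "b x"] permutes_in_image[OF bZ] s(1) fb by simp
      finally have "b x' = vadd p (b x) ?u" unfolding b_def using permutes_inverses(2)[OF \<sigma>perm] by simp
      moreover have "b x \<in> Z" using permutes_in_image[OF bZ] s(1) by simp
      ultimately show "(b x, b x') \<in> cay p T" using uT by (auto simp: cay_def)
    qed
    have "cay p T \<subseteq> Z \<times> Z" using TZ vadd_Zp5[OF p0] by (auto simp: cay_def)
    then have "finite (cay p T)" using fin_Z finite_subset by blast
    moreover have "inj_on (map_prod b b) (cay p T)"
      using inj_on_subset[OF prod.inj_map[OF permutes_inj[OF bZ] permutes_inj[OF bZ]]] by blast
    ultimately show ?thesis using endo_inj_surj[OF _ sub] by blast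
  qed
  then have "b \<in> AutS p (VHA p A)" using bZ by (simp add: AutS_def)
  then show ?thesis using \<sigma>Aut f_eq by blast
qed

end

theorem theorem3p5:
  fixes p :: nat and A :: "((nat \<Rightarrow> int) \<Rightarrow> (nat \<Rightarrow> int)) set"
  assumes "prime p" and "odd p"
    and "perm_group (Zp5 p) A" and "A \<subseteq> AutH p" and "A \<noteq> AutH p"
    and "\<exists>k. card A = p ^ k"
    and "card (centR p A) \<ge> p ^ 2"
  shows "CI_schur_ring p (VHA p A)"
proof -
  interpret zp_pgroup p A
    using assms prime_gt_0_nat by unfold_locales auto
  have "IsoS p (VHA p A) = {\<sigma> \<circ> a | a \<sigma>. a \<in> AutS p (VHA p A) \<and> \<sigma> \<in> AutH p}"
    using IsoS_subset AutS_AutH_subset by blast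
  then show ?thesis using schur_ring_VHA by (simp add: CI_schur_ring_def)
qed

end
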